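(* Let $(M_t)_{0\le t<T}$ be a maximal solution of the $H^3$-flow $\frac{d}{dt}X=-H^3\nu$ of closed strictly convex hypersurfaces in $\mathbb{R}^{4}$, where $M_0$ is $2$-pinched. Let $$\phi=\frac{(a-b)^2+(a-c)^2+(b-c)^2}{(a+b+c)^2},$$ where $a,b,c$ are the principal curvatures. Then $\phi\le \tfrac18$ holds on $M_t$ for all $0\le t<T$.
   Context: Hypersurfaces are smooth, closed (compact, without boundary), embedded, of dimension $n=3$ in Euclidean $\mathbb{R}^4$, with outer unit normal $\nu$, induced metric $g_{ij}=\langle X_{,i},X_{,j}\rangle$, second fundamental form $h_{ij}=-\langle X_{,ij},\nu\rangle$, and principal curvatures $a=\lambda_1,\ b=\lambda_2,\ c=\lambda_3$ (the eigenvalues of $(h_{ij})$ with respect to $(g_{ij})$). Strictly convex means that all $\lambda_i>0$. $H=a+b+c$ is the mean curvature. A solution of the flow is a smooth time-dependent family of embeddings $X(\cdot,t)$ with image $M_t$, $0\le t<T$, satisfying $\frac{d}{dt}X=-H^3\nu$ and starting at $M_0$; it is maximal if it cannot be extended as a smooth solution beyond time $T$. $M_0$ is $2$-pinched if $\lambda_i/\lambda_j\le 2$ everywhere on $M_0$ for all $1\le i,j\le 3$. *)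

theory Defs
  imports "HOL-Analysis.Analysis"
begin

section \<open>Smooth maps and closed smooth 3-manifolds\<close>

text \<open>
  The derivatives are taken within \<open>S\<close>, so that the notion makes sense on sets such as
  \<open>U \<times> [0,T)\<close> with \<open>U\<close> open, where it means smoothness up to the boundary \<open>t = 0\<close>.
  All sets \<open>S\<close> used below are open or of this form, so derivatives within \<open>S\<close> are unique.
\<close>

primrec Ck_on :: "nat \<Rightarrow> 'a::euclidean_space set \<Rightarrow> ('a \<Rightarrow> 'b::real_normed_vector) \<Rightarrow> bool" where
  "Ck_on 0 S = (\<lambda>f. continuous_on S f)"
| "Ck_on (Suc k) S = (\<lambda>f. \<exists>D. (\<forall>x\<in>S. (f has_derivative D x) (at x within S)) \<and>
                            (\<forall>v. Ck_on k S (\<lambda>x. D x v)))"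

definition smooth_on :: "'a::euclidean_space set \<Rightarrow> ('a \<Rightarrow> 'b::real_normed_vector) \<Rightarrow> bool" where
  "smooth_on S f \<longleftrightarrow> (\<forall>k. Ck_on k S f)"

text \<open>
  A local parametrization (inverse of a chart) is a pair \<open>(U, \<psi>)\<close> of an open set of
  parameters and a map on it.
\<close>

type_synonym 'm parametrization = "(real^3) set \<times> (real^3 \<Rightarrow> 'm)"

text \<open>
  There is no boundary because all parameter domains are open in \<open>\<real>\<^sup>3\<close>.
  Second countability follows from compactness.
\<close>

definition closed_3_manifold :: "'m::t2_space set \<Rightarrow> 'm parametrization set \<Rightarrow> bool" where
  "closed_3_manifold M A \<longleftrightarrow>
     compact M \<and>
     (\<Union>(U, \<psi>)\<in>A. \<psi> ` U) = M \<and>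
     (\<forall>(U, \<psi>)\<in>A. open U \<and> openin (top_of_set M) (\<psi> ` U) \<and>
                 (\<exists>\<phi>. homeomorphism U (\<psi> ` U) \<psi> \<phi>)) \<and>
     (\<forall>(U, \<psi>)\<in>A. \<forall>(V, \<eta>)\<in>A.
        smooth_on {u\<in>U. \<psi> u \<in> \<eta> ` V} (\<lambda>u. inv_into V \<eta> (\<psi> u)))"


section \<open>Local geometry of a parametrized hypersurface in four-space\<close>

definition partial :: "3 \<Rightarrow> (real^3 \<Rightarrow> real^4) \<Rightarrow> real^3 \<Rightarrow> real^4" where
  "partial i F u = frechet_derivative F (at u) (axis i 1)"

definition first_form :: "(real^3 \<Rightarrow> real^4) \<Rightarrow> real^3 \<Rightarrow> real^3^3" where
  "first_form F u = (\<chi> i j. partial i F u \<bullet> partial j F u)"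

definition second_form :: "(real^3 \<Rightarrow> real^4) \<Rightarrow> real^4 \<Rightarrow> real^3 \<Rightarrow> real^3^3" where
  "second_form F n u = (\<chi> i j. - (partial j (partial i F) u \<bullet> n))"

text \<open>
  \<open>\<lambda>\<^sub>1, \<lambda>\<^sub>2, \<lambda>\<^sub>3\<close> are the eigenvalues of \<open>(h\<^sub>i\<^sub>j)\<close> with respect to \<open>(g\<^sub>i\<^sub>j)\<close>, listed
  with multiplicity (in any order): they belong to a basis of eigenvectors \<open>h v = \<lambda> g v\<close>.
\<close>

definition principal_curvatures ::
    "(real^3 \<Rightarrow> real^4) \<Rightarrow> real^4 \<Rightarrow> real^3 \<Rightarrow> real^3 \<Rightarrow> bool" where
  "principal_curvatures F n u l \<longleftrightarrow>
     (\<exists>v :: 3 \<Rightarrow> real^3. inj v \<and> independent (range v) \<and>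
        (\<forall>i. second_form F n u *v v i = (l $ i) *\<^sub>R (first_form F u *v v i)))"

definition mean_curvature :: "(real^3 \<Rightarrow> real^4) \<Rightarrow> real^4 \<Rightarrow> real^3 \<Rightarrow> real" where
  "mean_curvature F n u =
     (THE H. \<exists>l. principal_curvatures F n u l \<and> H = l $ 1 + l $ 2 + l $ 3)"

text \<open>
  \<open>n\<close> is the outer unit normal at \<open>F u\<close> of the closed hypersurface \<open>S\<close> locally
  parametrized by \<open>F\<close>. The sets \<^term>\<open>inside S\<close> and \<^term>\<open>outside S\<close> are the unions of
  the bounded and of the unbounded components of the complement of \<open>S\<close>.
\<close>

definition outer_unit_normal ::
    "(real^4) set \<Rightarrow> (real^3 \<Rightarrow> real^4) \<Rightarrow> real^3 \<Rightarrow> real^4 \<Rightarrow> bool" where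
  "outer_unit_normal S F u n \<longleftrightarrow>
     norm n = 1 \<and> (\<forall>i. n \<bullet> partial i F u = 0) \<and>
     (\<exists>\<epsilon>>0. \<forall>s. 0 < s \<and> s < \<epsilon> \<longrightarrow>
        F u + s *\<^sub>R n \<in> outside S \<and> F u - s *\<^sub>R n \<in> inside S)"


section \<open>Closed embedded hypersurfaces\<close>

definition smooth_embedding ::
    "'m::t2_space set \<Rightarrow> 'm parametrization set \<Rightarrow> ('m \<Rightarrow> real^4) \<Rightarrow> bool" where
  "smooth_embedding M A Y \<longleftrightarrow>
     (\<exists>Z. homeomorphism M (Y ` M) Y Z) \<and>
     (\<forall>(U, \<psi>)\<in>A. smooth_on U (Y \<circ> \<psi>) \<and>
        (\<forall>u\<in>U. inj (frechet_derivative (Y \<circ> \<psi>) (at u))))"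

definition outer_unit_normal_field ::
    "'m::t2_space set \<Rightarrow> 'm parametrization set \<Rightarrow> ('m \<Rightarrow> real^4) \<Rightarrow> ('m \<Rightarrow> real^4) \<Rightarrow> bool" where
  "outer_unit_normal_field M A Y \<nu> \<longleftrightarrow>
     (\<forall>(U, \<psi>)\<in>A. \<forall>u\<in>U. outer_unit_normal (Y ` M) (Y \<circ> \<psi>) u (\<nu> (\<psi> u)))"

text \<open>
  In the next definitions, \<open>Y\<close> is an embedding and \<open>\<nu>\<close> its outer unit normal field.
\<close>

definition strictly_convex ::
    "'m parametrization set \<Rightarrow> ('m \<Rightarrow> real^4) \<Rightarrow> ('m \<Rightarrow> real^4) \<Rightarrow> bool" where
  "strictly_convex A Y \<nu> \<longleftrightarrow>
     (\<forall>(U, \<psi>)\<in>A. \<forall>u\<in>U. \<forall>l. principal_curvatures (Y \<circ> \<psi>) (\<nu> (\<psi> u)) u l \<longrightarrow>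
        (\<forall>i. l $ i > 0))"

definition two_pinched ::
    "'m parametrization set \<Rightarrow> ('m \<Rightarrow> real^4) \<Rightarrow> ('m \<Rightarrow> real^4) \<Rightarrow> bool" where
  "two_pinched A Y \<nu> \<longleftrightarrow>
     (\<forall>(U, \<psi>)\<in>A. \<forall>u\<in>U. \<forall>l. principal_curvatures (Y \<circ> \<psi>) (\<nu> (\<psi> u)) u l \<longrightarrow>
        (\<forall>i j. l $ i / l $ j \<le> 2))"


section \<open>The flow by the cube of the mean curvature\<close>

definition time_interval :: "ereal \<Rightarrow> real set" where
  "time_interval T = {t. 0 \<le> t \<and> ereal t < T}"

text \<open>
  The final time \<open>T\<close> is allowed to be \<open>\<infinity>\<close>. The normal field \<open>\<nu>\<close> is determined by \<open>X\<close>.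
\<close>

definition H3_flow ::
    "'m::t2_space set \<Rightarrow> 'm parametrization set \<Rightarrow> ereal \<Rightarrow>
     (real \<Rightarrow> 'm \<Rightarrow> real^4) \<Rightarrow> (real \<Rightarrow> 'm \<Rightarrow> real^4) \<Rightarrow> bool" where
  "H3_flow M A T X \<nu> \<longleftrightarrow>
     0 < T \<and>
     (\<forall>(U, \<psi>)\<in>A. smooth_on (U \<times> time_interval T) (\<lambda>(u, t). X t (\<psi> u))) \<and>
     (\<forall>t\<in>time_interval T.
        smooth_embedding M A (X t) \<and> outer_unit_normal_field M A (X t) (\<nu> t)) \<and>
     (\<forall>(U, \<psi>)\<in>A. \<forall>u\<in>U. \<forall>t\<in>time_interval T.
        ((\<lambda>s. X s (\<psi> u)) has_vector_derivative
           - ((mean_curvature (X t \<circ> \<psi>) (\<nu> t (\<psi> u)) u ^ 3) *\<^sub>R \<nu> t (\<psi> u)))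
          (at t within time_interval T))"

definition maximal_H3_flow ::
    "'m::t2_space set \<Rightarrow> 'm parametrization set \<Rightarrow> ereal \<Rightarrow>
     (real \<Rightarrow> 'm \<Rightarrow> real^4) \<Rightarrow> (real \<Rightarrow> 'm \<Rightarrow> real^4) \<Rightarrow> bool" where
  "maximal_H3_flow M A T X \<nu> \<longleftrightarrow>
     H3_flow M A T X \<nu> \<and>
     \<not> (\<exists>T' X' \<nu>'. T < T' \<and> H3_flow M A T' X' \<nu>' \<and>
          (\<forall>t\<in>time_interval T. \<forall>p\<in>M. X' t p = X t p))"

definition phi :: "real \<Rightarrow> real \<Rightarrow> real \<Rightarrow> real" where
  "phi a b c = ((a - b)\<^sup>2 + (a - c)\<^sup>2 + (b - c)\<^sup>2) / (a + b + c)\<^sup>2"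

end

theory Submission
  imports Defs
begin

text \<open>
  With \<open>S = a\<^sup>2 + b\<^sup>2 + c\<^sup>2\<close> and \<open>H = a + b + c\<close>, the claim is \<open>P = 8 S - 3 H\<^sup>2 \<le> 0\<close>, and it is
  shown by the maximum principle for the operator \<open>L = \<partial>\<^sub>t - 3 H\<^sup>2 \<Delta>\<close>. At a spatial maximum with
  \<open>P = 0\<close> the value of \<open>L P\<close> is the sum of a reaction term \<open>32 H\<^sup>2 (S\<^sup>2 - H (a\<^sup>3 + b\<^sup>3 + c\<^sup>3))\<close>, which is
  negative because the point is not umbilic, and a gradient term that is nonpositive by the
  Codazzi equations and \<open>\<nabla>P = 0\<close>; the constant \<open>1/8\<close> is exactly the threshold for the latter.
  Since the gradient term is only controlled on the level \<open>P = 0\<close>, the argument is run at the last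
  time \<open>t\<^sub>0\<close> with \<open>P \<le> 0\<close>: there \<open>L P < 0\<close> at the zeros of \<open>P\<close>, hence nearby by continuity, so shortly
  after \<open>t\<^sub>0\<close> there is no positive space-time maximum near any point, and \<open>M\<close> is compact.
  The computation of \<open>L P\<close> takes place in coordinates that are normal at a single point and
  obtained from a chart by a quadratic change of variables.
\<close>

section \<open>Calculus of smooth maps\<close>

text \<open>The borderline shape is 2:1:1. The triple \<open>(2, 1, 1)\<close> is 2-pinched and has
  \<open>8 S = 3 H\<^sup>2\<close>, and the same ratios give equality in the gradient inequality, so
  the initial bound and the estimate of the gradient term are both sharp. The gradient term splits
  because the derivative \<open>T\<close> of the second fundamental form is totally symmetric: for
  each direction \<open>k\<close> only the three entries \<open>T i i k\<close> enter the derivative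
  of \<open>H\<close>, which leaves one inequality in three real variables per direction. Two
  obstacles shape the rest. The critical time may be \<open>t = 0\<close>, so all calculus,
  including the symmetry of mixed derivatives, takes place within sets \<open>V \<times> I\<close>
  that contain boundary points. Moreover, covariant derivatives are avoided: the operator is
  evaluated at the centre of normal coordinates, and nearby the same coordinate expression is kept,
  although it is no longer the geometric one. This suffices, because at a maximum every second
  derivative along a coordinate axis is nonpositive, whatever the coordinates.\<close>

lemma Ck_on_cong:
  assumes "Ck_on k S f" and "\<And>x. x \<in> S \<Longrightarrow> f x = g x"
  shows "Ck_on k S g"
proof (cases k)
  case 0
  then show ?thesis
    using assms by (auto intro: continuous_on_eq)
next
  case (Suc m)
  with assms(1) obtain D where D: "\<forall>x\<in>S. (f has_derivative D x) (at x within S)"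
    and C: "\<forall>v. Ck_on m S (\<lambda>x. D x v)"
    by auto
  have "(g has_derivative D x) (at x within S)" if "x \<in> S" for x
    using that assms(2) D by (metis has_derivative_transform)
  with C Suc show ?thesis
    by auto
qed

lemma Ck_on_SucD: "Ck_on (Suc k) S f \<Longrightarrow> Ck_on k S f"
proof (induction k arbitrary: f)
  case 0
  then show ?case by (auto intro: has_derivative_continuous_on)
next
  case (Suc k)
  then obtain D where D: "\<forall>x\<in>S. (f has_derivative D x) (at x within S)"
    and C: "\<forall>v. Ck_on (Suc k) S (\<lambda>x. D x v)"
    unfolding Ck_on.simps(2)[of "Suc k"] by blast
  then have "\<forall>v. Ck_on k S (\<lambda>x. D x v)"
    using Suc.IH by blast
  with D show ?case
    by auto
qed

lemma Ck_on_const: "Ck_on k S (\<lambda>x. c)"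
  by (induction k arbitrary: c) (auto intro!: exI[of _ "\<lambda>x v. 0"] continuous_on_const)

lemma Ck_on_add: "Ck_on k S f \<Longrightarrow> Ck_on k S g \<Longrightarrow> Ck_on k S (\<lambda>x. f x + g x)"
proof (induction k arbitrary: f g)
  case 0
  then show ?case by (auto intro: continuous_on_add)
next
  case (Suc k)
  then obtain D E where "\<forall>x\<in>S. (f has_derivative D x) (at x within S)" "\<forall>v. Ck_on k S (\<lambda>x. D x v)"
    "\<forall>x\<in>S. (g has_derivative E x) (at x within S)" "\<forall>v. Ck_on k S (\<lambda>x. E x v)"
    by auto
  with Suc.IH show ?case
    by (auto intro!: exI[of _ "\<lambda>x v. D x v + E x v"] has_derivative_add)
qed

lemma Ck_on_bounded_linear: "Ck_on k S f \<Longrightarrow> bounded_linear h \<Longrightarrow> Ck_on k S (\<lambda>x. h (f x))"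
proof (induction k arbitrary: f)
  case 0
  then show ?case by (auto intro: bounded_linear.continuous_on)
next
  case (Suc k)
  then obtain D where "\<forall>x\<in>S. (f has_derivative D x) (at x within S)" "\<forall>v. Ck_on k S (\<lambda>x. D x v)"
    by auto
  then have "\<forall>x\<in>S. ((\<lambda>x. h (f x)) has_derivative (\<lambda>v. h (D x v))) (at x within S)"
    and "\<forall>v. Ck_on k S (\<lambda>x. h (D x v))"
    using Suc bounded_linear.has_derivative by blast+
  then show ?case
    by auto
qed

lemma Ck_on_bounded_bilinear:
  assumes "bounded_bilinear h"
  shows "Ck_on k S f \<Longrightarrow> Ck_on k S g \<Longrightarrow> Ck_on k S (\<lambda>x. h (f x) (g x))"
proof (induction k arbitrary: f g)
  case 0
  then show ?case by (auto intro: bounded_bilinear.continuous_on[OF assms])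
next
  case (Suc k)
  then obtain D E where DE: "\<forall>x\<in>S. (f has_derivative D x) (at x within S)" "\<forall>v. Ck_on k S (\<lambda>x. D x v)"
    "\<forall>x\<in>S. (g has_derivative E x) (at x within S)" "\<forall>v. Ck_on k S (\<lambda>x. E x v)"
    by auto
  have "Ck_on k S f" "Ck_on k S g"
    using Suc.prems by (auto dest!: Ck_on_SucD simp del: Ck_on.simps)
  with DE Suc.IH have "\<forall>v. Ck_on k S (\<lambda>x. h (f x) (E x v) + h (D x v) (g x))"
    by (auto intro!: Ck_on_add)
  moreover have "\<forall>x\<in>S. ((\<lambda>x. h (f x) (g x)) has_derivative (\<lambda>v. h (f x) (E x v) + h (D x v) (g x))) (at x within S)"
    using DE by (auto intro!: bounded_bilinear.FDERIV[OF assms])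
  ultimately show ?case
    by auto
qed

lemmas Ck_on_mult = Ck_on_bounded_bilinear[OF bounded_bilinear_mult]
lemmas Ck_on_scaleR = Ck_on_bounded_bilinear[OF bounded_bilinear_scaleR]
lemmas Ck_on_inner = Ck_on_bounded_bilinear[OF bounded_bilinear_inner]
lemmas Ck_on_minus = Ck_on_bounded_linear[OF _ bounded_linear_minus[OF bounded_linear_ident]]

lemma Ck_on_inverse:
  fixes f :: "'a::euclidean_space \<Rightarrow> real"
  shows "Ck_on k S f \<Longrightarrow> (\<And>x. x \<in> S \<Longrightarrow> f x \<noteq> 0) \<Longrightarrow> Ck_on k S (\<lambda>x. inverse (f x))"
proof (induction k)
  case 0
  then show ?case by (auto intro: continuous_on_inverse)
next
  case (Suc k)
  then obtain D where D: "\<forall>x\<in>S. (f has_derivative D x) (at x within S)" "\<forall>v. Ck_on k S (\<lambda>x. D x v)"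
    by auto
  have "Ck_on k S (\<lambda>x. inverse (f x))"
    using Suc Ck_on_SucD by blast
  with D have "\<forall>v. Ck_on k S (\<lambda>x. - (inverse (f x) * D x v * inverse (f x)))"
    by (auto intro!: Ck_on_minus Ck_on_mult)
  moreover have "\<forall>x\<in>S. ((\<lambda>x. inverse (f x)) has_derivative (\<lambda>v. - (inverse (f x) * D x v * inverse (f x)))) (at x within S)"
    using D Suc.prems(2) by (auto intro!: has_derivative_inverse)
  ultimately show ?case
    by auto
qed

lemma Ck_on_sqrt:
  shows "Ck_on k S f \<Longrightarrow> (\<And>x. x \<in> S \<Longrightarrow> f x > 0) \<Longrightarrow> Ck_on k S (\<lambda>x. sqrt (f x))"
proof (induction k)
  case 0
  then show ?case by (auto intro: continuous_on_real_sqrt)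
next
  case (Suc k)
  then obtain D where D: "\<forall>x\<in>S. (f has_derivative D x) (at x within S)" "\<forall>v. Ck_on k S (\<lambda>x. D x v)"
    by auto
  have "Ck_on k S (\<lambda>x. sqrt (f x))"
    using Suc Ck_on_SucD by blast
  then have "Ck_on k S (\<lambda>x. inverse (sqrt (f x)))"
    using Suc.prems(2) by (intro Ck_on_inverse) (auto simp: less_le)
  with D have "\<forall>v. Ck_on k S (\<lambda>x. D x v * (inverse (sqrt (f x)) * (1 / 2)))"
    by (intro allI Ck_on_mult Ck_on_const) auto
  moreover have "\<forall>x\<in>S. ((\<lambda>x. sqrt (f x)) has_derivative (\<lambda>v. D x v * (inverse (sqrt (f x)) * (1 / 2)))) (at x within S)"
    using D Suc.prems(2) by (auto intro!: derivative_eq_intros simp: field_simps)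
  ultimately show ?case
    by auto
qed

lemma Ck_on_sum:
  "(\<And>i. i \<in> J \<Longrightarrow> Ck_on k S (f i)) \<Longrightarrow> Ck_on k S (\<lambda>x. \<Sum>i\<in>J. f i x)"
  by (induction J rule: infinite_finite_induct) (auto intro: Ck_on_const Ck_on_add)

lemma Ck_on_compose:
  fixes f :: "'b::euclidean_space \<Rightarrow> 'c::real_normed_vector"
    and p :: "'a::euclidean_space \<Rightarrow> 'b"
  shows "Ck_on k S f \<Longrightarrow> Ck_on k R p \<Longrightarrow> p ` R \<subseteq> S \<Longrightarrow> Ck_on k R (\<lambda>x. f (p x))"
proof (induction k arbitrary: f)
  case 0
  then show ?case by (auto intro: continuous_on_compose2)
next
  case (Suc k)
  then obtain D E where DE: "\<forall>x\<in>S. (f has_derivative D x) (at x within S)" "\<forall>v. Ck_on k S (\<lambda>x. D x v)"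
    "\<forall>x\<in>R. (p has_derivative E x) (at x within R)" "\<forall>v. Ck_on k R (\<lambda>x. E x v)"
    by auto
  have p: "Ck_on k R p"
    using Suc.prems Ck_on_SucD by blast
  \<comment> \<open>The induction hypothesis speaks of \<open>\<lambda>x. D x v\<close> with a fixed
    \<open>v\<close>, whereas in the chain rule the direction \<open>E x v\<close> moves with
    \<open>x\<close>. Expanding it in \<open>Basis\<close> leaves fixed directions with
    differentiable coefficients.\<close>
  have *: "(\<Sum>b\<in>Basis. (E x v \<bullet> b) *\<^sub>R D (p x) b) = D (p x) (E x v)" if "x \<in> R" for x v
  proof -
    have "linear (D (p x))"
      using DE(1) that Suc.prems(3) by (auto intro!: has_derivative_linear)
    then have "(\<Sum>b\<in>Basis. (E x v \<bullet> b) *\<^sub>R D (p x) b) = D (p x) (\<Sum>b\<in>Basis. (E x v \<bullet> b) *\<^sub>R b)"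
      by (simp add: linear_sum linear_scale)
    then show ?thesis
      by (simp add: euclidean_representation)
  qed
  have "\<forall>v. Ck_on k R (\<lambda>x. \<Sum>b\<in>Basis. (E x v \<bullet> b) *\<^sub>R D (p x) b)"
    using DE Suc.IH[OF spec[OF DE(2)] p Suc.prems(3)]
    by (intro allI Ck_on_sum Ck_on_scaleR Ck_on_inner Ck_on_const) auto
  then have "\<forall>v. Ck_on k R (\<lambda>x. D (p x) (E x v))"
    by (auto simp: * intro: Ck_on_cong)
  moreover have "\<forall>x\<in>R. ((\<lambda>x. f (p x)) has_derivative (\<lambda>v. D (p x) (E x v))) (at x within R)"
    using DE Suc.prems(3) has_derivative_in_compose2[of S f D p R]
    by blast
  ultimately show ?case
    by auto
qed

lemma smooth_on_cong: "smooth_on S f \<Longrightarrow> (\<And>x. x \<in> S \<Longrightarrow> f x = g x) \<Longrightarrow> smooth_on S g"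
  unfolding smooth_on_def using Ck_on_cong by blast

lemma smooth_on_const: "smooth_on S (\<lambda>x. c)"
  unfolding smooth_on_def using Ck_on_const by blast

lemma smooth_on_add: "smooth_on S f \<Longrightarrow> smooth_on S g \<Longrightarrow> smooth_on S (\<lambda>x. f x + g x)"
  unfolding smooth_on_def using Ck_on_add by blast

lemma smooth_on_bounded_linear: "bounded_linear h \<Longrightarrow> smooth_on S f \<Longrightarrow> smooth_on S (\<lambda>x. h (f x))"
  unfolding smooth_on_def using Ck_on_bounded_linear by blast

lemma smooth_on_ident: "smooth_on S (\<lambda>x. x)"
  unfolding smooth_on_def
proof
  show "Ck_on k S (\<lambda>x. x)" for k
    by (cases k) (auto intro!: exI[of _ "\<lambda>x v. v"] Ck_on_const continuous_on_id)
qed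

lemma smooth_on_linear: "bounded_linear h \<Longrightarrow> smooth_on S h"
  using smooth_on_bounded_linear[OF _ smooth_on_ident] .

lemma smooth_on_minus: "smooth_on S f \<Longrightarrow> smooth_on S (\<lambda>x. - f x)"
  unfolding smooth_on_def using Ck_on_minus by blast

lemma smooth_on_diff: "smooth_on S f \<Longrightarrow> smooth_on S g \<Longrightarrow> smooth_on S (\<lambda>x. f x - g x)"
  using smooth_on_add[OF _ smooth_on_minus] by fastforce

lemma smooth_on_bounded_bilinear:
  "bounded_bilinear h \<Longrightarrow> smooth_on S f \<Longrightarrow> smooth_on S g \<Longrightarrow> smooth_on S (\<lambda>x. h (f x) (g x))"
  unfolding smooth_on_def using Ck_on_bounded_bilinear by blast

lemmas smooth_on_mult = smooth_on_bounded_bilinear[OF bounded_bilinear_mult]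
lemmas smooth_on_scaleR = smooth_on_bounded_bilinear[OF bounded_bilinear_scaleR]
lemmas smooth_on_inner = smooth_on_bounded_bilinear[OF bounded_bilinear_inner]

lemma smooth_on_sum: "(\<And>i. i \<in> J \<Longrightarrow> smooth_on S (f i)) \<Longrightarrow> smooth_on S (\<lambda>x. \<Sum>i\<in>J. f i x)"
  unfolding smooth_on_def by (intro allI Ck_on_sum) simp

lemma smooth_on_inverse:
  fixes f :: "'a::euclidean_space \<Rightarrow> real"
  shows "smooth_on S f \<Longrightarrow> (\<And>x. x \<in> S \<Longrightarrow> f x \<noteq> 0) \<Longrightarrow> smooth_on S (\<lambda>x. inverse (f x))"
  unfolding smooth_on_def using Ck_on_inverse by blast

lemma smooth_on_sqrt: "smooth_on S f \<Longrightarrow> (\<And>x. x \<in> S \<Longrightarrow> f x > 0) \<Longrightarrow> smooth_on S (\<lambda>x. sqrt (f x))"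
  unfolding smooth_on_def using Ck_on_sqrt by blast

lemma smooth_on_compose:
  fixes f :: "'b::euclidean_space \<Rightarrow> 'c::real_normed_vector"
    and p :: "'a::euclidean_space \<Rightarrow> 'b"
  shows "smooth_on S f \<Longrightarrow> smooth_on R p \<Longrightarrow> p ` R \<subseteq> S \<Longrightarrow> smooth_on R (\<lambda>x. f (p x))"
  unfolding smooth_on_def using Ck_on_compose by blast

lemma smooth_on_imp_continuous_on: "smooth_on S f \<Longrightarrow> continuous_on S f"
  unfolding smooth_on_def by (metis Ck_on.simps(1))

lemmas smooth_intros = smooth_on_const smooth_on_ident smooth_on_add smooth_on_minus smooth_on_diff
  smooth_on_mult smooth_on_scaleR smooth_on_inner smooth_on_sum


section \<open>Directional derivatives\<close>

text \<open>The derivative is taken within \<open>Q\<close>, so that on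
  \<open>U \<times> [0,T)\<close> it is also meaningful at the initial time. The point comes last,
  so that \<open>dd Q v f\<close> is again a function and can be differentiated.\<close>

definition dd :: "'a::euclidean_space set \<Rightarrow> 'a \<Rightarrow> ('a \<Rightarrow> 'b::real_normed_vector) \<Rightarrow> 'a \<Rightarrow> 'b" where
  "dd Q v f x = frechet_derivative f (at x within Q) v"

text \<open>The two conditions are what a set with boundary has to provide. Small steps along every
  basis vector inside \<open>Q\<close> make the derivative within \<open>Q\<close> unique. Density
  of the interior lets equalities of continuous functions pass to the boundary, which is how second
  derivatives are shown to commute there.\<close>

locale smooth_domain =
  fixes Q :: "'a::euclidean_space set"
  assumes Basis_direction:
      "\<And>x b e. x \<in> Q \<Longrightarrow> b \<in> Basis \<Longrightarrow> e > 0 \<Longrightarrow> \<exists>d. 0 < \<bar>d\<bar> \<and> \<bar>d\<bar> < e \<and> x + d *\<^sub>R b \<in> Q"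
    and dense_interior: "Q \<subseteq> closure (interior Q)"
begin

lemma has_derivative_unique:
  assumes "(f has_derivative f') (at x within Q)" "(f has_derivative f'') (at x within Q)" "x \<in> Q"
  shows "f' = f''"
  using frechet_derivative_unique_within[OF assms(1,2)] Basis_direction[OF assms(3)] by blast

lemma dd_eqI:
  assumes "(f has_derivative f') (at x within Q)" "x \<in> Q"
  shows "dd Q v f x = f' v"
  unfolding dd_def
  using has_derivative_unique[OF _ assms] assms(1)
  by (metis differentiable_def frechet_derivative_works)

lemma smooth_has_derivative:
  assumes "smooth_on Q f" "x \<in> Q"
  shows "(f has_derivative (\<lambda>v. dd Q v f x)) (at x within Q)"
proof -
  have "Ck_on (Suc 0) Q f"
    using assms(1) by (auto simp: smooth_on_def simp del: Ck_on.simps)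
  then have "f differentiable (at x within Q)"
    using assms(2) by (auto simp: differentiable_def)
  then show ?thesis
    unfolding dd_def using frechet_derivative_works by blast
qed

lemma smooth_dd:
  assumes "smooth_on Q f"
  shows "smooth_on Q (dd Q v f)"
  unfolding smooth_on_def
proof
  fix k
  have "Ck_on (Suc k) Q f"
    using assms(1) by (auto simp: smooth_on_def simp del: Ck_on.simps)
  then obtain D where D: "\<forall>x\<in>Q. (f has_derivative D x) (at x within Q)" "\<forall>v. Ck_on k Q (\<lambda>x. D x v)"
    by auto
  then have "D x v = dd Q v f x" if "x \<in> Q" for x
    using that dd_eqI by metis
  then show "Ck_on k Q (dd Q v f)"
    using Ck_on_cong[OF spec[OF D(2), of v]] by blast
qed

lemma dd_cong:
  assumes "smooth_on Q f" "\<And>x. x \<in> Q \<Longrightarrow> f x = g x" "x \<in> Q"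
  shows "dd Q v f x = dd Q v g x"
proof -
  have "(g has_derivative (\<lambda>v. dd Q v f x)) (at x within Q)"
    using smooth_has_derivative[OF assms(1,3)] assms(2,3) by (metis has_derivative_transform)
  then show ?thesis
    using assms(3) by (simp add: dd_eqI)
qed

lemma dd_const: "x \<in> Q \<Longrightarrow> dd Q v (\<lambda>x. c) x = 0"
  by (rule dd_eqI) (auto intro!: derivative_eq_intros)

lemma dd_add:
  assumes "smooth_on Q f" "smooth_on Q g" "x \<in> Q"
  shows "dd Q v (\<lambda>x. f x + g x) x = dd Q v f x + dd Q v g x"
  by (rule dd_eqI[OF has_derivative_add[OF smooth_has_derivative smooth_has_derivative]]) (use assms in auto)

lemma dd_bounded_linear:
  assumes "bounded_linear h" "smooth_on Q f" "x \<in> Q"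
  shows "dd Q v (\<lambda>x. h (f x)) x = h (dd Q v f x)"
  by (rule dd_eqI[OF bounded_linear.has_derivative[OF assms(1) smooth_has_derivative]]) (use assms in auto)

lemmas dd_minus = dd_bounded_linear[OF bounded_linear_minus[OF bounded_linear_ident]]
lemmas dd_inner_const = dd_bounded_linear[OF bounded_linear_inner_left]
lemmas dd_mult_const = dd_bounded_linear[OF bounded_linear_mult_right]

lemma dd_bounded_bilinear:
  assumes "bounded_bilinear h" "smooth_on Q f" "smooth_on Q g" "x \<in> Q"
  shows "dd Q v (\<lambda>x. h (f x) (g x)) x = h (f x) (dd Q v g x) + h (dd Q v f x) (g x)"
  by (rule dd_eqI[OF bounded_bilinear.FDERIV[OF assms(1) smooth_has_derivative smooth_has_derivative]]) (use assms in auto)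

lemma dd_sum:
  assumes "\<And>i. i \<in> J \<Longrightarrow> smooth_on Q (f i)" "x \<in> Q"
  shows "dd Q v (\<lambda>x. \<Sum>i\<in>J. f i x) x = (\<Sum>i\<in>J. dd Q v (f i) x)"
  by (rule dd_eqI[OF has_derivative_sum[OF smooth_has_derivative]]) (use assms in auto)

lemma dd2_cong:
  assumes "smooth_on Q f" "\<And>x. x \<in> Q \<Longrightarrow> f x = g x" "x \<in> Q"
  shows "dd Q w (dd Q v f) x = dd Q w (dd Q v g) x"
  by (rule dd_cong[OF smooth_dd[OF assms(1)] dd_cong[OF assms(1,2)] assms(3)])

lemma dd2_bounded_bilinear:
  assumes h: "bounded_bilinear h" and f: "smooth_on Q f" and g: "smooth_on Q g" and x: "x \<in> Q"
  shows "dd Q w (dd Q v (\<lambda>x. h (f x) (g x))) x =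
    h (f x) (dd Q w (dd Q v g) x) + h (dd Q w f x) (dd Q v g x) +
    h (dd Q v f x) (dd Q w g x) + h (dd Q w (dd Q v f) x) (g x)"
proof -
  note s = f g smooth_dd[OF f] smooth_dd[OF g] smooth_on_bounded_bilinear[OF h] smooth_on_add smooth_dd
  have "dd Q w (dd Q v (\<lambda>x. h (f x) (g x))) x = dd Q w (\<lambda>x. h (f x) (dd Q v g x) + h (dd Q v f x) (g x)) x"
    by (rule dd_cong[OF smooth_dd]) (use s x dd_bounded_bilinear[OF h f g] in auto)
  also have "\<dots> = dd Q w (\<lambda>x. h (f x) (dd Q v g x)) x + dd Q w (\<lambda>x. h (dd Q v f x) (g x)) x"
    by (intro dd_add smooth_on_bounded_bilinear[OF h] s x)
  finally show ?thesis
    using s x by (simp add: dd_bounded_bilinear[OF h] algebra_simps)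
qed

lemma dd2_sum:
  assumes "\<And>i. i \<in> J \<Longrightarrow> smooth_on Q (f i)" "x \<in> Q"
  shows "dd Q w (dd Q v (\<lambda>x. \<Sum>i\<in>J. f i x)) x = (\<Sum>i\<in>J. dd Q w (dd Q v (f i)) x)"
proof -
  have "dd Q w (dd Q v (\<lambda>x. \<Sum>i\<in>J. f i x)) x = dd Q w (\<lambda>x. \<Sum>i\<in>J. dd Q v (f i) x) x"
    using assms by (intro dd_cong smooth_dd smooth_on_sum dd_sum)
  also have "\<dots> = (\<Sum>i\<in>J. dd Q w (dd Q v (f i)) x)"
    using assms by (intro dd_sum smooth_dd)
  finally show ?thesis .
qed

lemma dd_linear:
  assumes "smooth_on Q f" "x \<in> Q"
  shows "linear (\<lambda>v. dd Q v f x)"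
  using smooth_has_derivative[OF assms] has_derivative_linear by blast

end

section \<open>Symmetry of second derivatives, up to the boundary\<close>

context smooth_domain
begin

lemma dd_line:
  assumes "smooth_on Q f" "x + s *\<^sub>R v \<in> interior Q"
  shows "((\<lambda>s. f (x + s *\<^sub>R v)) has_vector_derivative dd Q v f (x + s *\<^sub>R v)) (at s)"
proof -
  let ?y = "x + s *\<^sub>R v"
  have "(f has_derivative (\<lambda>v. dd Q v f ?y)) (at ?y)"
    using smooth_has_derivative[OF assms(1), of ?y] assms(2) interior_subset
    by (metis at_within_interior subsetD)
  moreover have "((\<lambda>s. x + s *\<^sub>R v) has_derivative (\<lambda>s. s *\<^sub>R v)) (at s)"
    by (auto intro!: derivative_eq_intros)
  ultimately have "((\<lambda>s. f (x + s *\<^sub>R v)) has_derivative (\<lambda>r. dd Q (r *\<^sub>R v) f ?y)) (at s)"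
    using has_derivative_compose by blast
  moreover have "dd Q (r *\<^sub>R v) f ?y = r *\<^sub>R dd Q v f ?y" for r
    using dd_linear[OF assms(1)] assms(2) interior_subset linear_scale by blast
  ultimately show ?thesis
    by (simp add: has_vector_derivative_def)
qed

text \<open>The mean value theorem is applied twice: along \<open>v\<close> to the difference over
  \<open>w\<close>, then along \<open>w\<close> to the derivative in direction \<open>v\<close>. The
  second difference is symmetric in \<open>v\<close> and \<open>w\<close>, so comparing both orders
  shows that mixed derivatives agree.\<close>

lemma second_difference:
  fixes f :: "'a \<Rightarrow> real"
  assumes f: "smooth_on Q f" and "ball x r \<subseteq> interior Q" "s > 0" "s * (norm v + norm w) < r"
  shows "\<exists>z. dist x z \<le> s * (norm v + norm w) \<and>
    f (x + s *\<^sub>R v + s *\<^sub>R w) - f (x + s *\<^sub>R v) - f (x + s *\<^sub>R w) + f x = s * s * dd Q w (dd Q v f) z"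
proof -
  have near: "dist x (x + a *\<^sub>R v + b *\<^sub>R w) \<le> s * (norm v + norm w)"
    if "0 \<le> a" "a \<le> s" "0 \<le> b" "b \<le> s" for a b
  proof -
    have "dist x (x + a *\<^sub>R v + b *\<^sub>R w) = norm (a *\<^sub>R v + b *\<^sub>R w)"
      by (simp add: dist_norm norm_minus_commute algebra_simps)
    also have "\<dots> \<le> a * norm v + b * norm w"
      using that norm_triangle_ineq[of "a *\<^sub>R v" "b *\<^sub>R w"] by simp
    also have "\<dots> \<le> s * norm v + s * norm w"
      using that by (intro add_mono mult_right_mono) auto
    finally show ?thesis
      by (simp add: distrib_left)
  qed
  then have int: "x + a *\<^sub>R v + b *\<^sub>R w \<in> interior Q"
    if "0 \<le> a" "a \<le> s" "0 \<le> b" "b \<le> s" for a b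
    using that assms(2,4) by (meson le_less_trans mem_ball subsetD)
  define \<phi> where "\<phi> a = f (x + s *\<^sub>R w + a *\<^sub>R v) - f (x + a *\<^sub>R v)" for a
  have "\<exists>a>0. a < s \<and> \<phi> s - \<phi> 0 = (s - 0) * (dd Q v f (x + s *\<^sub>R w + a *\<^sub>R v) - dd Q v f (x + a *\<^sub>R v))"
  proof (rule MVT2[OF \<open>s > 0\<close>])
    fix a assume a: "0 \<le> a" "a \<le> s"
    have "((\<lambda>a. f (x + s *\<^sub>R w + a *\<^sub>R v)) has_real_derivative dd Q v f (x + s *\<^sub>R w + a *\<^sub>R v)) (at a)"
      using dd_line[OF f, of "x + s *\<^sub>R w" a v] int[of a s] a \<open>s > 0\<close>
      by (simp add: has_real_derivative_iff_has_vector_derivative ac_simps)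
    moreover have "((\<lambda>a. f (x + a *\<^sub>R v)) has_real_derivative dd Q v f (x + a *\<^sub>R v)) (at a)"
      using dd_line[OF f, of x a v] int[of a 0] a \<open>s > 0\<close>
      by (simp add: has_real_derivative_iff_has_vector_derivative ac_simps)
    ultimately show "(\<phi> has_real_derivative dd Q v f (x + s *\<^sub>R w + a *\<^sub>R v) - dd Q v f (x + a *\<^sub>R v)) (at a)"
      unfolding \<phi>_def by (rule DERIV_diff)
  qed
  then obtain a where a: "0 < a" "a < s"
    "\<phi> s - \<phi> 0 = s * (dd Q v f (x + s *\<^sub>R w + a *\<^sub>R v) - dd Q v f (x + a *\<^sub>R v))"
    by auto
  define \<psi> where "\<psi> b = dd Q v f (x + a *\<^sub>R v + b *\<^sub>R w)" for b
  have "\<exists>b>0. b < s \<and> \<psi> s - \<psi> 0 = (s - 0) * dd Q w (dd Q v f) (x + a *\<^sub>R v + b *\<^sub>R w)"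
  proof (rule MVT2[OF \<open>s > 0\<close>])
    fix b assume b: "0 \<le> b" "b \<le> s"
    show "(\<psi> has_real_derivative dd Q w (dd Q v f) (x + a *\<^sub>R v + b *\<^sub>R w)) (at b)"
      unfolding \<psi>_def has_real_derivative_iff_has_vector_derivative
      using dd_line[OF smooth_dd[OF f], of "x + a *\<^sub>R v" b w] int[of a b] a b by simp
  qed
  then obtain b where b: "0 < b" "b < s"
    "\<psi> s - \<psi> 0 = s * dd Q w (dd Q v f) (x + a *\<^sub>R v + b *\<^sub>R w)"
    by auto
  have "f (x + s *\<^sub>R v + s *\<^sub>R w) - f (x + s *\<^sub>R v) - f (x + s *\<^sub>R w) + f x = \<phi> s - \<phi> 0"
    by (simp add: \<phi>_def ac_simps)
  also have "\<dots> = s * (\<psi> s - \<psi> 0)"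
    by (simp add: a(3) \<psi>_def ac_simps)
  also have "\<dots> = s * s * dd Q w (dd Q v f) (x + a *\<^sub>R v + b *\<^sub>R w)"
    by (simp add: b(3))
  finally show ?thesis
    using near[of a b] a b by (intro exI[of _ "x + a *\<^sub>R v + b *\<^sub>R w"]) auto
qed

lemma dd_commute_interior:
  fixes f :: "'a \<Rightarrow> real"
  assumes f: "smooth_on Q f" and x: "x \<in> interior Q"
  shows "dd Q w (dd Q v f) x = dd Q v (dd Q w f) x"
proof (rule ccontr)
  let ?a = "dd Q w (dd Q v f)" and ?b = "dd Q v (dd Q w f)"
  assume neq: "?a x \<noteq> ?b x"
  define e where "e = \<bar>?a x - ?b x\<bar> / 2"
  have e: "e > 0"
    using neq by (simp add: e_def)
  have cont: "continuous (at x) ?a" "continuous (at x) ?b"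
    using smooth_on_imp_continuous_on[OF smooth_dd[OF smooth_dd[OF f]]] x
      continuous_on_interior by blast+
  obtain r where r: "r > 0" "ball x r \<subseteq> interior Q"
    using x by (meson open_contains_ball open_interior)
  obtain d1 where d1: "d1 > 0" "\<And>z. dist z x < d1 \<Longrightarrow> dist (?a z) (?a x) < e"
    using cont(1) e unfolding continuous_at_eps_delta by blast
  obtain d2 where d2: "d2 > 0" "\<And>z. dist z x < d2 \<Longrightarrow> dist (?b z) (?b x) < e"
    using cont(2) e unfolding continuous_at_eps_delta by blast
  \<comment> \<open>With this \<open>s\<close> the intermediate points stay within \<open>r\<close>,
    \<open>d1\<close> and \<open>d2\<close> of \<open>x\<close>; the summand \<open>1\<close>
    prevents a zero denominator when \<open>v\<close> and \<open>w\<close> vanish.\<close>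
  define s where "s = min r (min d1 d2) / (2 * (norm v + norm w + 1))"
  have N: "norm v + norm w + 1 > 0" "norm v + (norm w + 2) > 0"
    by (simp_all add: add_nonneg_pos)
  have s: "s > 0"
    using r d1 d2 N by (simp add: s_def)
  have "s * (norm v + norm w) < s * (2 * (norm v + norm w + 1))"
    using s N by (intro mult_strict_left_mono) auto
  also have "\<dots> = min r (min d1 d2)"
    using N by (simp add: s_def)
  finally have lt: "s * (norm v + norm w) < min r (min d1 d2)" .
  obtain z where z: "dist x z \<le> s * (norm v + norm w)"
    "f (x + s *\<^sub>R v + s *\<^sub>R w) - f (x + s *\<^sub>R v) - f (x + s *\<^sub>R w) + f x = s * s * ?a z"
    using second_difference[OF f r(2) s] lt by fastforce
  obtain z' where z': "dist x z' \<le> s * (norm w + norm v)"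
    "f (x + s *\<^sub>R w + s *\<^sub>R v) - f (x + s *\<^sub>R w) - f (x + s *\<^sub>R v) + f x = s * s * ?b z'"
    using second_difference[OF f r(2) s, of w v] lt by (auto simp: add.commute)
  have "s * s * ?a z = s * s * ?b z'"
    using z(2) z'(2) by (simp add: algebra_simps)
  then have "?a z = ?b z'"
    using s by simp
  moreover have "dist (?a z) (?a x) < e" "dist (?b z') (?b x) < e"
    using d1(2)[of z] d2(2)[of z'] z(1) z'(1) lt by (auto simp: dist_commute add.commute)
  ultimately show False
    using dist_triangle_half_l[of "?a x" "?a z" "2 * e" "?b x"]
    by (simp add: e_def dist_commute) (simp add: dist_real_def)
qed

text \<open>Interior points converge to \<open>x\<close>, and both mixed derivatives are continuous
  on \<open>Q\<close>, so the equality passes to the limit. This covers the initial time of a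
  space-time cylinder.\<close>

lemma dd_commute_real:
  fixes f :: "'a \<Rightarrow> real"
  assumes f: "smooth_on Q f" and x: "x \<in> Q"
  shows "dd Q w (dd Q v f) x = dd Q v (dd Q w f) x"
proof -
  let ?a = "dd Q w (dd Q v f)" and ?b = "dd Q v (dd Q w f)"
  obtain y where y: "\<And>n. y n \<in> interior Q" "y \<longlonglongrightarrow> x"
    using x dense_interior closure_sequential by (metis subsetD)
  have yQ: "y n \<in> Q" for n
    using y(1) interior_subset by blast
  have "continuous_on Q ?a" "continuous_on Q ?b"
    by (intro smooth_on_imp_continuous_on smooth_dd f)+
  then have "(\<lambda>n. ?a (y n)) \<longlonglongrightarrow> ?a x" "(\<lambda>n. ?b (y n)) \<longlonglongrightarrow> ?b x"
    using yQ y(2) x by (auto simp: continuous_on_sequentially o_def)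
  moreover have "?a (y n) = ?b (y n)" for n
    by (rule dd_commute_interior[OF f y(1)])
  ultimately show ?thesis
    using LIMSEQ_unique by auto
qed

lemma dd_commute:
  fixes f :: "'a \<Rightarrow> 'b::euclidean_space"
  assumes f: "smooth_on Q f" and x: "x \<in> Q"
  shows "dd Q w (dd Q v f) x = dd Q v (dd Q w f) x"
proof (rule euclidean_eqI)
  fix b :: 'b
  have *: "dd Q w (dd Q v f) x \<bullet> b = dd Q w (dd Q v (\<lambda>x. f x \<bullet> b)) x" for v w
  proof -
    have "dd Q w (dd Q v f) x \<bullet> b = dd Q w (\<lambda>x. dd Q v f x \<bullet> b) x"
      by (simp add: dd_inner_const[OF smooth_dd[OF f] x])
    also have "\<dots> = dd Q w (dd Q v (\<lambda>x. f x \<bullet> b)) x"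
      by (intro dd_cong smooth_on_inner smooth_dd f smooth_on_const dd_inner_const[symmetric] x)
    finally show ?thesis .
  qed
  show "dd Q w (dd Q v f) x \<bullet> b = dd Q v (dd Q w f) x \<bullet> b"
    unfolding * by (rule dd_commute_real[OF smooth_on_inner[OF f smooth_on_const] x])
qed

end

section \<open>Domains: open sets and cylinders over an interval\<close>

lemma smooth_domain_open:
  assumes "open U"
  shows "smooth_domain U"
proof
  fix x b :: 'a and e :: real
  assume xb: "x \<in> U" "b \<in> Basis" "e > 0"
  then obtain r where r: "r > 0" "ball x r \<subseteq> U"
    using assms open_contains_ball by blast
  then show "\<exists>d. 0 < \<bar>d\<bar> \<and> \<bar>d\<bar> < e \<and> x + d *\<^sub>R b \<in> U"
    using xb by (intro exI[of _ "min e r / 2"]) (auto simp: dist_norm subset_iff)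
next
  show "U \<subseteq> closure (interior U)"
    using assms by (simp add: interior_open closure_subset)
qed

lemma smooth_domain_times_interval:
  fixes V :: "'a::euclidean_space set" and I :: "real set"
  assumes V: "open V" and I: "convex I" "interior I \<noteq> {}"
  shows "smooth_domain (V \<times> I)"
proof
  fix x b :: "'a \<times> real" and e :: real
  assume xb: "x \<in> V \<times> I" "b \<in> Basis" "e > 0"
  obtain v t where x: "x = (v, t)" "v \<in> V" "t \<in> I"
    using xb(1) by auto
  from xb(2) consider a where "b = (a, 0)" "a \<in> Basis" | "b = (0, 1)"
    by (auto simp: Basis_prod_def)
  then show "\<exists>d. 0 < \<bar>d\<bar> \<and> \<bar>d\<bar> < e \<and> x + d *\<^sub>R b \<in> V \<times> I"
  proof cases
    case 1
    obtain d where "0 < \<bar>d\<bar>" "\<bar>d\<bar> < e" "v + d *\<^sub>R a \<in> V"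
      using smooth_domain.Basis_direction[OF smooth_domain_open[OF V] x(2) 1(2) xb(3)] by blast
    then show ?thesis
      using 1 x by auto
  next
    case 2
    obtain s where s: "s \<in> I" "s \<noteq> t"
    proof -
      obtain a where "a \<in> interior I"
        using I(2) by blast
      then obtain r where r: "r > 0" "ball a r \<subseteq> I"
        using mem_interior by blast
      then have "a \<in> I" "a + r / 2 \<in> I"
        by (auto simp: subset_iff dist_real_def)
      then show ?thesis
        using that[of a] that[of "a + r / 2"] r(1) by (cases "a = t") auto
    qed
    \<comment> \<open>The step goes a fraction \<open>c\<close> of the way from \<open>t\<close> to
      another point \<open>s\<close> of \<open>I\<close>. Convexity keeps it in \<open>I\<close>,
      and \<open>c\<close> makes it shorter than \<open>e\<close>. Its sign depends on
      \<open>s\<close>, which accommodates an endpoint \<open>t\<close> of \<open>I\<close>.\<close>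
    define c where "c = min 1 (e / (2 * \<bar>s - t\<bar>))"
    have c: "0 < c" "c \<le> 1" "c * \<bar>s - t\<bar> < e"
    proof -
      show "0 < c" "c \<le> 1"
        using s xb(3) by (auto simp: c_def)
      have "c * \<bar>s - t\<bar> \<le> e / (2 * \<bar>s - t\<bar>) * \<bar>s - t\<bar>"
        unfolding c_def by (intro mult_right_mono) auto
      also have "\<dots> = e / 2"
        using s by simp
      finally show "c * \<bar>s - t\<bar> < e"
        using xb(3) by simp
    qed
    have "t + c * (s - t) \<in> I"
      using convexD[OF I(1) x(3) s(1), of "1 - c" c] c by (simp add: algebra_simps)
    then show ?thesis
      using 2 x c s by (intro exI[of _ "c * (s - t)"]) (auto simp: abs_mult)
  qed
next
  have "I \<subseteq> closure (interior I)"
    using I by (simp add: convex_closure_interior closure_subset)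
  then show "V \<times> I \<subseteq> closure (interior (V \<times> I))"
    using V closure_subset by (fastforce simp: interior_Times closure_Times interior_open)
qed

context smooth_domain
begin

lemma dd_diff:
  assumes "smooth_on Q f" "smooth_on Q g" "x \<in> Q"
  shows "dd Q v (\<lambda>x. f x - g x) x = dd Q v f x - dd Q v g x"
  by (rule dd_eqI[OF has_derivative_diff[OF smooth_has_derivative smooth_has_derivative]]) (use assms in auto)

lemma dd2_diff:
  assumes "smooth_on Q f" "smooth_on Q g" "x \<in> Q"
  shows "dd Q w (dd Q v (\<lambda>x. f x - g x)) x = dd Q w (dd Q v f) x - dd Q w (dd Q v g) x"
proof -
  have "dd Q w (dd Q v (\<lambda>x. f x - g x)) x = dd Q w (\<lambda>x. dd Q v f x - dd Q v g x) x"
    by (rule dd_cong[OF smooth_dd dd_diff assms(3)]) (intro assms smooth_on_diff)+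
  then show ?thesis
    by (simp add: dd_diff smooth_dd assms)
qed

lemma dd2_bounded_linear:
  assumes h: "bounded_linear h" and f: "smooth_on Q f" and x: "x \<in> Q"
  shows "dd Q w (dd Q v (\<lambda>x. h (f x))) x = h (dd Q w (dd Q v f) x)"
proof -
  have "dd Q w (dd Q v (\<lambda>x. h (f x))) x = dd Q w (\<lambda>x. h (dd Q v f x)) x"
    by (rule dd_cong[OF smooth_dd dd_bounded_linear[OF h f] x]) (intro smooth_on_bounded_linear[OF h] f)+
  then show ?thesis
    by (simp add: dd_bounded_linear[OF h] smooth_dd f x)
qed

lemmas dd2_minus = dd2_bounded_linear[OF bounded_linear_minus[OF bounded_linear_ident]]
lemmas dd2_mult_const = dd2_bounded_linear[OF bounded_linear_mult_right]

end

section \<open>Derivatives along segments and at a maximum\<close>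

context smooth_domain
begin

text \<open>In contrast to \<open>dd_line\<close>, the segment only has to lie in \<open>Q\<close>.
  A spatial segment at time \<open>0\<close> consists of boundary points of the cylinder, so the
  chain rule is used within \<open>Q\<close>.\<close>

lemma dd_segment:
  assumes f: "smooth_on Q f" and seg: "\<And>s. \<bar>s\<bar> < r \<Longrightarrow> x + s *\<^sub>R v \<in> Q" and s: "\<bar>s\<bar> < r"
  shows "((\<lambda>s. f (x + s *\<^sub>R v)) has_vector_derivative dd Q v f (x + s *\<^sub>R v)) (at s)"
proof -
  let ?B = "{- r<..<r}"
  have sB: "s \<in> ?B"
    using s by auto
  have "((\<lambda>s. f (x + s *\<^sub>R v)) has_derivative (\<lambda>h. dd Q (h *\<^sub>R v) f (x + s *\<^sub>R v))) (at s within ?B)"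
  proof (rule has_derivative_in_compose2[of Q f "\<lambda>x v. dd Q v f x"])
    show "(\<lambda>s. x + s *\<^sub>R v) ` ?B \<subseteq> Q"
      using seg by auto
    show "((\<lambda>s. x + s *\<^sub>R v) has_derivative (\<lambda>h. h *\<^sub>R v)) (at s within ?B)"
      by (auto intro!: derivative_eq_intros)
  qed (use smooth_has_derivative[OF f] sB in auto)
  moreover have "dd Q (h *\<^sub>R v) f (x + s *\<^sub>R v) = h *\<^sub>R dd Q v f (x + s *\<^sub>R v)" for h
    by (rule linear_scale[OF dd_linear[OF f seg[OF s]]])
  moreover have "at s within ?B = at s"
    by (rule at_within_open[OF sB]) simp
  ultimately show ?thesis
    by (simp add: has_vector_derivative_def)
qed

lemma local_maximum_dd:
  fixes f :: "'a \<Rightarrow> real"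
  assumes f: "smooth_on Q f" and r: "r > 0" and seg: "\<And>s. \<bar>s\<bar> < r \<Longrightarrow> x + s *\<^sub>R v \<in> Q"
    and max: "\<And>s. \<bar>s\<bar> < r \<Longrightarrow> f (x + s *\<^sub>R v) \<le> f x"
  shows "dd Q v f x = 0" "dd Q v (dd Q v f) x \<le> 0"
proof -
  define \<phi> where "\<phi> s = f (x + s *\<^sub>R v)" for s
  define \<phi>' where "\<phi>' s = dd Q v f (x + s *\<^sub>R v)" for s
  have d1: "(\<phi> has_real_derivative \<phi>' s) (at s)" if "\<bar>s\<bar> < r" for s
    using dd_segment[OF f seg that]
    by (simp add: \<phi>_def[abs_def] \<phi>'_def has_real_derivative_iff_has_vector_derivative)
  have d2: "(\<phi>' has_real_derivative dd Q v (dd Q v f) x) (at 0)"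
    using dd_segment[OF smooth_dd[OF f] seg, of r 0] r
    by (simp add: \<phi>'_def[abs_def] has_real_derivative_iff_has_vector_derivative)
  have "\<phi>' 0 = 0"
  proof (rule DERIV_local_max[OF d1 r])
    show "\<forall>y. \<bar>0 - y\<bar> < r \<longrightarrow> \<phi> y \<le> \<phi> 0"
      using max by (simp add: \<phi>_def)
  qed (use r in simp)
  then show "dd Q v f x = 0"
    by (simp add: \<phi>'_def)
  show "dd Q v (dd Q v f) x \<le> 0"
  proof (rule ccontr)
    assume "\<not> ?thesis"
    then obtain d where d: "d > 0" "\<And>h. 0 < h \<Longrightarrow> h < d \<Longrightarrow> \<phi>' 0 < \<phi>' (0 + h)"
      using DERIV_pos_inc_right[OF d2] by auto
    define h where "h = min d r / 2"
    have h: "0 < h" "h < d" "h < r"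
      using d(1) r by (auto simp: h_def)
    have "\<exists>z>0. z < h \<and> \<phi> h - \<phi> 0 = (h - 0) * \<phi>' z"
      using h by (intro MVT2 d1) auto
    then obtain z where z: "0 < z" "z < h" "\<phi> h - \<phi> 0 = h * \<phi>' z"
      by auto
    then have "\<phi>' z > 0"
      using d(2)[of z] h \<open>\<phi>' 0 = 0\<close> by simp
    then have "\<phi> h - \<phi> 0 > 0"
      using z(3) h(1) by simp
    moreover have "\<phi> h \<le> \<phi> 0"
      using max[of h] h by (simp add: \<phi>_def)
    ultimately show False
      by simp
  qed
qed

end

section \<open>The gradient inequality\<close>

text \<open>Equality holds for \<open>a = 1/2\<close>, \<open>b = c = 1/4\<close>, \<open>y = z = x/2\<close>.\<close>

lemma pinching_line:
  fixes a b c x y z :: real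
  assumes abc: "a + b + c = 1" "a\<^sup>2 + b\<^sup>2 + c\<^sup>2 = 3 / 8"
    and xyz: "(a - 3/8) * x + (b - 3/8) * y + (c - 3/8) * z = 0"
  shows "2 * a * (x + y + z)\<^sup>2 \<le> x\<^sup>2 + 3 * y\<^sup>2 + 3 * z\<^sup>2 + 3 / 8 * (x + y + z)\<^sup>2"
proof -
  \<comment> \<open>\<open>s\<close> measures the distance from the equality case
    \<open>a = 1/2\<close>, and \<open>\<delta>\<close> is half the gap between \<open>b\<close> and
    \<open>c\<close>. The two conditions on \<open>a\<close>, \<open>b\<close>, \<open>c\<close>
    determine \<open>\<delta>\<^sup>2\<close> as a function of \<open>s\<close>, which forces
    \<open>0 \<le> s \<le> 1/3\<close>.\<close>
  define p q \<delta> s where "p = y + z" and "q = y - z" and "\<delta> = (b - c) / 2" and "s = 1 / 2 - a"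
  have c: "c = 1 - a - b"
    using abc by simp
  have yz: "y = (p + q) / 2" "z = (p - q) / 2"
    by (auto simp: p_def q_def)
  have \<delta>2: "\<delta>\<^sup>2 = 3 / 4 * s * (1 / 3 - s)"
  proof -
    have "4 * \<delta>\<^sup>2 = 2 * (a\<^sup>2 + b\<^sup>2 + c\<^sup>2) - 2 * a\<^sup>2 - (1 - a)\<^sup>2"
      unfolding \<delta>_def c by (simp add: power2_eq_square field_simps)
    then have "\<delta>\<^sup>2 = (3 / 4 - 2 * a\<^sup>2 - (1 - a)\<^sup>2) / 4"
      unfolding abc(2) by simp
    then show ?thesis
      unfolding s_def by (simp add: power2_eq_square field_simps)
  qed
  have rhs: "x\<^sup>2 + 3 * y\<^sup>2 + 3 * z\<^sup>2 + 3 / 8 * (x + y + z)\<^sup>2 - 2 * a * (x + y + z)\<^sup>2 =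
    x\<^sup>2 + 3 / 2 * p\<^sup>2 + 3 / 2 * q\<^sup>2 + (3 / 8 - 2 * a) * (x + p)\<^sup>2"
  proof -
    have "x + y + z = x + p" "3 * y\<^sup>2 + 3 * z\<^sup>2 = 3 / 2 * p\<^sup>2 + 3 / 2 * q\<^sup>2"
      by (simp_all add: p_def q_def power2_eq_square field_simps)
    then show ?thesis
      by (simp add: algebra_simps)
  qed
  have "x\<^sup>2 + 3 / 2 * p\<^sup>2 + 3 / 2 * q\<^sup>2 + (3 / 8 - 2 * a) * (x + p)\<^sup>2 \<ge> 0"
  \<comment> \<open>For a given sum \<open>x + p\<close> the minimum of
    \<open>x\<^sup>2 + 3/2 p\<^sup>2\<close> is \<open>3/5 (x + p)\<^sup>2\<close>. So the form is
    nonnegative for all \<open>x\<close>, \<open>p\<close>, \<open>q\<close> exactly while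
    \<open>2 a \<le> 3/8 + 3/5\<close>, which is the threshold \<open>39/80\<close>. Above it the
    linear relation \<open>xyz\<close> has to enter.\<close>
  proof (cases "a \<le> 39 / 80")
    case True
    have "x\<^sup>2 + 3 / 2 * p\<^sup>2 + 3 / 2 * q\<^sup>2 + (3 / 8 - 2 * a) * (x + p)\<^sup>2 =
      (2 * x - 3 * p)\<^sup>2 / 10 + 3 / 2 * q\<^sup>2 + (39 / 40 - 2 * a) * (x + p)\<^sup>2"
      by (simp add: power2_eq_square field_simps)
    also have "\<dots> \<ge> 0"
      using True by (intro add_nonneg_nonneg mult_nonneg_nonneg) auto
    finally show ?thesis .
  next
    case False
    \<comment> \<open>\<open>d\<close> vanishes in the equality case, and \<open>m\<close> is the
      coefficient \<open>a - 3/8\<close> of \<open>x\<close> in the relation \<open>xyz\<close>. In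
      these variables the relation becomes \<open>dm\<close>.\<close>
    define d m where "d = x - p" and "m = 1 / 8 - s"
    have s1: "s < 1 / 80"
      using False by (simp add: s_def)
    have s0: "s \<ge> 0"
    proof (rule ccontr)
      assume "\<not> s \<ge> 0"
      then have "3 / 4 * s * (1 / 3 - s) < 0"
        using mult_neg_pos[of "3 / 4 * s" "1 / 3 - s"] by simp
      with \<delta>2 show False
        by (metis not_less zero_le_power2)
    qed
    have dm: "d * m = s * p / 2 - \<delta> * q"
      using xyz unfolding yz d_def m_def s_def \<delta>_def c by (simp add: field_simps)
    have \<delta>s: "4 * \<delta>\<^sup>2 \<le> s"
      unfolding \<delta>2 using s0 by (simp add: field_simps)
    have m: "m \<ge> 9 / 80"
      using s1 by (simp add: m_def)
    \<comment> \<open>Written in \<open>p\<close>, \<open>q\<close>, \<open>d\<close> the form is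
      \<open>8 s p\<^sup>2 + (8 s - 1/2) p d + (3/8 + 2 s) d\<^sup>2 + 3/2 q\<^sup>2\<close>. It is
      split so that \<open>- p d / 2\<close>, the only term in \<open>p\<close> without a factor
      \<open>s\<close>, falls into the second part \<open>k2\<close>, where \<open>dm\<close>
      eliminates \<open>d\<close>.\<close>
    have "s * p\<^sup>2 + 8 * s * p * d + 3 / 8 * d\<^sup>2 = s * (p + 4 * d)\<^sup>2 + (3 / 8 - 16 * s) * d\<^sup>2"
      by (simp add: power2_eq_square field_simps)
    also have "\<dots> \<ge> 0"
      using s0 s1 by (intro add_nonneg_nonneg mult_nonneg_nonneg) auto
    finally have k1: "0 \<le> s * p\<^sup>2 + 8 * s * p * d + 3 / 8 * d\<^sup>2" .
    \<comment> \<open>The chain ends in \<open>m\<close> times the expression of \<open>k2\<close>,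
      after \<open>d * m\<close> is replaced by means of \<open>dm\<close>. The cross term with
      \<open>\<delta>\<close> is absorbed by a square thanks to
      \<open>4 \<delta>\<^sup>2 \<le> s\<close>, and \<open>m \<ge> 9/80\<close> gives
      \<open>7 m - 1/4 \<ge> 1/2\<close>.\<close>
    have "0 \<le> 2 * (\<delta> * p + q / 8)\<^sup>2 + (27 / 160 - 1 / 32) * q\<^sup>2"
      by (intro add_nonneg_nonneg mult_nonneg_nonneg) auto
    also have "\<dots> = (4 * \<delta>\<^sup>2) * (1 / 2) * p\<^sup>2 + \<delta> * p * q / 2 + 3 / 2 * (9 / 80) * q\<^sup>2"
      by (simp add: power2_eq_square field_simps)
    also have "\<dots> \<le> s * (7 * m - 1 / 4) * p\<^sup>2 + \<delta> * p * q / 2 + 3 / 2 * m * q\<^sup>2"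
      using \<delta>s m s0 by (intro add_mono mult_mono mult_right_mono mult_left_mono order_refl) auto
    also have "\<dots> = m * (7 * s * p\<^sup>2 + 3 / 2 * q\<^sup>2) - p / 2 * (d * m)"
      unfolding dm by (simp add: power2_eq_square field_simps)
    finally have "0 \<le> m * (7 * s * p\<^sup>2 + 3 / 2 * q\<^sup>2 - p / 2 * d)"
      by (simp add: algebra_simps)
    then have k2: "0 \<le> 7 * s * p\<^sup>2 + 3 / 2 * q\<^sup>2 - p / 2 * d"
      using m by (simp add: zero_le_mult_iff)
    have "x\<^sup>2 + 3 / 2 * p\<^sup>2 + 3 / 2 * q\<^sup>2 + (3 / 8 - 2 * a) * (x + p)\<^sup>2 =
      (s * p\<^sup>2 + 8 * s * p * d + 3 / 8 * d\<^sup>2) + (7 * s * p\<^sup>2 + 3 / 2 * q\<^sup>2 - p / 2 * d) + 2 * s * d\<^sup>2"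
      unfolding d_def s_def by (simp add: power2_eq_square field_simps)
    also have "\<dots> \<ge> 0"
      using add_nonneg_nonneg[OF add_nonneg_nonneg[OF k1 k2], of "2 * s * d\<^sup>2"] s0 by simp
    finally show ?thesis .
  qed
  with rhs show ?thesis
    by linarith
qed

text \<open>Homogeneity: \<open>a\<close>, \<open>b\<close>, \<open>c\<close> are divided by
  \<open>H\<close>, while \<open>x\<close>, \<open>y\<close>, \<open>z\<close> stay as they
  are.\<close>

lemma pinching_line_scaled:
  fixes a b c x y z H :: real
  assumes "H > 0" "a + b + c = H" "a\<^sup>2 + b\<^sup>2 + c\<^sup>2 = 3 / 8 * H\<^sup>2"
    and "a * x + b * y + c * z = 3 / 8 * H * (x + y + z)"
  shows "2 * a * (x + y + z)\<^sup>2 \<le> H * (x\<^sup>2 + 3 * y\<^sup>2 + 3 * z\<^sup>2 + 3 / 8 * (x + y + z)\<^sup>2)"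
proof -
  have "2 * (a / H) * (x + y + z)\<^sup>2 \<le> x\<^sup>2 + 3 * y\<^sup>2 + 3 * z\<^sup>2 + 3 / 8 * (x + y + z)\<^sup>2"
  proof (rule pinching_line)
    show "a / H + b / H + c / H = 1" "(a / H)\<^sup>2 + (b / H)\<^sup>2 + (c / H)\<^sup>2 = 3 / 8"
      using assms by (simp_all add: power_divide flip: add_divide_distrib)
    have "(a / H - 3 / 8) * x + (b / H - 3 / 8) * y + (c / H - 3 / 8) * z =
      (a * x + b * y + c * z - 3 / 8 * H * (x + y + z)) / H"
      using assms(1) by (simp add: field_simps)
    then show "(a / H - 3 / 8) * x + (b / H - 3 / 8) * y + (c / H - 3 / 8) * z = 0"
      by (simp add: assms(4))
  qed
  then show ?thesis
    using assms(1) by (simp add: field_simps)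
qed

text \<open>The left side is one eighth of \<open>L P\<close> at a critical point with
  \<open>P = 0\<close>. Here \<open>l\<close> are the principal curvatures, \<open>T\<close> is the
  derivative of the second fundamental form and \<open>B\<close> that of the mean curvature;
  \<open>sym\<close> contains the Codazzi equations, and \<open>crit\<close> says that the
  derivative of \<open>P\<close> vanishes. The gradient inequality is applied once in each of the
  three directions.\<close>

lemma reaction_gradient_negative:
  fixes l :: "3 \<Rightarrow> real" and T :: "3 \<Rightarrow> 3 \<Rightarrow> 3 \<Rightarrow> real"
  assumes pos: "\<And>i. l i > 0"
    and H: "H = (\<Sum>i\<in>UNIV. l i)" and S: "S = (\<Sum>i\<in>UNIV. (l i)\<^sup>2)" and C: "C = (\<Sum>i\<in>UNIV. (l i)^3)"
    and sym: "\<And>i j k. T i j k = T j i k" "\<And>i j k. T i j k = T i k j"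
    and B: "\<And>k. B k = (\<Sum>i\<in>UNIV. T i i k)"
    and SH: "S = 3 / 8 * H\<^sup>2"
    and crit: "\<And>k. (\<Sum>i\<in>UNIV. l i * T i i k) = 3 / 8 * H * B k"
  shows "6 * H\<^sup>2 * (S\<^sup>2 - H * C - (\<Sum>i\<in>UNIV. \<Sum>j\<in>UNIV. \<Sum>k\<in>UNIV. (T i j k)\<^sup>2)) +
    12 * H * (\<Sum>i\<in>UNIV. l i * (B i)\<^sup>2) + 2 * H^3 * C - 9 / 4 * H\<^sup>2 * (\<Sum>i\<in>UNIV. (B i)\<^sup>2) -
    3 / 4 * H^4 * S < 0"
proof -
  have H0: "H > 0"
    unfolding H by (intro sum_pos pos) auto
  have l3: "H = l 1 + l 2 + l 3" "S = (l 1)\<^sup>2 + (l 2)\<^sup>2 + (l 3)\<^sup>2" "C = l 1^3 + l 2^3 + l 3^3"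
    unfolding H S C by (simp_all add: sum_3)
  have T: "T 2 1 1 = T 1 1 2" "T 1 2 1 = T 1 1 2" "T 3 1 1 = T 1 1 3" "T 1 3 1 = T 1 1 3"
    "T 1 2 2 = T 2 2 1" "T 2 1 2 = T 2 2 1" "T 3 2 2 = T 2 2 3" "T 2 3 2 = T 2 2 3"
    "T 1 3 3 = T 3 3 1" "T 3 1 3 = T 3 3 1" "T 2 3 3 = T 3 3 2" "T 3 2 3 = T 3 3 2"
    "T 1 3 2 = T 1 2 3" "T 2 1 3 = T 1 2 3" "T 2 3 1 = T 1 2 3" "T 3 1 2 = T 1 2 3" "T 3 2 1 = T 1 2 3"
    using sym by metis+
  have B3: "B k = T 1 1 k + T 2 2 k + T 3 3 k" for k
    by (simp add: B sum_3)
  have crit3: "l 1 * T 1 1 k + l 2 * T 2 2 k + l 3 * T 3 3 k = 3 / 8 * H * B k" for k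
    using crit[of k] by (simp add: sum_3)
  have S3: "(l 1)\<^sup>2 + (l 2)\<^sup>2 + (l 3)\<^sup>2 = 3 / 8 * H\<^sup>2"
    using SH l3(2) by simp
  have g1: "2 * l 1 * (B 1)\<^sup>2 \<le> H * ((T 1 1 1)\<^sup>2 + 3 * (T 2 2 1)\<^sup>2 + 3 * (T 3 3 1)\<^sup>2 + 3 / 8 * (B 1)\<^sup>2)"
    unfolding B3 by (rule pinching_line_scaled[OF H0, of _ "l 2" "l 3"])
      (use l3 S3 crit3[of 1] B3 in auto)
  have g2: "2 * l 2 * (B 2)\<^sup>2 \<le> H * ((T 2 2 2)\<^sup>2 + 3 * (T 1 1 2)\<^sup>2 + 3 * (T 3 3 2)\<^sup>2 + 3 / 8 * (B 2)\<^sup>2)"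
  proof -
    have "2 * l 2 * (T 2 2 2 + T 1 1 2 + T 3 3 2)\<^sup>2 \<le>
      H * ((T 2 2 2)\<^sup>2 + 3 * (T 1 1 2)\<^sup>2 + 3 * (T 3 3 2)\<^sup>2 + 3 / 8 * (T 2 2 2 + T 1 1 2 + T 3 3 2)\<^sup>2)"
      by (rule pinching_line_scaled[OF H0, of _ "l 1" "l 3"])
        (use l3 S3 crit3[of 2] B3[of 2] in \<open>auto simp: add_ac\<close>)
    then show ?thesis
      by (simp add: B3 add_ac)
  qed
  have g3: "2 * l 3 * (B 3)\<^sup>2 \<le> H * ((T 3 3 3)\<^sup>2 + 3 * (T 1 1 3)\<^sup>2 + 3 * (T 2 2 3)\<^sup>2 + 3 / 8 * (B 3)\<^sup>2)"
  proof -
    have "2 * l 3 * (T 3 3 3 + T 1 1 3 + T 2 2 3)\<^sup>2 \<le>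
      H * ((T 3 3 3)\<^sup>2 + 3 * (T 1 1 3)\<^sup>2 + 3 * (T 2 2 3)\<^sup>2 + 3 / 8 * (T 3 3 3 + T 1 1 3 + T 2 2 3)\<^sup>2)"
      by (rule pinching_line_scaled[OF H0, of _ "l 1" "l 2"])
        (use l3 S3 crit3[of 3] B3[of 3] in \<open>auto simp: add_ac\<close>)
    then show ?thesis
      by (simp add: B3 add_ac)
  qed
  define N where "N = (\<Sum>i\<in>UNIV. \<Sum>j\<in>UNIV. \<Sum>k\<in>UNIV. (T i j k)\<^sup>2)"
  define b where "b = (\<Sum>i\<in>UNIV. (B i)\<^sup>2)"
  define e where "e = (\<Sum>i\<in>UNIV. l i * (B i)\<^sup>2)"
  \<comment> \<open>By total symmetry each \<open>T i i k\<close> with \<open>i \<noteq> k\<close>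
    occurs three times in the full sum; this is the weight \<open>3\<close> in
    \<open>pinching_line\<close>. The remaining entry \<open>T 1 2 3\<close> has a favourable
    sign.\<close>
  have N: "N = ((T 1 1 1)\<^sup>2 + 3 * (T 2 2 1)\<^sup>2 + 3 * (T 3 3 1)\<^sup>2) +
    ((T 2 2 2)\<^sup>2 + 3 * (T 1 1 2)\<^sup>2 + 3 * (T 3 3 2)\<^sup>2) +
    ((T 3 3 3)\<^sup>2 + 3 * (T 1 1 3)\<^sup>2 + 3 * (T 2 2 3)\<^sup>2) + 6 * (T 1 2 3)\<^sup>2"
    unfolding N_def by (simp add: sum_3 T)
  have "2 * e \<le> H * (N - 6 * (T 1 2 3)\<^sup>2 + 3 / 8 * b)"
    using g1 g2 g3 unfolding N b_def e_def sum_3 by (simp add: algebra_simps)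
  also have "\<dots> \<le> H * (N + 3 / 8 * b)"
    using H0 by (intro mult_left_mono) auto
  finally have grad: "6 * H * (2 * e) \<le> 6 * H * (H * (N + 3 / 8 * b))"
    using H0 by (intro mult_left_mono) auto
  \<comment> \<open>For positive curvatures this vanishes only if all are equal. Equal curvatures
    have \<open>S = H\<^sup>2 / 3\<close>, which differs from \<open>3/8 H\<^sup>2\<close>, so the
    sum is strictly positive.\<close>
  have "H * C - S\<^sup>2 = l 1 * l 2 * (l 1 - l 2)\<^sup>2 + l 1 * l 3 * (l 1 - l 3)\<^sup>2 + l 2 * l 3 * (l 2 - l 3)\<^sup>2"
    unfolding l3 by (simp add: power2_eq_square power3_eq_cube algebra_simps)
  moreover have "\<dots> > 0"
  proof -
    have nn: "l i * l j * (l i - l j)\<^sup>2 \<ge> 0" for i j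
      using pos[of i] pos[of j] by simp
    have p: "l i * l j * (l i - l j)\<^sup>2 > 0" if "l i \<noteq> l j" for i j
      using pos[of i] pos[of j] that by simp
    have "l 1 \<noteq> l 2 \<or> l 1 \<noteq> l 3"
    proof (rule ccontr)
      assume "\<not> ?thesis"
      then have "3 * (l 1)\<^sup>2 = 3 / 8 * (3 * l 1)\<^sup>2"
        using S3 l3(1) by (simp add: power2_eq_square)
      then show False
        using pos[of 1] by (simp add: power2_eq_square)
    qed
    then show ?thesis
      using nn[of 1 2] nn[of 1 3] nn[of 2 3] p[of 1 2] p[of 1 3] by linarith
  qed
  ultimately have "4 * H\<^sup>2 * (S\<^sup>2 - H * C) < 0"
    using H0 by (intro mult_pos_neg) auto
  \<comment> \<open>On the level \<open>S = 3/8 H\<^sup>2\<close> the terms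
    \<open>2 H\<^sup>3 C - 3/4 H\<^sup>4 S\<close> amount to
    \<open>2 H\<^sup>2 (H C - S\<^sup>2)\<close>, so a factor \<open>4\<close> of the original
    \<open>6\<close> remains in front of the reaction term.\<close>
  moreover have "6 * H\<^sup>2 * (S\<^sup>2 - H * C - N) + 12 * H * e + 2 * H^3 * C - 9 / 4 * H\<^sup>2 * b - 3 / 4 * H^4 * S
    = 4 * H\<^sup>2 * (S\<^sup>2 - H * C) + (6 * H * (2 * e) - 6 * H * (H * (N + 3 / 8 * b))) +
      2 * H\<^sup>2 * S * (S - 3 / 8 * H\<^sup>2)"
    by (simp add: power2_eq_square power3_eq_cube power4_eq_xxxx algebra_simps)
  moreover have "2 * H\<^sup>2 * S * (S - 3 / 8 * H\<^sup>2) = 0"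
    using SH by simp
  ultimately show ?thesis
    using grad unfolding N_def b_def e_def by linarith
qed

section \<open>Evolution at a point\<close>

text \<open>The frame and \<open>n\<close> are four independent vectors, hence they span four-space.
  Vector identities at the base point are thereby reduced to inner products with them.\<close>

lemma orthogonal_to_frame_imp_zero:
  fixes f :: "3 \<Rightarrow> real^4" and n v :: "real^4"
  assumes f: "inj f" "independent (range f)" and n: "n \<noteq> 0" "\<And>i. n \<bullet> f i = 0"
    and v: "v \<bullet> n = 0" "\<And>i. v \<bullet> f i = 0"
  shows "v = 0"
proof -
  have "n \<notin> span (range f)"
  proof
    assume "n \<in> span (range f)"
    then have "orthogonal n n"
      using n(2) by (intro orthogonal_to_span[of n "range f"]) (auto simp: orthogonal_def)
    with n(1) show False
      by (simp add: orthogonal_def)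
  qed
  then have ind: "independent (insert n (range f))"
    using f(2) by (rule independent_insertI)
  have "n \<notin> range f"
    using \<open>n \<notin> span (range f)\<close> span_superset by (rule contra_subsetD[rotated])
  then have "card (insert n (range f)) = 4"
    using f(1) by (simp add: card_image)
  then have "UNIV \<subseteq> span (insert n (range f))"
    using ind by (intro card_ge_dim_independent) auto
  then have "v \<in> span (insert n (range f))"
    by (rule subsetD) simp
  then have "orthogonal v v"
    using v by (intro orthogonal_to_span[of v "insert n (range f)"]) (auto simp: orthogonal_def)
  then show "v = 0"
    by (simp add: orthogonal_def)
qed

definition space_dir :: "3 \<Rightarrow> (real^3) \<times> real" where
  "space_dir i = (axis i 1, 0)"

definition time_dir :: "(real^3) \<times> real" where
  "time_dir = (0, 1)"

text \<open>\<open>a\<close> is the matrix of the Weingarten map. The point \<open>x0\<close> carries normal coordinates whose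
  axes are principal directions.\<close>

locale normal_point = smooth_domain Q for Q :: "((real^3) \<times> real) set" +
  fixes G \<nu> :: "(real^3) \<times> real \<Rightarrow> real^4" and a :: "3 \<Rightarrow> 3 \<Rightarrow> (real^3) \<times> real \<Rightarrow> real"
    and x0 :: "(real^3) \<times> real" and l :: "3 \<Rightarrow> real"
  assumes G: "smooth_on Q G" and nu: "smooth_on Q \<nu>" and a: "\<And>i j. smooth_on Q (a i j)"
    and nu_unit: "\<And>x. x \<in> Q \<Longrightarrow> \<nu> x \<bullet> \<nu> x = 1"
    and nu_normal: "\<And>x i. x \<in> Q \<Longrightarrow> dd Q (space_dir i) G x \<bullet> \<nu> x = 0"
    and weingarten: "\<And>x i j. x \<in> Q \<Longrightarrow>
      - (dd Q (space_dir j) (dd Q (space_dir i) G) x \<bullet> \<nu> x) =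
      (\<Sum>k\<in>UNIV. (dd Q (space_dir i) G x \<bullet> dd Q (space_dir k) G x) * a k j x)"
    and flow: "\<And>x. x \<in> Q \<Longrightarrow> dd Q time_dir G x = - ((\<Sum>i\<in>UNIV. a i i x)^3) *\<^sub>R \<nu> x"
    and x0: "x0 \<in> Q"
    and metric0: "\<And>i j. dd Q (space_dir i) G x0 \<bullet> dd Q (space_dir j) G x0 = (if i = j then 1 else 0)"
    and christoffel0: "\<And>i j k. dd Q (space_dir j) (dd Q (space_dir i) G) x0 \<bullet> dd Q (space_dir k) G x0 = 0"
    and a0: "\<And>i j. a i j x0 = (if i = j then l i else 0)"
begin

abbreviation "D \<equiv> dd Q"
abbreviation "e \<equiv> space_dir"
abbreviation "\<tau> \<equiv> time_dir"
abbreviation "F i \<equiv> D (e i) G"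
abbreviation "FF i j \<equiv> D (e j) (F i)"

lemmas smooths = G nu a smooth_dd[OF G] smooth_dd[OF smooth_dd[OF G]] smooth_dd[OF nu]
  smooth_dd[OF smooth_dd[OF nu]] smooth_dd[OF smooth_dd[OF smooth_dd[OF G]]] smooth_dd[OF a]

lemmas smooth_rules = smooths smooth_intros

lemmas dd_inner = dd_bounded_bilinear[OF bounded_bilinear_inner]
lemmas dd_mult = dd_bounded_bilinear[OF bounded_bilinear_mult]
lemmas dd_scaleR = dd_bounded_bilinear[OF bounded_bilinear_scaleR]
lemmas dd2_inner = dd2_bounded_bilinear[OF bounded_bilinear_inner]
lemmas dd2_mult = dd2_bounded_bilinear[OF bounded_bilinear_mult]
lemmas dd2_scaleR = dd2_bounded_bilinear[OF bounded_bilinear_scaleR]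

lemma D_nu_normal: "x \<in> Q \<Longrightarrow> D v \<nu> x \<bullet> \<nu> x = 0"
proof -
  assume x: "x \<in> Q"
  have "D v (\<lambda>x. \<nu> x \<bullet> \<nu> x) x = D v (\<lambda>x. 1) x"
    by (intro dd_cong smooth_rules nu_unit x)
  then show ?thesis
    using x by (simp add: dd_inner nu dd_const inner_commute)
qed

lemma DD_nu_normal: "x \<in> Q \<Longrightarrow> D w (D v \<nu>) x \<bullet> \<nu> x = - (D v \<nu> x \<bullet> D w \<nu> x)"
proof -
  assume x: "x \<in> Q"
  have "D w (\<lambda>x. D v \<nu> x \<bullet> \<nu> x) x = D w (\<lambda>x. 0) x"
    by (intro dd_cong smooth_rules D_nu_normal x)
  then show ?thesis
    using x by (simp add: dd_inner smooths dd_const inner_commute)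
qed

lemma D_nu_tangent: "x \<in> Q \<Longrightarrow> F i x \<bullet> D v \<nu> x = - (D v (F i) x \<bullet> \<nu> x)"
proof -
  assume x: "x \<in> Q"
  have "D v (\<lambda>x. F i x \<bullet> \<nu> x) x = D v (\<lambda>x. 0) x"
    by (intro dd_cong smooth_rules nu_normal x)
  then show ?thesis
    using x by (simp add: dd_inner smooths dd_const)
qed

lemma FF_commute: "x \<in> Q \<Longrightarrow> FF i j x = FF j i x"
  by (rule dd_commute[OF G])

lemma frame0: "inj (\<lambda>i. F i x0)" "independent (range (\<lambda>i. F i x0))"
proof -
  show inj: "inj (\<lambda>i. F i x0)"
  proof
    fix i j assume "F i x0 = F j x0"
    then have "F i x0 \<bullet> F i x0 = F i x0 \<bullet> F j x0"
      by simp
    then show "i = j"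
      unfolding metric0 by (simp split: if_splits)
  qed
  have "pairwise orthogonal (range (\<lambda>i. F i x0))"
    unfolding pairwise_image by (simp add: pairwise_def orthogonal_def metric0)
  moreover have "0 \<notin> range (\<lambda>i. F i x0)"
  proof
    assume "0 \<in> range (\<lambda>i. F i x0)"
    then obtain i where i: "0 = F i x0"
      by (rule imageE)
    show False
      using metric0[of i i] unfolding i[symmetric] by simp
  qed
  ultimately show "independent (range (\<lambda>i. F i x0))"
    by (rule pairwise_orthogonal_independent)
qed

lemma zero_by_frame:
  assumes "v \<bullet> \<nu> x0 = 0" "\<And>i. v \<bullet> F i x0 = 0"
  shows "v = 0"
proof (rule orthogonal_to_frame_imp_zero[OF frame0])
  show "\<nu> x0 \<noteq> 0"
    using nu_unit[OF x0] by auto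
qed (use assms nu_normal[OF x0] in \<open>auto simp: inner_commute\<close>)

lemma second0: "FF i j x0 \<bullet> \<nu> x0 = (if i = j then - l i else 0)"
proof -
  have "- (FF i j x0 \<bullet> \<nu> x0) = (\<Sum>k\<in>UNIV. (if i = k then 1 else 0) * (if k = j then l k else 0))"
    using weingarten[OF x0, of j i] by (simp add: metric0 a0)
  also have "\<dots> = (if i = j then l i else 0)"
    by (simp add: if_distrib[of "\<lambda>x. x * _"] sum.delta' cong: if_cong)
  finally show ?thesis
    by (simp split: if_splits)
qed

lemma FF0: "FF i j x0 = (if i = j then - l i else 0) *\<^sub>R \<nu> x0"
proof -
  have "FF i j x0 - (if i = j then - l i else 0) *\<^sub>R \<nu> x0 = 0"
  proof (rule zero_by_frame)
    show "(FF i j x0 - (if i = j then - l i else 0) *\<^sub>R \<nu> x0) \<bullet> \<nu> x0 = 0"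
      unfolding inner_diff_left inner_scaleR_left second0 nu_unit[OF x0] by simp
    show "(FF i j x0 - (if i = j then - l i else 0) *\<^sub>R \<nu> x0) \<bullet> F k x0 = 0" for k
      unfolding inner_diff_left inner_scaleR_left christoffel0 inner_commute[of "\<nu> x0"] nu_normal[OF x0] by simp
  qed
  then show ?thesis
    by simp
qed

lemma nu0: "D (e k) \<nu> x0 = l k *\<^sub>R F k x0"
proof -
  have "D (e k) \<nu> x0 - l k *\<^sub>R F k x0 = 0"
  proof (rule zero_by_frame)
    show "(D (e k) \<nu> x0 - l k *\<^sub>R F k x0) \<bullet> \<nu> x0 = 0"
      by (simp add: inner_diff_left D_nu_normal nu_normal x0)
    fix i
    have "D (e k) \<nu> x0 \<bullet> F i x0 = (if i = k then l i else 0)"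
      unfolding inner_commute[of "D (e k) \<nu> x0"] D_nu_tangent[OF x0] second0 by simp
    then show "(D (e k) \<nu> x0 - l k *\<^sub>R F k x0) \<bullet> F i x0 = 0"
      by (auto simp: inner_diff_left metric0)
  qed
  then show ?thesis
    by simp
qed

text \<open>The covariant derivative of the second fundamental form at \<open>x0\<close>, where the
  Christoffel symbols vanish. Written through third derivatives of \<open>G\<close>, its Codazzi
  equations become the symmetry of partial derivatives.\<close>

definition T :: "3 \<Rightarrow> 3 \<Rightarrow> 3 \<Rightarrow> real" where
  "T i j k = - (D (e k) (FF i j) x0 \<bullet> \<nu> x0)"

lemma T_sym: "T i j k = T j i k" "T i j k = T i k j"
proof -
  have "D (e k) (FF i j) x0 = D (e k) (FF j i) x0"
    by (rule dd_cong[OF _ FF_commute x0]) (rule smooths)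
  then show "T i j k = T j i k"
    by (simp add: T_def)
  have "D (e k) (FF i j) x0 = D (e j) (FF i k) x0"
    by (rule dd_commute[OF _ x0]) (rule smooths)
  then show "T i j k = T i k j"
    by (simp add: T_def)
qed

text \<open>At \<open>x0\<close> the second derivatives of \<open>G\<close> are normal and the
  derivatives of \<open>\<nu>\<close> are tangential, so differentiating the normal contributes
  nothing.\<close>

lemma D_second: "D (e k) (\<lambda>x. - (FF i j x \<bullet> \<nu> x)) x0 = T i j k"
proof -
  have "D (e k) (\<lambda>x. - (FF i j x \<bullet> \<nu> x)) x0 = - (FF i j x0 \<bullet> D (e k) \<nu> x0 + D (e k) (FF i j) x0 \<bullet> \<nu> x0)"
    by (simp add: dd_minus dd_inner smooth_rules x0)
  also have "FF i j x0 \<bullet> D (e k) \<nu> x0 = 0"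
    by (simp add: nu0 christoffel0)
  finally show ?thesis
    by (simp add: T_def)
qed

lemma D_metric: "D (e k) (\<lambda>x. F i x \<bullet> F j x) x0 = 0"
  using christoffel0 by (simp add: dd_inner smooths x0 inner_commute)

text \<open>Product rule for \<open>h = g a\<close> at a point where \<open>g\<close> is the
  identity. Derivatives of \<open>a\<close> are read off from those of \<open>h\<close> and
  \<open>g\<close>, so the inverse metric is never differentiated.\<close>

lemma D_weingarten:
  "D v (\<lambda>x. - (FF i j x \<bullet> \<nu> x)) x0 = (\<Sum>k\<in>UNIV. D v (\<lambda>x. F i x \<bullet> F k x) x0 * a k j x0) + D v (a i j) x0"
proof -
  have "D v (\<lambda>x. - (FF i j x \<bullet> \<nu> x)) x0 = D v (\<lambda>x. \<Sum>k\<in>UNIV. (F i x \<bullet> F k x) * a k j x) x0"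
    by (rule dd_cong[OF _ weingarten x0]) (intro smooth_rules)
  also have "\<dots> = (\<Sum>k\<in>UNIV. D v (\<lambda>x. (F i x \<bullet> F k x) * a k j x) x0)"
    by (intro dd_sum smooth_rules x0)
  also have "\<dots> = (\<Sum>k\<in>UNIV. D v (\<lambda>x. F i x \<bullet> F k x) x0 * a k j x0 + (if i = k then D v (a k j) x0 else 0))"
    by (intro sum.cong refl) (simp add: dd_mult smooth_rules x0 metric0)
  finally show ?thesis
    by (simp add: sum.distrib)
qed

lemma D_a: "D (e k) (a i j) x0 = T i j k"
  using D_weingarten[of "e k" j i] by (simp add: D_second D_metric)

lemma DD_weingarten:
  "D (e k) (D (e k) (\<lambda>x. - (FF i i x \<bullet> \<nu> x))) x0 =
    l i * D (e k) (D (e k) (\<lambda>x. F i x \<bullet> F i x)) x0 + D (e k) (D (e k) (a i i)) x0"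
proof -
  have "D (e k) (D (e k) (\<lambda>x. - (FF i i x \<bullet> \<nu> x))) x0 =
    D (e k) (D (e k) (\<lambda>x. \<Sum>m\<in>UNIV. (F i x \<bullet> F m x) * a m i x)) x0"
    by (rule dd2_cong[OF _ weingarten x0]) (intro smooth_rules)
  also have "\<dots> = (\<Sum>m\<in>UNIV. D (e k) (D (e k) (\<lambda>x. (F i x \<bullet> F m x) * a m i x)) x0)"
    by (intro dd2_sum smooth_rules x0)
  also have "\<dots> = (\<Sum>m\<in>UNIV. (if i = m then l i * D (e k) (D (e k) (\<lambda>x. F i x \<bullet> F i x)) x0 else 0) +
      (if i = m then D (e k) (D (e k) (a i i)) x0 else 0))"
    by (intro sum.cong refl) (auto simp: dd2_mult smooth_rules x0 metric0 D_metric a0)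
  finally show ?thesis
    by (simp add: sum.distrib)
qed

definition M :: "3 \<Rightarrow> 3 \<Rightarrow> real" where
  "M i k = D (e k) (D (e k) (a i i)) x0"

text \<open>Its tangential part contains derivatives of Christoffel symbols, which need not vanish
  at \<open>x0\<close> and are never computed. They enter \<open>M i k\<close> through \<open>l k *
  (E k i \<bullet> F k x0) + l i * (E i k \<bullet> F i x0)\<close>, up to a factor; this is
  symmetric in \<open>i\<close> and \<open>k\<close> and cancels in
  \<open>M_commutator\<close>.\<close>

definition E :: "3 \<Rightarrow> 3 \<Rightarrow> real^4" where
  "E i k = D (e k) (D (e k) (F i)) x0"

lemma DD_second: "D (e k) (D (e k) (\<lambda>x. - (FF i i x \<bullet> \<nu> x))) x0 =
  - (D (e k) (D (e k) (FF i i)) x0 \<bullet> \<nu> x0) - 2 * l k * (E k i \<bullet> F k x0) - l i * (l k)\<^sup>2"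
proof -
  have "D (e k) (D (e k) (\<lambda>x. - (FF i i x \<bullet> \<nu> x))) x0 =
    D (e k) (\<lambda>x. - (D (e k) (\<lambda>x. FF i i x \<bullet> \<nu> x) x)) x0"
    by (intro dd_cong smooth_dd smooth_rules dd_minus x0)
  also have "\<dots> = - D (e k) (D (e k) (\<lambda>x. FF i i x \<bullet> \<nu> x)) x0"
    by (intro dd_minus smooth_dd smooth_rules x0)
  also have "\<dots> = - (FF i i x0 \<bullet> D (e k) (D (e k) \<nu>) x0 + 2 * (D (e k) (FF i i) x0 \<bullet> D (e k) \<nu> x0) +
      D (e k) (D (e k) (FF i i)) x0 \<bullet> \<nu> x0)"
    by (simp add: dd2_inner smooths x0)
  also have "FF i i x0 \<bullet> D (e k) (D (e k) \<nu>) x0 = l i * (l k)\<^sup>2"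
    using DD_nu_normal[OF x0, of "e k" "e k"]
    by (simp add: FF0 nu0 metric0 inner_commute power2_eq_square)
  also have "D (e k) (FF i i) x0 = E k i"
  proof -
    have "D (e k) (FF i i) x0 = D (e i) (FF i k) x0"
      by (rule dd_commute[OF smooth_dd[OF G] x0])
    also have "\<dots> = D (e i) (FF k i) x0"
      by (rule dd_cong[OF _ FF_commute x0]) (intro smooths)
    finally show ?thesis
      by (simp add: E_def)
  qed
  finally show ?thesis
    by (simp add: nu0)
qed

lemma DD_metric: "D (e k) (D (e k) (\<lambda>x. F i x \<bullet> F i x)) x0 =
  2 * (E i k \<bullet> F i x0) + (if i = k then 2 * (l i)\<^sup>2 else 0)"
  using nu_unit[OF x0]
  by (simp add: dd2_inner smooths x0 FF0 E_def inner_commute power2_eq_square)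

text \<open>Flatness of the ambient space enters here: these are iterated partial derivatives of a
  map into \<open>real^4\<close>, so they commute. What is left in \<open>M_commutator\<close> are
  products of curvatures only.\<close>

lemma fourth_commute: "D (e k) (D (e k) (FF i i)) x0 = D (e i) (D (e i) (FF k k)) x0"
proof -
  have "D (e k) (D (e k) (D (e i) (F i))) x0 = D (e k) (D (e i) (D (e k) (F i))) x0"
    by (rule dd_cong[OF _ dd_commute x0]) (rule smooths)+
  also have "\<dots> = D (e i) (D (e k) (D (e k) (F i))) x0"
    by (rule dd_commute[OF _ x0]) (rule smooths)
  also have "\<dots> = D (e i) (D (e k) (D (e i) (F k))) x0"
    by (rule dd2_cong[OF _ FF_commute x0]) (rule smooths)
  also have "\<dots> = D (e i) (D (e i) (D (e k) (F k))) x0"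
    by (rule dd_cong[OF _ dd_commute x0]) (rule smooths)+
  finally show ?thesis .
qed

text \<open>Simons' identity at \<open>x0\<close>.\<close>

lemma M_commutator: "M i k - M k i = l i * l k * (l i - l k)"
proof -
  have M: "M i k = - (D (e k) (D (e k) (FF i i)) x0 \<bullet> \<nu> x0) - 2 * l k * (E k i \<bullet> F k x0) - l i * (l k)\<^sup>2
    - l i * (2 * (E i k \<bullet> F i x0) + (if i = k then 2 * (l i)\<^sup>2 else 0))" for i k
    using DD_weingarten[of k i] by (simp add: M_def DD_second DD_metric)
  show ?thesis
    unfolding M fourth_commute[of i k] by (simp add: power2_eq_square algebra_simps)
qed

end

section \<open>Evolution of the mean curvature, of the squared norm of the second fundamental form,
  and of \<open>P\<close>\<close>

context normal_point
begin

definition H :: "(real^3) \<times> real \<Rightarrow> real" where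
  "H x = (\<Sum>i\<in>UNIV. a i i x)"

definition S :: "(real^3) \<times> real \<Rightarrow> real" where
  "S x = (\<Sum>i\<in>UNIV. \<Sum>j\<in>UNIV. a i j x * a j i x)"

definition P :: "(real^3) \<times> real \<Rightarrow> real" where
  "P x = 8 * S x - 3 * (H x * H x)"

text \<open>The normal speed: the velocity of the flow is \<open>q x *\<^sub>R \<nu> x\<close>.
  Products instead of a power suit the bilinear product rules.\<close>

definition q :: "(real^3) \<times> real \<Rightarrow> real" where
  "q x = - (H x * (H x * H x))"

definition B :: "3 \<Rightarrow> real" where
  "B k = (\<Sum>i\<in>UNIV. T i i k)"

lemma smooth_H: "smooth_on Q H"
  unfolding H_def[abs_def] by (intro smooth_rules)

lemma smooth_S: "smooth_on Q S"
  unfolding S_def[abs_def] by (intro smooth_rules)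

lemma smooth_P: "smooth_on Q P"
  unfolding P_def[abs_def] by (intro smooth_rules smooth_H smooth_S)

lemma smooth_q: "smooth_on Q q"
  unfolding q_def[abs_def] by (intro smooth_rules smooth_H)

lemma H0: "H x0 = (\<Sum>i\<in>UNIV. l i)"
  by (simp add: H_def a0)

lemma D_H: "D v H x0 = (\<Sum>i\<in>UNIV. D v (a i i) x0)"
  unfolding H_def[abs_def] by (intro dd_sum smooth_rules x0)

lemma DD_H: "D w (D v H) x0 = (\<Sum>i\<in>UNIV. D w (D v (a i i)) x0)"
  unfolding H_def[abs_def] by (intro dd2_sum smooth_rules x0)

lemma D_H_space: "D (e k) H x0 = B k"
  by (simp add: D_H D_a B_def)

lemma DD_H_space: "D (e k) (D (e k) H) x0 = (\<Sum>i\<in>UNIV. M i k)"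
  by (simp add: DD_H M_def)

lemma D_S: "D v S x0 = 2 * (\<Sum>i\<in>UNIV. l i * D v (a i i) x0)"
proof -
  have "D v S x0 = (\<Sum>i\<in>UNIV. \<Sum>j\<in>UNIV. D v (\<lambda>x. a i j x * a j i x) x0)"
    unfolding S_def[abs_def] using x0
    by (subst dd_sum) (auto intro!: sum.cong dd_sum smooth_rules)
  also have "\<dots> = (\<Sum>i\<in>UNIV. \<Sum>j\<in>UNIV. if i = j then 2 * (l i * D v (a i i) x0) else 0)"
    by (intro sum.cong refl) (auto simp: dd_mult smooths x0 a0)
  finally show ?thesis
    by (simp add: sum_distrib_left)
qed

text \<open>As \<open>a\<close> is diagonal at \<open>x0\<close>, second derivatives survive for
  diagonal entries only, which are the ones that \<open>M\<close> records. Off-diagonal entries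
  contribute through products of first derivatives.\<close>

lemma DD_S_space: "D (e k) (D (e k) S) x0 =
  2 * (\<Sum>i\<in>UNIV. l i * M i k) + 2 * (\<Sum>i\<in>UNIV. \<Sum>j\<in>UNIV. (T i j k)\<^sup>2)"
proof -
  have "D (e k) (D (e k) S) x0 = (\<Sum>i\<in>UNIV. \<Sum>j\<in>UNIV. D (e k) (D (e k) (\<lambda>x. a i j x * a j i x)) x0)"
    unfolding S_def[abs_def] using x0
    by (subst dd2_sum) (auto intro!: sum.cong dd2_sum smooth_rules)
  also have "\<dots> = (\<Sum>i\<in>UNIV. \<Sum>j\<in>UNIV. (if i = j then 2 * (l i * M i k) else 0) + 2 * (T i j k)\<^sup>2)"
  proof (intro sum.cong refl)
    fix i j
    have "D (e k) (D (e k) (\<lambda>x. a i j x * a j i x)) x0 =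
      a i j x0 * D (e k) (D (e k) (a j i)) x0 + T i j k * T j i k + T i j k * T j i k +
      D (e k) (D (e k) (a i j)) x0 * a j i x0"
      by (simp add: dd2_mult smooths x0 D_a)
    then show "D (e k) (D (e k) (\<lambda>x. a i j x * a j i x)) x0 =
      (if i = j then 2 * (l i * M i k) else 0) + 2 * (T i j k)\<^sup>2"
      unfolding T_sym(1)[of j i] by (auto simp: a0 M_def power2_eq_square)
  qed
  finally show ?thesis
    by (simp add: sum.distrib sum_distrib_left)
qed

lemma DD_q: "D (e k) (D (e k) q) x0 = - (6 * H x0 * (B k)\<^sup>2 + 3 * (H x0)\<^sup>2 * (\<Sum>i\<in>UNIV. M i k))"
  unfolding q_def[abs_def]
  by (simp add: dd2_minus dd2_mult dd_mult smooth_rules smooth_H x0 D_H_space DD_H_space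
      power2_eq_square algebra_simps)

lemma flow': "x \<in> Q \<Longrightarrow> D \<tau> G x = q x *\<^sub>R \<nu> x"
  by (simp add: flow q_def H_def power3_eq_cube algebra_simps)

lemma D_time_F: "D \<tau> (F i) x0 = q x0 *\<^sub>R D (e i) \<nu> x0 + D (e i) q x0 *\<^sub>R \<nu> x0"
proof -
  have "D \<tau> (F i) x0 = D (e i) (D \<tau> G) x0"
    by (rule dd_commute[OF G x0])
  also have "\<dots> = D (e i) (\<lambda>x. q x *\<^sub>R \<nu> x) x0"
    by (rule dd_cong[OF _ flow' x0]) (rule smooths)
  finally show ?thesis
    by (simp add: dd_scaleR smooth_q smooths x0)
qed

lemma D_time_metric: "D \<tau> (\<lambda>x. F i x \<bullet> F i x) x0 = 2 * q x0 * l i"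
  using nu_normal[OF x0, of i]
  by (simp add: dd_inner smooths x0 D_time_F nu0 inner_add_left inner_add_right metric0 inner_commute)

lemma D_time_FF: "D \<tau> (FF i i) x0 \<bullet> \<nu> x0 = - q x0 * (l i)\<^sup>2 + D (e i) (D (e i) q) x0"
proof -
  have "D \<tau> (FF i i) x0 = D (e i) (D \<tau> (F i)) x0"
    by (rule dd_commute[OF _ x0]) (rule smooths)
  also have "\<dots> = D (e i) (D (e i) (D \<tau> G)) x0"
    by (rule dd_cong[OF _ dd_commute x0]) (rule smooths)+
  also have "\<dots> = D (e i) (D (e i) (\<lambda>x. q x *\<^sub>R \<nu> x)) x0"
    by (rule dd2_cong[OF _ flow' x0]) (rule smooths)
  also have "\<dots> = q x0 *\<^sub>R D (e i) (D (e i) \<nu>) x0 + (2 * D (e i) q x0) *\<^sub>R D (e i) \<nu> x0 +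
      D (e i) (D (e i) q) x0 *\<^sub>R \<nu> x0"
    by (simp add: dd2_scaleR smooth_q smooths x0 scaleR_2 flip: scaleR_scaleR)
  finally have *: "D \<tau> (FF i i) x0 = \<dots>" .
  have "D (e i) (D (e i) \<nu>) x0 \<bullet> \<nu> x0 = - (l i)\<^sup>2"
    unfolding DD_nu_normal[OF x0] nu0 by (simp add: metric0 power2_eq_square)
  then show ?thesis
    unfolding * by (simp add: inner_add_left D_nu_normal x0 nu_unit)
qed

text \<open>The second fundamental form changes by \<open>q l\<^sup>2\<close> minus the second
  derivative of \<open>q\<close>. The change \<open>2 q l\<close> of the metric, times
  \<open>l\<close>, is subtracted from this. Diagonal entries of the metric suffice, because
  \<open>a\<close> is diagonal at \<open>x0\<close>.\<close>

lemma D_time_a: "D \<tau> (a i i) x0 = - q x0 * (l i)\<^sup>2 - D (e i) (D (e i) q) x0"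
proof -
  have "FF i i x0 \<bullet> D \<tau> \<nu> x0 = 0"
    using D_nu_normal[OF x0, of \<tau>] by (simp add: FF0 inner_commute)
  then have "D \<tau> (\<lambda>x. - (FF i i x \<bullet> \<nu> x)) x0 = - (D \<tau> (FF i i) x0 \<bullet> \<nu> x0)"
    by (simp add: dd_minus dd_inner smooth_rules x0)
  moreover have "(\<Sum>k\<in>UNIV. D \<tau> (\<lambda>x. F i x \<bullet> F k x) x0 * a k i x0) = 2 * q x0 * l i * l i"
    by (simp add: a0 D_time_metric if_distrib cong: if_cong)
  ultimately show ?thesis
    using D_weingarten[of \<tau> i i] unfolding D_time_FF by (simp add: power2_eq_square algebra_simps)
qed

lemma D_P: "D v P x0 = 8 * D v S x0 - 6 * H x0 * D v H x0"
  unfolding P_def[abs_def]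
  by (simp add: dd_diff dd_mult_const dd_mult smooth_rules smooth_H smooth_S x0)

lemma DD_P: "D (e k) (D (e k) P) x0 =
  8 * D (e k) (D (e k) S) x0 - 6 * ((B k)\<^sup>2 + H x0 * D (e k) (D (e k) H) x0)"
  unfolding P_def[abs_def]
  by (simp add: dd2_diff dd2_mult_const dd2_mult smooth_rules smooth_H smooth_S x0 D_H_space
      power2_eq_square)

lemma heat_P_negative:
  assumes pos: "\<And>i. l i > 0" and P0: "P x0 = 0" and crit: "\<And>k. D (e k) P x0 = 0"
  shows "D \<tau> P x0 - 3 * (H x0)\<^sup>2 * (\<Sum>k\<in>UNIV. D (e k) (D (e k) P) x0) < 0"
proof -
  define h where "h = H x0"
  define s where "s = S x0"
  define c where "c = (\<Sum>i\<in>UNIV. (l i)^3)"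
  define N where "N = (\<Sum>i\<in>UNIV. \<Sum>j\<in>UNIV. \<Sum>k\<in>UNIV. (T i j k)\<^sup>2)"
  have s: "s = (\<Sum>i\<in>UNIV. (l i)\<^sup>2)"
    by (simp add: s_def S_def a0 power2_eq_square if_distrib cong: if_cong)
  have "6 * h\<^sup>2 * (s\<^sup>2 - h * c - N) + 12 * h * (\<Sum>i\<in>UNIV. l i * (B i)\<^sup>2) + 2 * h^3 * c -
    9 / 4 * h\<^sup>2 * (\<Sum>i\<in>UNIV. (B i)\<^sup>2) - 3 / 4 * h^4 * s < 0"
    unfolding N_def
  proof (rule reaction_gradient_negative[where T=T and B=B, OF pos _ s c_def _ _ B_def])
    show "h = (\<Sum>i\<in>UNIV. l i)"
      by (simp add: h_def H0)
    show "T i j k = T j i k" "T i j k = T i k j" for i j k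
      by (rule T_sym)+
    show "s = 3 / 8 * h\<^sup>2"
      using P0 unfolding P_def s_def[symmetric] h_def[symmetric] by (simp add: power2_eq_square)
    show "(\<Sum>i\<in>UNIV. l i * T i i k) = 3 / 8 * h * B k" for k
      using crit[of k] unfolding D_P D_S D_a D_H_space h_def[symmetric] by simp
  qed
  moreover have "D \<tau> P x0 - 3 * (H x0)\<^sup>2 * (\<Sum>k\<in>UNIV. D (e k) (D (e k) P) x0) =
    8 * (6 * h\<^sup>2 * (s\<^sup>2 - h * c - N) + 12 * h * (\<Sum>i\<in>UNIV. l i * (B i)\<^sup>2) + 2 * h^3 * c -
    9 / 4 * h\<^sup>2 * (\<Sum>i\<in>UNIV. (B i)\<^sup>2) - 3 / 4 * h^4 * s)"
  proof -
    \<comment> \<open>All second derivatives of \<open>a\<close> are collected here.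
      \<open>m1\<close> is the Laplacian of \<open>H\<close> and cancels. \<open>m3\<close> comes
      from the time derivative of \<open>S\<close>, where \<open>l\<close> weights the second
      derivatives of \<open>H\<close>; \<open>m2\<close> comes from the Laplacian of
      \<open>S\<close>, where \<open>l\<close> weights the Laplacian of \<open>a\<close>. Simons'
      identity converts \<open>m3 - m2\<close> into the reaction term.\<close>
    define m1 where "m1 = (\<Sum>k\<in>UNIV. \<Sum>i\<in>UNIV. M i k)"
    define m2 where "m2 = (\<Sum>k\<in>UNIV. \<Sum>i\<in>UNIV. l i * M i k)"
    define m3 where "m3 = (\<Sum>k\<in>UNIV. \<Sum>i\<in>UNIV. l k * M i k)"
    define b where "b = (\<Sum>i\<in>UNIV. (B i)\<^sup>2)"
    define lb where "lb = (\<Sum>i\<in>UNIV. l i * (B i)\<^sup>2)"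
    have q0: "q x0 = - (h^3)"
      by (simp add: q_def h_def power3_eq_cube)
    have a_t: "D \<tau> (a i i) x0 = h^3 * (l i)\<^sup>2 + 6 * h * (B i)\<^sup>2 + 3 * h\<^sup>2 * (\<Sum>j\<in>UNIV. M j i)" for i
      by (simp add: D_time_a DD_q q0 h_def)
    have Ht: "D \<tau> H x0 = h^3 * s + 6 * h * b + 3 * h\<^sup>2 * m1"
      unfolding D_H a_t b_def m1_def s by (simp add: sum.distrib sum_distrib_left)
    have "D \<tau> S x0 = 2 * (\<Sum>i\<in>UNIV. h^3 * (l i)^3 + 6 * h * (l i * (B i)\<^sup>2) + 3 * h\<^sup>2 * (\<Sum>j\<in>UNIV. l i * M j i))"
      unfolding D_S a_t
      by (simp add: algebra_simps power2_eq_square power3_eq_cube sum_distrib_left)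
    also have "\<dots> = 2 * (h^3 * c + 6 * h * lb + 3 * h\<^sup>2 * m3)"
      unfolding c_def lb_def m3_def by (simp add: sum.distrib sum_distrib_left)
    finally have St: "D \<tau> S x0 = 2 * (h^3 * c + 6 * h * lb + 3 * h\<^sup>2 * m3)" .
    have N': "N = (\<Sum>k\<in>UNIV. \<Sum>i\<in>UNIV. \<Sum>j\<in>UNIV. (T i j k)\<^sup>2)"
      unfolding N_def by (simp add: sum_3)
    have Sx: "(\<Sum>k\<in>UNIV. D (e k) (D (e k) S) x0) = 2 * m2 + 2 * N"
      unfolding DD_S_space m2_def N' by (simp add: sum.distrib sum_distrib_left)
    have Hx: "(\<Sum>k\<in>UNIV. D (e k) (D (e k) H) x0) = m1"
      unfolding DD_H_space m1_def ..
    have Px: "(\<Sum>k\<in>UNIV. D (e k) (D (e k) P) x0) = 8 * (2 * m2 + 2 * N) - 6 * (b + h * m1)"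
      unfolding DD_P b_def h_def[symmetric] Hx[symmetric] Sx[symmetric]
      by (simp add: sum.distrib sum_subtractf sum_distrib_left)
    have "m3 - m2 = s\<^sup>2 - h * c"
    proof -
      have "m3 = (\<Sum>k\<in>UNIV. \<Sum>i\<in>UNIV. l i * M k i)"
        unfolding m3_def by (rule sum.swap)
      then have "m3 - m2 = (\<Sum>k\<in>UNIV. \<Sum>i\<in>UNIV. l i * (M k i - M i k))"
        unfolding m2_def by (simp add: sum_subtractf algebra_simps)
      also have "\<dots> = (\<Sum>k\<in>UNIV. \<Sum>i\<in>UNIV. l i * (l k * l i * (l k - l i)))"
        unfolding M_commutator ..
      also have "\<dots> = s\<^sup>2 - h * c"
        unfolding s c_def h_def H0 sum_3 by (simp add: power2_eq_square power3_eq_cube algebra_simps)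
      finally show ?thesis .
    qed
    then have m3: "m3 = m2 + s\<^sup>2 - h * c"
      by simp
    show ?thesis
      unfolding D_P Px St Ht m3 b_def[symmetric] lb_def[symmetric] h_def[symmetric]
      by (simp add: power2_eq_square power3_eq_cube power4_eq_xxxx algebra_simps)
  qed
  ultimately show ?thesis
    by (simp only: mult_less_0_iff) simp
qed

end

section \<open>Simultaneous diagonalization\<close>

lemma vanishing_linear_coefficient:
  fixes b q :: real
  assumes "\<And>t. 0 \<le> t * b + t\<^sup>2 * q"
  shows "b = 0"
proof (rule ccontr)
  assume b: "b \<noteq> 0"
  \<comment> \<open>This choice makes \<open>t * b\<close> equal to
    \<open>- t\<^sup>2 (\<bar>q\<bar> + 1)\<close>, which outweighs the quadratic term.\<close>
  define t where "t = - b / (\<bar>q\<bar> + 1)"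
  have t: "t * (\<bar>q\<bar> + 1) = - b"
    by (simp add: t_def)
  have "t\<^sup>2 * q \<le> t\<^sup>2 * \<bar>q\<bar>"
    by (intro mult_left_mono) auto
  also have "\<dots> < t\<^sup>2 * (\<bar>q\<bar> + 1)"
  proof -
    have "t \<noteq> 0"
      using b t by auto
    then show ?thesis
      by (simp add: distrib_left)
  qed
  also have "\<dots> = - (t * b)"
    unfolding power2_eq_square mult.assoc t by simp
  finally show False
    using assms[of t] by simp
qed

text \<open>A unit vector of \<open>K\<close> that maximizes the Rayleigh quotient
  \<open>(x \<bullet> h x) / (x \<bullet> g x)\<close> is critical, so the first variation in all
  directions of \<open>K\<close> vanishes. The equation is tested against \<open>K\<close> only,
  since \<open>g\<close> and \<open>h\<close> may map out of \<open>K\<close>.\<close>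

lemma generalized_eigenvector:
  fixes g h :: "'a::euclidean_space \<Rightarrow> 'a"
  assumes lin: "linear g" "linear h"
    and sym: "\<And>x y. g x \<bullet> y = x \<bullet> g y" "\<And>x y. h x \<bullet> y = x \<bullet> h y"
    and pos: "\<And>x. x \<noteq> 0 \<Longrightarrow> x \<bullet> g x > 0"
    and K: "subspace K" "x0 \<in> K" "x0 \<noteq> 0"
  shows "\<exists>v c. v \<in> K \<and> v \<bullet> g v = 1 \<and> (\<forall>y\<in>K. h v \<bullet> y = c * (g v \<bullet> y))"
proof -
  define R where "R x = (x \<bullet> h x) / (x \<bullet> g x)" for x
  let ?C = "K \<inter> sphere 0 1"
  have "closed K"
    using K(1) closed_subspace by blast
  then have "compact ?C"
    by (intro closed_Int_compact compact_sphere)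
  moreover have "x0 /\<^sub>R norm x0 \<in> ?C"
    using K by (auto simp: subspace_scale)
  moreover have "continuous_on ?C R"
  proof -
    have "continuous_on ?C g" "continuous_on ?C h"
      using lin by (simp_all add: linear_continuous_on linear_conv_bounded_linear)
    moreover have "x \<bullet> g x \<noteq> 0" if "x \<in> ?C" for x
    proof -
      have "x \<noteq> 0"
        using that by auto
      from pos[OF this] show ?thesis
        by simp
    qed
    ultimately show ?thesis
      unfolding R_def by (intro continuous_on_divide continuous_on_inner continuous_on_id) simp_all
  qed
  ultimately obtain u where u: "u \<in> ?C" "\<And>y. y \<in> ?C \<Longrightarrow> R y \<le> R u"
    using continuous_attains_sup[of ?C R] by blast
  define c where "c = R u"
  have u0: "u \<noteq> 0" "u \<in> K"
    using u(1) by auto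
  have le: "x \<bullet> h x \<le> c * (x \<bullet> g x)" if "x \<in> K" for x
  proof (cases "x = 0")
    case False
    define y where "y = x /\<^sub>R norm x"
    have y: "y \<in> ?C" "x = norm x *\<^sub>R y"
      using that K(1) False by (auto simp: y_def subspace_scale)
    have "R y \<le> c"
      using u(2)[OF y(1)] by (simp add: c_def)
    moreover have "y \<bullet> g y > 0"
      using y(1) by (intro pos) auto
    ultimately have "y \<bullet> h y \<le> c * (y \<bullet> g y)"
      by (simp add: R_def field_simps)
    then have "(norm x)\<^sup>2 * (y \<bullet> h y) \<le> (norm x)\<^sup>2 * (c * (y \<bullet> g y))"
      by (intro mult_left_mono) auto
    moreover have "x \<bullet> h x = (norm x)\<^sup>2 * (y \<bullet> h y)" "x \<bullet> g x = (norm x)\<^sup>2 * (y \<bullet> g y)"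
      using lin False by (simp_all add: y_def linear_scale power2_eq_square field_simps)
    ultimately show ?thesis
      by (simp add: algebra_simps)
  qed (simp add: lin linear_0)
  have eq: "u \<bullet> h u = c * (u \<bullet> g u)"
    using pos[OF u0(1)] by (simp add: c_def R_def)
  have orth: "h u \<bullet> y = c * (g u \<bullet> y)" if y: "y \<in> K" for y
  proof -
    have "0 \<le> t * (2 * (c * (g u \<bullet> y) - h u \<bullet> y)) + t\<^sup>2 * (c * (y \<bullet> g y) - y \<bullet> h y)" for t
    proof -
      have "u + t *\<^sub>R y \<in> K"
        using u0 y K(1) by (simp add: subspace_add subspace_scale)
      from le[OF this] show ?thesis
        using eq sym(1)[of u y] sym(2)[of u y]
        by (simp add: linear_add[OF lin(1)] linear_add[OF lin(2)] linear_scale[OF lin(1)]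
            linear_scale[OF lin(2)] inner_add_left inner_add_right power2_eq_square
            inner_commute[of y] algebra_simps)
    qed
    then have "2 * (c * (g u \<bullet> y) - h u \<bullet> y) = 0"
      by (rule vanishing_linear_coefficient)
    then show ?thesis
      by simp
  qed
  define v where "v = u /\<^sub>R sqrt (u \<bullet> g u)"
  have "v \<in> K"
    using u0 K(1) by (simp add: v_def subspace_scale)
  moreover have "v \<bullet> g v = 1"
  proof -
    have "v \<bullet> g v = (u \<bullet> g u) / (sqrt (u \<bullet> g u))\<^sup>2"
    proof -
      have "inverse r * (inverse r * x) = x / r\<^sup>2" for r x :: real
        by (simp add: power2_eq_square divide_inverse)
      then show ?thesis
        by (simp add: v_def linear_scale[OF lin(1)] del: real_sqrt_pow2)
    qed
    then show ?thesis
      using pos[OF u0(1)] by simp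
  qed
  moreover have "\<forall>y\<in>K. h v \<bullet> y = c * (g v \<bullet> y)"
    using orth by (simp add: v_def linear_scale[OF lin(1)] linear_scale[OF lin(2)] algebra_simps)
  ultimately show ?thesis
    by blast
qed

lemma simultaneous_diagonalization:
  fixes g h :: "'a::euclidean_space \<Rightarrow> 'a" and J :: "'i set"
  assumes lin: "linear g" "linear h"
    and sym: "\<And>x y. g x \<bullet> y = x \<bullet> g y" "\<And>x y. h x \<bullet> y = x \<bullet> h y"
    and pos: "\<And>x. x \<noteq> 0 \<Longrightarrow> x \<bullet> g x > 0"
  shows "finite J \<Longrightarrow> card J \<le> DIM('a) \<Longrightarrow>
    \<exists>v l. \<forall>i\<in>J. h (v i) = l i *\<^sub>R g (v i) \<and> (\<forall>j\<in>J. g (v i) \<bullet> v j = (if i = j then 1 else 0))"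
proof (induction J rule: finite_induct)
  case empty
  then show ?case by simp
next
  case (insert k J)
  then obtain v l where v: "\<And>i. i \<in> J \<Longrightarrow> h (v i) = l i *\<^sub>R g (v i)"
    "\<And>i j. i \<in> J \<Longrightarrow> j \<in> J \<Longrightarrow> g (v i) \<bullet> v j = (if i = j then 1 else 0)"
    by auto
  \<comment> \<open>The \<open>g\<close>-orthogonal complement of the eigenvectors found so far. It
    is cut out by fewer than \<open>DIM('a)\<close> linear conditions and therefore contains a
    nonzero vector.\<close>
  define K where "K = {x. \<forall>i\<in>J. g (v i) \<bullet> x = 0}"
  have K: "subspace K"
    by (auto simp: K_def subspace_def inner_add_right)
  have "dim ((\<lambda>i. g (v i)) ` J) < DIM('a)"
    using insert dim_le_card'[of "(\<lambda>i. g (v i)) ` J"] card_image_le[of J "\<lambda>i. g (v i)"] by simp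
  then obtain x0 where "x0 \<noteq> 0" "\<And>y. y \<in> span ((\<lambda>i. g (v i)) ` J) \<Longrightarrow> orthogonal x0 y"
    by (rule orthogonal_to_subspace_exists) blast
  then have "x0 \<in> K" "x0 \<noteq> 0"
    by (auto simp: K_def orthogonal_def inner_commute[of _ x0] intro!: span_base)
  from generalized_eigenvector[OF lin sym pos K this]
  obtain w c where w: "w \<in> K" "w \<bullet> g w = 1" "\<And>y. y \<in> K \<Longrightarrow> h w \<bullet> y = c * (g w \<bullet> y)"
    by blast
  have gw: "g w \<bullet> v i = 0" "g (v i) \<bullet> w = 0" if "i \<in> J" for i
    using w(1) that sym(1)[of w "v i"] by (auto simp: K_def inner_commute)
  have hw: "h w \<bullet> v i = 0" if "i \<in> J" for i
    using sym(2)[of w "v i"] v(1)[OF that] gw(2)[OF that] by (simp add: inner_commute)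
  have "h w = c *\<^sub>R g w"
  proof (rule vector_eq_ldot[THEN iffD1, rule_format])
    fix z
    \<comment> \<open>\<open>r\<close> is the component of \<open>z\<close> in \<open>K\<close>. The
      rest of \<open>z\<close> is a combination of the \<open>v i\<close>, to which
      \<open>h w\<close> and \<open>g w\<close> are both orthogonal, so the eigenvector equation
      extends from \<open>K\<close> to the whole space.\<close>
    define r where "r = z - (\<Sum>i\<in>J. (g (v i) \<bullet> z) *\<^sub>R v i)"
    have "g (v j) \<bullet> r = 0" if "j \<in> J" for j
      using that insert.hyps(1)
      by (simp add: r_def inner_diff_right inner_sum_right v(2) if_distrib sum.delta cong: if_cong sum.cong)
    then have "r \<in> K"
      by (simp add: K_def)
    have z: "z = r + (\<Sum>i\<in>J. (g (v i) \<bullet> z) *\<^sub>R v i)"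
      by (simp add: r_def)
    have "(\<Sum>i\<in>J. (g (v i) \<bullet> z) *\<^sub>R v i) \<bullet> h w = 0" "(\<Sum>i\<in>J. (g (v i) \<bullet> z) *\<^sub>R v i) \<bullet> g w = 0"
      by (simp_all add: inner_sum_left inner_commute[of "v _"] hw gw)
    then have "z \<bullet> h w = h w \<bullet> r" "z \<bullet> g w = g w \<bullet> r"
      by (simp_all add: r_def inner_diff_right inner_commute)
    then show "z \<bullet> h w = z \<bullet> c *\<^sub>R g w"
      using w(3)[OF \<open>r \<in> K\<close>] by simp
  qed
  then show ?case
    using v w(2) gw insert.hyps(2)
    by (intro exI[of _ "v(k := w)"] exI[of _ "l(k := c)"]) (auto simp: inner_commute)
qed

section \<open>Positive definite matrices and traces\<close>

definition pos_def :: "real^'n^'n \<Rightarrow> bool" where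
  "pos_def g \<longleftrightarrow> transpose g = g \<and> (\<forall>x. x \<noteq> 0 \<longrightarrow> x \<bullet> (g *v x) > 0)"

lemma symmetric_inner:
  fixes g :: "real^'n^'n"
  assumes "transpose g = g"
  shows "(g *v x) \<bullet> y = x \<bullet> (g *v y)"
  by (metis assms dot_lmul_matrix vector_transpose_matrix inner_commute transpose_matrix_vector)

lemma invertible_pos_def: "pos_def g \<Longrightarrow> invertible g"
  unfolding pos_def_def
  by (metis inner_zero_right less_irrefl matrix_left_invertible_ker invertible_left_inverse)

lemma matrix_inv_inverse:
  fixes g :: "real^'n^'n"
  assumes "invertible g"
  shows "g ** matrix_inv g = mat 1" "matrix_inv g ** g = mat 1"
proof -
  have "\<exists>B. g ** B = mat 1 \<and> B ** g = mat 1"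
    using assms by (simp add: invertible_def)
  then have "g ** matrix_inv g = mat 1 \<and> matrix_inv g ** g = mat 1"
    unfolding matrix_inv_def by (rule someI_ex)
  then show "g ** matrix_inv g = mat 1" "matrix_inv g ** g = mat 1"
    by auto
qed

lemma matrix_simultaneous_diagonalization:
  fixes g h :: "real^'n^'n"
  assumes "pos_def g" "transpose h = h"
  shows "\<exists>v :: 'n \<Rightarrow> real^'n. \<exists>l. (\<forall>i. h *v v i = l i *\<^sub>R (g *v v i)) \<and>
    (\<forall>i j. (g *v v i) \<bullet> v j = (if i = j then 1 else 0))"
proof -
  have "\<exists>v l. \<forall>i\<in>(UNIV :: 'n set). h *v v i = l i *\<^sub>R (g *v v i) \<and>
    (\<forall>j\<in>(UNIV :: 'n set). (g *v v i) \<bullet> v j = (if i = j then 1 else 0))"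
    using assms by (intro simultaneous_diagonalization symmetric_inner) (auto simp: pos_def_def)
  then obtain v l where "\<forall>i\<in>(UNIV :: 'n set). h *v v i = l i *\<^sub>R (g *v v i) \<and>
    (\<forall>j\<in>(UNIV :: 'n set). (g *v v i) \<bullet> v j = (if i = j then 1 else 0))"
    by (elim exE)
  then show ?thesis
    by (intro exI[of _ v] exI[of _ l]) simp
qed

lemma orthonormal_form_independent:
  fixes g :: "real^'n^'n" and v :: "'n \<Rightarrow> real^'n"
  assumes "\<And>i j. (g *v v i) \<bullet> v j = (if i = j then 1 else 0)"
  shows "inj v" "independent (range v)"
proof -
  show inj: "inj v"
    using assms by (intro injI) (metis zero_neq_one)
  show "independent (range v)"
  proof (rule independent_if_scalars_zero)
    fix c x assume c: "(\<Sum>y\<in>range v. c y *\<^sub>R y) = 0" and "x \<in> range v"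
    then obtain i where i: "x = v i"
      by auto
    have "0 = (g *v v i) \<bullet> (\<Sum>j\<in>UNIV. c (v j) *\<^sub>R v j)"
      using c by (simp add: sum.reindex[OF inj] o_def)
    also have "\<dots> = c (v i)"
      by (simp add: inner_sum_right assms if_distrib cong: if_cong)
    finally show "c x = 0"
      by (simp add: i)
  qed simp
qed

lemma trace_eigenbasis:
  fixes g h :: "real^'n^'n" and v :: "'n \<Rightarrow> real^'n"
  assumes g: "invertible g" and v: "inj v" "independent (range v)"
    and eig: "\<And>i. h *v v i = l i *\<^sub>R (g *v v i)"
  shows "trace (matrix_inv g ** h) = (\<Sum>i\<in>UNIV. l i)"
    and "trace ((matrix_inv g ** h) ** (matrix_inv g ** h)) = (\<Sum>i\<in>UNIV. (l i)\<^sup>2)"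
proof -
  define A where "A = matrix_inv g ** h"
  define V :: "real^'n^'n" where "V = (\<chi> i j. v j $ i)"
  define L :: "real^'n^'n" where "L = (\<chi> i j. if i = j then l i else 0)"
  have Av: "A *v v i = l i *\<^sub>R v i" for i
  proof -
    have "A *v v i = matrix_inv g *v (h *v v i)"
      by (simp add: A_def matrix_vector_mul_assoc)
    also have "\<dots> = l i *\<^sub>R ((matrix_inv g ** g) *v v i)"
      by (simp add: eig matrix_vector_mult_scaleR matrix_vector_mul_assoc)
    also have "matrix_inv g ** g = mat 1"
      by (rule matrix_inv_inverse(2)[OF g])
    finally show ?thesis
      by simp
  qed
  have Vv: "V *v x = (\<Sum>i\<in>UNIV. x $ i *\<^sub>R v i)" for x
    by (simp add: V_def matrix_vector_mult_def vec_eq_iff mult.commute)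
  have AV: "A ** V = V ** L"
  proof (rule matrix_eq[THEN iffD2], rule allI)
    fix x
    have "A *v (V *v x) = (\<Sum>i\<in>UNIV. x $ i *\<^sub>R (l i *\<^sub>R v i))"
      unfolding Vv by (simp add: linear_sum[OF matrix_vector_mul_linear] matrix_vector_mult_scaleR Av)
    also have "\<dots> = V *v (L *v x)"
    proof -
      have "(L *v x) $ i = l i * x $ i" for i
        by (simp add: L_def matrix_vector_mult_def if_distrib[of "\<lambda>y. y * _"] cong: if_cong)
      then show ?thesis
        unfolding Vv by (simp add: mult.commute)
    qed
    finally show "(A ** V) *v x = (V ** L) *v x"
      by (simp add: matrix_vector_mul_assoc)
  qed
  have "x = 0" if "V *v x = 0" for x
  proof -
    have "(\<Sum>y\<in>range v. x $ (inv v y) *\<^sub>R y) = 0"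
      using that v(1) by (simp add: Vv sum.reindex o_def)
    then have "x $ (inv v (v i)) = 0" for i
      using independentD[OF v(2) _ subset_refl, of "\<lambda>y. x $ (inv v y)" "v i"] by simp
    then show ?thesis
      using v(1) by (simp add: vec_eq_iff)
  qed
  then have "invertible V"
    using matrix_left_invertible_ker invertible_left_inverse by blast
  then obtain W where W: "V ** W = mat 1" "W ** V = mat 1"
    by (auto simp: invertible_def)
  have A: "A = V ** L ** W"
    by (metis AV W(1) matrix_mul_assoc matrix_mul_rid)
  have AA: "A ** A = V ** (L ** L) ** W"
  proof -
    have "A ** A = V ** L ** (W ** V) ** L ** W"
      by (simp add: A matrix_mul_assoc)
    then show ?thesis
      by (simp add: W(2) matrix_mul_assoc)
  qed
  have conj: "trace (V ** X ** W) = trace X" for X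
    by (metis W(2) matrix_mul_assoc matrix_mul_rid trace_mul_sym)
  show "trace (matrix_inv g ** h) = (\<Sum>i\<in>UNIV. l i)"
    unfolding A_def[symmetric] A conj by (simp add: L_def trace_def)
  show "trace ((matrix_inv g ** h) ** (matrix_inv g ** h)) = (\<Sum>i\<in>UNIV. (l i)\<^sup>2)"
    unfolding A_def[symmetric] AA conj
    by (simp add: L_def trace_def matrix_matrix_mult_def if_distrib power2_eq_square cong: if_cong)
qed

section \<open>Curvature and reparametrization\<close>

lemma dd_chain:
  assumes Q: "smooth_domain Q" and R: "smooth_domain R" and f: "smooth_on Q f" and p: "smooth_on R p"
    and sub: "p ` R \<subseteq> Q" and x: "x \<in> R"
  shows "dd R v (\<lambda>x. f (p x)) x = dd Q (dd R v p x) f (p x)"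
proof (rule smooth_domain.dd_eqI[OF R _ x])
  show "((\<lambda>x. f (p x)) has_derivative (\<lambda>v. dd Q (dd R v p x) f (p x))) (at x within R)"
    by (rule has_derivative_in_compose2[OF smooth_domain.smooth_has_derivative[OF Q f] sub x
          smooth_domain.smooth_has_derivative[OF R p x]])
qed

lemma dd_eq_sum_Basis:
  assumes Q: "smooth_domain Q" and f: "smooth_on Q f" and x: "x \<in> Q"
  shows "dd Q v f x = (\<Sum>b\<in>Basis. (v \<bullet> b) *\<^sub>R dd Q b f x)"
proof -
  have lin: "linear (\<lambda>v. dd Q v f x)"
    by (rule smooth_domain.dd_linear[OF Q f x])
  have "dd Q (\<Sum>b\<in>Basis. (v \<bullet> b) *\<^sub>R b) f x = (\<Sum>b\<in>Basis. (v \<bullet> b) *\<^sub>R dd Q b f x)"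
    unfolding linear_sum[OF lin] linear_scale[OF lin] ..
  then show ?thesis
    by (simp add: euclidean_representation)
qed

text \<open>The last term, with the second derivative of \<open>p\<close>, is a tangent vector when
  \<open>f\<close> parametrizes a hypersurface. It disappears from the second fundamental form, and
  \<open>normal_coordinates\<close> exploits it to make the Christoffel symbols vanish.\<close>

lemma dd2_chain:
  assumes Q: "smooth_domain Q" and R: "smooth_domain R" and f: "smooth_on Q f" and p: "smooth_on R p"
    and sub: "p ` R \<subseteq> Q" and x: "x \<in> R"
  shows "dd R w (dd R v (\<lambda>x. f (p x))) x =
    (\<Sum>b\<in>Basis. (dd R v p x \<bullet> b) *\<^sub>R dd Q (dd R w p x) (dd Q b f) (p x)) +
    dd Q (dd R w (dd R v p) x) f (p x)"
proof -
  interpret Q: smooth_domain Q by (rule Q)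
  interpret R: smooth_domain R by (rule R)
  have px: "p x \<in> Q"
    using sub x by auto
  have s: "smooth_on R (\<lambda>x. dd R v p x \<bullet> b)" "smooth_on R (\<lambda>x. dd Q b f (p x))" for b
    by (intro smooth_on_inner smooth_on_const R.smooth_dd smooth_on_compose[OF Q.smooth_dd[OF f] p sub] p)+
  have "dd R w (dd R v (\<lambda>x. f (p x))) x =
    dd R w (\<lambda>x. \<Sum>b\<in>Basis. (dd R v p x \<bullet> b) *\<^sub>R dd Q b f (p x)) x"
  proof (rule R.dd_cong[OF _ _ x])
    show "smooth_on R (dd R v (\<lambda>x. f (p x)))"
      by (intro R.smooth_dd smooth_on_compose[OF f p sub])
    show "dd R v (\<lambda>x. f (p x)) x = (\<Sum>b\<in>Basis. (dd R v p x \<bullet> b) *\<^sub>R dd Q b f (p x))" if "x \<in> R" for x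
      using that sub unfolding dd_chain[OF Q R f p sub that] by (intro dd_eq_sum_Basis[OF Q f]) auto
  qed
  also have "\<dots> = (\<Sum>b\<in>Basis. dd R w (\<lambda>x. (dd R v p x \<bullet> b) *\<^sub>R dd Q b f (p x)) x)"
    by (intro R.dd_sum smooth_on_scaleR s x)
  also have "\<dots> = (\<Sum>b\<in>Basis. (dd R v p x \<bullet> b) *\<^sub>R dd Q (dd R w p x) (dd Q b f) (p x) +
      (dd R w (dd R v p) x \<bullet> b) *\<^sub>R dd Q b f (p x))"
  proof (intro sum.cong refl)
    fix b
    have "dd R w (\<lambda>x. (dd R v p x \<bullet> b) *\<^sub>R dd Q b f (p x)) x =
      (dd R v p x \<bullet> b) *\<^sub>R dd R w (\<lambda>x. dd Q b f (p x)) x +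
      dd R w (\<lambda>x. dd R v p x \<bullet> b) x *\<^sub>R dd Q b f (p x)"
      by (rule R.dd_bounded_bilinear[OF bounded_bilinear_scaleR s x])
    then show "dd R w (\<lambda>x. (dd R v p x \<bullet> b) *\<^sub>R dd Q b f (p x)) x =
      (dd R v p x \<bullet> b) *\<^sub>R dd Q (dd R w p x) (dd Q b f) (p x) +
      (dd R w (dd R v p) x \<bullet> b) *\<^sub>R dd Q b f (p x)"
      unfolding R.dd_inner_const[OF R.smooth_dd[OF p] x]
        dd_chain[OF Q R Q.smooth_dd[OF f] p sub x] .
  qed
  finally show ?thesis
    unfolding dd_eq_sum_Basis[OF Q f px, of "dd R w (dd R v p) x"] by (simp add: sum.distrib)
qed

lemma dd_open:
  assumes "open U" "u \<in> U"
  shows "dd U v f u = frechet_derivative f (at u) v"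
  unfolding dd_def at_within_open[OF assms(2,1)] ..

lemma partial_eq_dd: "open U \<Longrightarrow> u \<in> U \<Longrightarrow> partial i F u = dd U (axis i 1) F u"
  by (simp add: partial_def dd_open)

lemma smooth_on_differentiable:
  assumes "open U" "smooth_on U f" "u \<in> U"
  shows "f differentiable (at u)"
  using smooth_domain.smooth_has_derivative[OF smooth_domain_open[OF assms(1)] assms(2,3)]
  unfolding differentiable_def at_within_open[OF assms(3,1)] by blast

lemma partial2_eq_dd:
  assumes U: "open U" and F: "smooth_on U F" and u: "u \<in> U"
  shows "partial j (partial i F) u = dd U (axis j 1) (dd U (axis i 1) F) u"
proof -
  have s: "smooth_on U (dd U (axis i 1) F)"
    by (rule smooth_domain.smooth_dd[OF smooth_domain_open[OF U] F])
  have "frechet_derivative (dd U (axis i 1) F) (at u) = frechet_derivative (partial i F) (at u)"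
    by (rule frechet_derivative_transform_within_open[OF smooth_on_differentiable[OF U s u] U u])
      (simp add: partial_eq_dd[OF U])
  then show ?thesis
    by (simp add: partial_def[of j] dd_open[OF U u])
qed

lemma second_form_sym:
  assumes U: "open U" and F: "smooth_on U F" and u: "u \<in> U"
  shows "transpose (second_form F n u) = second_form F n u"
proof -
  have "transpose (second_form F n u) $ i $ j = second_form F n u $ i $ j" for i j
    using smooth_domain.dd_commute[OF smooth_domain_open[OF U] F u, of "axis i 1" "axis j 1"]
    by (simp add: transpose_def second_form_def partial2_eq_dd[OF assms])
  then show ?thesis
    by (simp add: vec_eq_iff)
qed

lemma first_form_sym: "transpose (first_form F u) = first_form F u"
  by (simp add: first_form_def transpose_def vec_eq_iff inner_commute)

lemma frechet_derivative_eq_sum_partial: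
  assumes "F differentiable (at u)"
  shows "frechet_derivative F (at u) v = (\<Sum>i\<in>UNIV. v $ i *\<^sub>R partial i F u)"
proof -
  have "linear (frechet_derivative F (at u))"
    using assms by (rule linear_frechet_derivative)
  then have "frechet_derivative F (at u) (\<Sum>i\<in>UNIV. v $ i *\<^sub>R axis i 1) = (\<Sum>i\<in>UNIV. v $ i *\<^sub>R partial i F u)"
    by (simp add: linear_sum linear_scale partial_def)
  moreover have "(\<Sum>i\<in>UNIV. v $ i *\<^sub>R axis i 1) = v"
    using basis_expansion[of v] by (simp add: scalar_mult_eq_scaleR)
  ultimately show ?thesis
    by simp
qed

lemma first_form_inner:
  assumes "F differentiable (at u)"
  shows "frechet_derivative F (at u) x \<bullet> frechet_derivative F (at u) y = (first_form F u *v x) \<bullet> y"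
proof -
  have *: "z \<bullet> y = (\<Sum>i\<in>UNIV. z $ i * y $ i)" for z
    by (simp add: inner_vec_def)
  show ?thesis
    unfolding * frechet_derivative_eq_sum_partial[OF assms] inner_sum_right unfolding inner_sum_left
    by (simp add: first_form_def matrix_vector_mult_def sum_distrib_left mult_ac inner_commute)
qed

lemma first_form_pos_def:
  assumes "F differentiable (at u)" "inj (frechet_derivative F (at u))"
  shows "pos_def (first_form F u)"
proof -
  have "x \<bullet> (first_form F u *v x) > 0" if "x \<noteq> 0" for x
  proof -
    have "linear (frechet_derivative F (at u))"
      using assms(1) by (rule linear_frechet_derivative)
    then have "frechet_derivative F (at u) x \<noteq> 0"
      using assms(2) that by (metis injD linear_0)
    then have "frechet_derivative F (at u) x \<bullet> frechet_derivative F (at u) x > 0"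
      by simp
    then show ?thesis
      unfolding first_form_inner[OF assms(1)] by (simp add: inner_commute)
  qed
  then show ?thesis
    by (simp add: pos_def_def first_form_sym)
qed

section \<open>The Weingarten map and its traces\<close>

definition shape :: "(real^3 \<Rightarrow> real^4) \<Rightarrow> real^4 \<Rightarrow> real^3 \<Rightarrow> real^3^3" where
  "shape F n u = matrix_inv (first_form F u) ** second_form F n u"

text \<open>For \<open>a + b + c > 0\<close>, the inequality \<open>phi a b c \<le> 1/8\<close> says that this quantity is
  nonpositive.\<close>

definition pinching :: "real^3^3 \<Rightarrow> real" where
  "pinching B = 8 * trace (B ** B) - 3 * (trace B)\<^sup>2"

lemma principal_curvatures_trace:
  assumes "invertible (first_form F u)" "principal_curvatures F n u l"
  shows "trace (shape F n u) = (\<Sum>i\<in>UNIV. l $ i)"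
    and "trace (shape F n u ** shape F n u) = (\<Sum>i\<in>UNIV. (l $ i)\<^sup>2)"
proof -
  obtain v :: "3 \<Rightarrow> real^3" where "inj v" "independent (range v)"
    "\<And>i. second_form F n u *v v i = (l $ i) *\<^sub>R (first_form F u *v v i)"
    using assms(2) unfolding principal_curvatures_def by auto
  from trace_eigenbasis[OF assms(1) this]
  show "trace (shape F n u) = (\<Sum>i\<in>UNIV. l $ i)"
    and "trace (shape F n u ** shape F n u) = (\<Sum>i\<in>UNIV. (l $ i)\<^sup>2)"
    by (simp_all add: shape_def)
qed

lemma principal_frame:
  assumes "pos_def (first_form F u)" "transpose (second_form F n u) = second_form F n u"
  obtains v :: "3 \<Rightarrow> real^3" and l :: "real^3"
  where "principal_curvatures F n u l"
    "\<And>i. second_form F n u *v v i = (l $ i) *\<^sub>R (first_form F u *v v i)"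
    "\<And>i j. (first_form F u *v v i) \<bullet> v j = (if i = j then 1 else 0)"
proof -
  obtain v :: "3 \<Rightarrow> real^3" and l where "(\<forall>i. second_form F n u *v v i = l i *\<^sub>R (first_form F u *v v i)) \<and>
    (\<forall>i j. (first_form F u *v v i) \<bullet> v j = (if i = j then 1 else 0))"
    using matrix_simultaneous_diagonalization[OF assms] by (elim exE)
  then have eig: "\<And>i. second_form F n u *v v i = l i *\<^sub>R (first_form F u *v v i)"
    and orth: "\<And>i j. (first_form F u *v v i) \<bullet> v j = (if i = j then 1 else 0)"
    by simp_all
  have "principal_curvatures F n u (\<chi> i. l i)"
    unfolding principal_curvatures_def using orthonormal_form_independent[OF orth] eig
    by (intro exI[of _ v]) simp
  then show ?thesis
    using that[of "\<chi> i. l i" v] eig orth by simp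
qed

text \<open>This justifies the description operator in \<open>mean_curvature\<close>: principal
  curvatures exist by \<open>principal_frame\<close>, and every list of them sums to the
  trace.\<close>

lemma mean_curvature_eq_trace:
  assumes g: "pos_def (first_form F u)" "transpose (second_form F n u) = second_form F n u"
  shows "mean_curvature F n u = trace (shape F n u)"
proof -
  obtain v :: "3 \<Rightarrow> real^3" and l where l: "principal_curvatures F n u l"
    by (rule principal_frame[OF g])
  have *: "l $ 1 + l $ 2 + l $ 3 = trace (shape F n u)" if "principal_curvatures F n u l" for l
    using principal_curvatures_trace(1)[OF invertible_pos_def[OF g(1)] that] by (simp add: sum_3)
  show ?thesis
    unfolding mean_curvature_def
  proof (rule the_equality)
    show "\<exists>l. principal_curvatures F n u l \<and> trace (shape F n u) = l $ 1 + l $ 2 + l $ 3"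
      using l *[OF l] by (intro exI[of _ l]) simp
  qed (use * in auto)
qed

lemma pinching_principal_curvatures:
  assumes "invertible (first_form F u)" "principal_curvatures F n u (vector [a, b, c])"
  shows "pinching (shape F n u) = 8 * (a\<^sup>2 + b\<^sup>2 + c\<^sup>2) - 3 * (a + b + c)\<^sup>2"
  unfolding pinching_def principal_curvatures_trace[OF assms] by (simp add: sum_3 vector_3)

section \<open>Change of parameters\<close>

lemma sum_Basis_cart:
  fixes v :: "real^'n"
  shows "(\<Sum>b\<in>Basis. (v \<bullet> b) *\<^sub>R f b) = (\<Sum>i\<in>UNIV. v $ i *\<^sub>R f (axis i 1))"
proof -
  have B: "(Basis :: (real^'n) set) = range (\<lambda>i. axis i 1)"
    by (auto simp: Basis_vec_def)
  have "inj (\<lambda>i. axis i 1 :: real^'n)"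
    by (auto intro!: injI simp: axis_eq_axis)
  then show ?thesis
    unfolding B by (simp add: sum.reindex inner_axis)
qed

definition jacobian_matrix :: "(real^3) set \<Rightarrow> (real^3 \<Rightarrow> real^3) \<Rightarrow> real^3 \<Rightarrow> real^3^3" where
  "jacobian_matrix V p y = (\<chi> a i. dd V (axis i 1) p y $ a)"

lemma transpose_mult_mult:
  fixes J g :: "real^'n^'n"
  shows "(transpose J ** g ** J) $ i $ j = (\<Sum>a\<in>UNIV. \<Sum>b\<in>UNIV. J $ a $ i * J $ b $ j * g $ a $ b)"
proof -
  have "(transpose J ** g ** J) $ i $ j = (\<Sum>b\<in>UNIV. \<Sum>a\<in>UNIV. J $ a $ i * J $ b $ j * g $ a $ b)"
    by (simp add: matrix_matrix_mult_def transpose_def sum_distrib_left sum_distrib_right mult_ac)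
  then show ?thesis
    by (subst sum.swap)
qed

context
  fixes U V :: "(real^3) set" and F :: "real^3 \<Rightarrow> real^4" and p :: "real^3 \<Rightarrow> real^3" and y :: "real^3"
  assumes U: "open U" and V: "open V" and F: "smooth_on U F" and p: "smooth_on V p"
    and sub: "p ` V \<subseteq> U" and y: "y \<in> V"
begin

lemma partial_reparam:
  "partial i (\<lambda>y. F (p y)) y = (\<Sum>a\<in>UNIV. jacobian_matrix V p y $ a $ i *\<^sub>R partial a F (p y))"
proof -
  have py: "p y \<in> U"
    using sub y by auto
  have "partial i (\<lambda>y. F (p y)) y = dd U (dd V (axis i 1) p y) F (p y)"
    unfolding partial_eq_dd[OF V y]
    by (rule dd_chain[OF smooth_domain_open[OF U] smooth_domain_open[OF V] F p sub y])
  also have "\<dots> = (\<Sum>a\<in>UNIV. dd V (axis i 1) p y $ a *\<^sub>R partial a F (p y))"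
    unfolding dd_open[OF U py]
    by (rule frechet_derivative_eq_sum_partial[OF smooth_on_differentiable[OF U F py]])
  finally show ?thesis
    by (simp add: jacobian_matrix_def)
qed

lemma first_form_reparam:
  "first_form (\<lambda>y. F (p y)) y = transpose (jacobian_matrix V p y) ** first_form F (p y) ** jacobian_matrix V p y"
proof -
  have "partial i (\<lambda>y. F (p y)) y \<bullet> partial j (\<lambda>y. F (p y)) y =
    (\<Sum>a\<in>UNIV. \<Sum>b\<in>UNIV. jacobian_matrix V p y $ a $ i * jacobian_matrix V p y $ b $ j *
      (partial a F (p y) \<bullet> partial b F (p y)))" for i j
    unfolding partial_reparam inner_sum_left unfolding inner_sum_right by (simp add: mult_ac)
  then show ?thesis
    by (simp add: vec_eq_iff transpose_mult_mult first_form_def)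
qed

text \<open>The term with the second derivative of \<open>p\<close> is tangential and is annihilated
  by \<open>n\<close>; this is why the form transforms as a tensor.\<close>

lemma second_form_reparam:
  assumes n: "\<And>a. n \<bullet> partial a F (p y) = 0"
  shows "second_form (\<lambda>y. F (p y)) n y =
    transpose (jacobian_matrix V p y) ** second_form F n (p y) ** jacobian_matrix V p y"
proof -
  have py: "p y \<in> U"
    using sub y by auto
  note domU = smooth_domain_open[OF U] and domV = smooth_domain_open[OF V]
  have smU: "smooth_on U (dd U v F)" for v
    by (rule smooth_domain.smooth_dd[OF domU F])
  have "partial j (partial i (\<lambda>y. F (p y))) y \<bullet> n =
    (\<Sum>a\<in>UNIV. \<Sum>b\<in>UNIV. jacobian_matrix V p y $ a $ i * (jacobian_matrix V p y $ b $ j * (partial b (partial a F) (p y) \<bullet> n)))"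
    for i j
  proof -
    have "partial j (partial i (\<lambda>y. F (p y))) y =
      (\<Sum>a\<in>UNIV. dd V (axis i 1) p y $ a *\<^sub>R dd U (dd V (axis j 1) p y) (dd U (axis a 1) F) (p y)) +
      dd U (dd V (axis j 1) (dd V (axis i 1) p) y) F (p y)"
      unfolding partial2_eq_dd[OF V smooth_on_compose[OF F p sub] y]
        dd2_chain[OF domU domV F p sub y] sum_Basis_cart ..
    moreover have "dd U v F (p y) \<bullet> n = 0" for v
      unfolding dd_open[OF U py]
        frechet_derivative_eq_sum_partial[OF smooth_on_differentiable[OF U F py]]
      by (simp add: inner_commute[of _ n] inner_sum_right n)
    moreover have "dd U v (dd U (axis a 1) F) (p y) = (\<Sum>b\<in>UNIV. v $ b *\<^sub>R partial b (partial a F) (p y))" for v a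
      unfolding dd_eq_sum_Basis[OF domU smU py, of v] sum_Basis_cart partial2_eq_dd[OF U F py] ..
    ultimately show ?thesis
      by (simp add: inner_add_left inner_sum_left sum_distrib_left jacobian_matrix_def)
  qed
  then show ?thesis
    by (simp add: vec_eq_iff transpose_mult_mult second_form_def mult_ac sum_negf)
qed

text \<open>The Weingarten map \<open>A\<close> changes to \<open>K ** A ** J\<close>, where
  \<open>K\<close> is the inverse of the Jacobian \<open>J\<close>, and the traces of
  \<open>A\<close> and \<open>A ** A\<close> are invariant under conjugation.\<close>

lemma shape_reparam:
  assumes n: "\<And>a. n \<bullet> partial a F (p y) = 0"
    and J: "invertible (jacobian_matrix V p y)" and g: "invertible (first_form F (p y))"
  shows "trace (shape (\<lambda>y. F (p y)) n y) = trace (shape F n (p y))"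
    and "pinching (shape (\<lambda>y. F (p y)) n y) = pinching (shape F n (p y))"
proof -
  define J where "J = jacobian_matrix V p y"
  define K where "K = matrix_inv J"
  define g where "g = first_form F (p y)"
  define A where "A = shape F n (p y)"
  have JK: "J ** K = mat 1" "K ** J = mat 1"
    using matrix_inv_inverse[OF assms(2)] by (simp_all add: J_def K_def)
  have gi: "g ** matrix_inv g = mat 1" "matrix_inv g ** g = mat 1"
    using matrix_inv_inverse[OF assms(3)] by (simp_all add: g_def)
  define g' where "g' = transpose J ** g ** J"
  have tJ: "transpose J ** transpose K = mat 1" "transpose K ** transpose J = mat 1"
    by (simp_all flip: matrix_transpose_mul add: JK)
  define k where "k = K ** matrix_inv g ** transpose K"
  have k: "k ** g' = mat 1"
  proof -
    have "k ** g' = K ** (matrix_inv g ** ((transpose K ** transpose J) ** g)) ** J"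
      by (simp add: k_def g'_def matrix_mul_assoc)
    then show ?thesis
      by (simp add: tJ gi JK)
  qed
  then have "invertible g'"
    using invertible_left_inverse by blast
  then have "matrix_inv g' = k"
    by (metis k matrix_inv_inverse(1) matrix_mul_assoc matrix_mul_lid matrix_mul_rid)
  then have "shape (\<lambda>y. F (p y)) n y = k ** (transpose J ** second_form F n (p y) ** J)"
    unfolding shape_def first_form_reparam second_form_reparam[OF n] g'_def g_def J_def by simp
  also have "\<dots> = K ** (matrix_inv g ** ((transpose K ** transpose J) ** second_form F n (p y))) ** J"
    by (simp add: k_def matrix_mul_assoc)
  also have "\<dots> = K ** A ** J"
    by (simp add: tJ A_def shape_def g_def)
  finally have s: "shape (\<lambda>y. F (p y)) n y = K ** A ** J" .
  have conj: "trace (K ** X ** J) = trace X" for X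
    by (metis JK(1) matrix_mul_assoc matrix_mul_rid trace_mul_sym)
  have "(K ** A ** J) ** (K ** A ** J) = K ** (A ** (J ** K) ** A) ** J"
    by (simp add: matrix_mul_assoc)
  then have s2: "(K ** A ** J) ** (K ** A ** J) = K ** (A ** A) ** J"
    by (simp add: JK)
  show "trace (shape (\<lambda>y. F (p y)) n y) = trace (shape F n (p y))"
    unfolding s conj A_def ..
  show "pinching (shape (\<lambda>y. F (p y)) n y) = pinching (shape F n (p y))"
    unfolding pinching_def s s2 conj unfolding A_def ..
qed

end

section \<open>Time slices of a space-time map\<close>

lemma smooth_on_Pair_const: "smooth_on S (\<lambda>u. (u, c))"
proof -
  have "smooth_on S (\<lambda>u. (u, 0) + (0, c))"
    by (intro smooth_on_add smooth_on_const smooth_on_linear bounded_linear_intros)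
  then show ?thesis
    by simp
qed

context
  fixes V :: "(real^3) set" and I :: "real set" and G :: "(real^3) \<times> real \<Rightarrow> real^4"
  assumes V: "open V" and I: "convex I" "interior I \<noteq> {}" and G: "smooth_on (V \<times> I) G"
begin

lemma smooth_slice: "t \<in> I \<Longrightarrow> smooth_on V (\<lambda>u. G (u, t))"
  by (rule smooth_on_compose[OF G smooth_on_Pair_const]) auto

lemma dd_slice:
  assumes f: "smooth_on (V \<times> I) f" and u: "u \<in> V" "t \<in> I"
  shows "dd V v (\<lambda>u. f (u, t)) u = dd (V \<times> I) (v, 0) f (u, t)"
proof -
  note dom = smooth_domain_times_interval[OF V I]
  have "dd V v (\<lambda>u. (u, t)) u = (v, 0)"
    by (rule smooth_domain.dd_eqI[OF smooth_domain_open[OF V] _ u(1)])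
      (auto intro!: derivative_eq_intros)
  then show ?thesis
    using dd_chain[OF dom smooth_domain_open[OF V] f smooth_on_Pair_const _ u(1), of t v] u(2)
    by auto
qed

lemma partial_slice:
  assumes u: "u \<in> V" "t \<in> I"
  shows "partial i (\<lambda>u. G (u, t)) u = dd (V \<times> I) (space_dir i) G (u, t)"
  unfolding partial_eq_dd[OF V u(1)] dd_slice[OF G u] space_dir_def ..

lemma partial2_slice:
  assumes u: "u \<in> V" "t \<in> I"
  shows "partial j (partial i (\<lambda>u. G (u, t))) u =
    dd (V \<times> I) (space_dir j) (dd (V \<times> I) (space_dir i) G) (u, t)"
proof -
  note dom = smooth_domain_times_interval[OF V I]
  note smooth = smooth_domain.smooth_dd[OF dom G]
  have "partial j (partial i (\<lambda>u. G (u, t))) u = dd V (axis j 1) (dd V (axis i 1) (\<lambda>u. G (u, t))) u"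
    by (rule partial2_eq_dd[OF V smooth_slice[OF u(2)] u(1)])
  also have "\<dots> = dd V (axis j 1) (\<lambda>u. dd (V \<times> I) (space_dir i) G (u, t)) u"
    by (rule smooth_domain.dd_cong[OF smooth_domain_open[OF V] _ _ u(1)])
      (auto simp: space_dir_def dd_slice[OF G _ u(2)]
        intro!: smooth_domain.smooth_dd[OF smooth_domain_open[OF V]] smooth_slice u)
  also have "\<dots> = dd (V \<times> I) (space_dir j) (dd (V \<times> I) (space_dir i) G) (u, t)"
    unfolding dd_slice[OF smooth u] by (simp add: space_dir_def)
  finally show ?thesis .
qed

end

section \<open>Moving charts\<close>

lemma matrix_inv_unique_left:
  fixes g k :: "real^'n^'n"
  assumes "g ** k = mat 1"
  shows "matrix_inv g = k"
proof -
  have "k ** g = mat 1"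
    using assms matrix_left_right_inverse by blast
  with assms have "invertible g"
    by (auto simp: invertible_def)
  then have "k ** (g ** matrix_inv g) = k"
    by (simp add: matrix_inv_inverse)
  then show ?thesis
    by (simp add: matrix_mul_assoc \<open>k ** g = mat 1\<close>)
qed

text \<open>The cofactor formula displays the entries of the inverse as polynomials divided by the
  determinant, from which smooth dependence on a parameter is evident.\<close>

definition adjugate3 :: "real^3^3 \<Rightarrow> real^3^3" where
  "adjugate3 g = vector
    [vector [g $ 2 $ 2 * g $ 3 $ 3 - g $ 2 $ 3 * g $ 3 $ 2, g $ 1 $ 3 * g $ 3 $ 2 - g $ 1 $ 2 * g $ 3 $ 3,
       g $ 1 $ 2 * g $ 2 $ 3 - g $ 1 $ 3 * g $ 2 $ 2],
     vector [g $ 2 $ 3 * g $ 3 $ 1 - g $ 2 $ 1 * g $ 3 $ 3, g $ 1 $ 1 * g $ 3 $ 3 - g $ 1 $ 3 * g $ 3 $ 1,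
       g $ 1 $ 3 * g $ 2 $ 1 - g $ 1 $ 1 * g $ 2 $ 3],
     vector [g $ 2 $ 1 * g $ 3 $ 2 - g $ 2 $ 2 * g $ 3 $ 1, g $ 1 $ 2 * g $ 3 $ 1 - g $ 1 $ 1 * g $ 3 $ 2,
       g $ 1 $ 1 * g $ 2 $ 2 - g $ 1 $ 2 * g $ 2 $ 1]]"

lemma matrix_inv_adjugate3:
  assumes "invertible g"
  shows "matrix_inv g $ i $ j = adjugate3 g $ i $ j * inverse (det g)"
proof -
  have d: "det g \<noteq> 0"
    using assms by (simp add: invertible_det_nz)
  have "g ** (\<chi> i j. adjugate3 g $ i $ j * inverse (det g)) = mat 1"
  proof -
    have "(g ** (\<chi> i j. adjugate3 g $ i $ j * inverse (det g))) $ i $ j =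
      (\<Sum>k\<in>UNIV. g $ i $ k * adjugate3 g $ k $ j) * inverse (det g)" for i j
      by (simp add: matrix_matrix_mult_def sum_distrib_left mult_ac)
    moreover have "(\<Sum>k\<in>UNIV. g $ i $ k * adjugate3 g $ k $ j) = (if i = j then det g else 0)" for i j
    proof -
      have "\<forall>i j. (\<Sum>k\<in>UNIV. g $ i $ k * adjugate3 g $ k $ j) = (if i = j then det g else 0)"
        unfolding forall_3 sum_3 adjugate3_def vector_3 det_3 by (simp add: algebra_simps)
      then show ?thesis
        by blast
    qed
    ultimately show ?thesis
      using d by (simp add: vec_eq_iff mat_def)
  qed
  from matrix_inv_unique_left[OF this] show ?thesis
    by simp
qed

lemma smooth_matrix_inv:
  fixes g :: "'a::euclidean_space \<Rightarrow> real^3^3"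
  assumes g: "\<And>i j. smooth_on S (\<lambda>x. g x $ i $ j)" and inv: "\<And>x. x \<in> S \<Longrightarrow> invertible (g x)"
  shows "smooth_on S (\<lambda>x. matrix_inv (g x) $ i $ j)"
proof -
  have "smooth_on S (\<lambda>x. det (g x))"
    unfolding det_3 by (intro smooth_intros g)
  then have d: "smooth_on S (\<lambda>x. inverse (det (g x)))"
    using inv by (intro smooth_on_inverse) (simp_all add: invertible_det_nz)
  have a: "\<forall>i j. smooth_on S (\<lambda>x. adjugate3 (g x) $ i $ j)"
    unfolding forall_3 adjugate3_def vector_3 by (intro conjI smooth_intros g)
  have "smooth_on S (\<lambda>x. adjugate3 (g x) $ i $ j * inverse (det (g x)))"
    by (intro smooth_on_mult d a[rule_format])
  then show ?thesis
    by (rule smooth_on_cong) (simp add: matrix_inv_adjugate3 inv)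
qed

lemma pos_def_congruence:
  fixes J g :: "real^'n^'n"
  assumes "pos_def g" "invertible J"
  shows "pos_def (transpose J ** g ** J)"
proof -
  have "transpose (transpose J ** g ** J) = transpose J ** g ** J"
    using assms(1) by (simp add: pos_def_def matrix_transpose_mul matrix_mul_assoc)
  moreover have "x \<bullet> ((transpose J ** g ** J) *v x) > 0" if "x \<noteq> 0" for x
  proof -
    have "J *v x \<noteq> 0"
      using that assms(2) by (metis invertible_def matrix_left_invertible_ker)
    moreover have "x \<bullet> ((transpose J ** g ** J) *v x) = (J *v x) \<bullet> (g *v (J *v x))"
      by (metis dot_lmul_matrix matrix_vector_mul_assoc transpose_matrix_vector transpose_transpose)
    ultimately show ?thesis
      using assms(1) by (simp add: pos_def_def)
  qed
  ultimately show ?thesis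
    by (simp add: pos_def_def)
qed

text \<open>The first fundamental form is the Gram matrix of the partial derivatives, so the
  coefficients of a vanishing combination annihilate a positive definite quadratic form.\<close>

lemma independent_partials:
  assumes "pos_def (first_form F u)"
  shows "inj (\<lambda>i. partial i F u)" "independent (range (\<lambda>i. partial i F u))"
proof -
  have q: "c \<bullet> (first_form F u *v c) = (\<Sum>i\<in>UNIV. c $ i *\<^sub>R partial i F u) \<bullet> (\<Sum>i\<in>UNIV. c $ i *\<^sub>R partial i F u)" for c
  proof -
    have *: "c \<bullet> y = (\<Sum>i\<in>UNIV. c $ i * y $ i)" for y
      by (simp add: inner_vec_def)
    show ?thesis
      unfolding * unfolding inner_sum_left unfolding inner_sum_right
      by (simp add: first_form_def matrix_vector_mult_def sum_distrib_left mult_ac)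
  qed
  have zero: "c = 0" if "(\<Sum>i\<in>UNIV. c $ i *\<^sub>R partial i F u) = 0" for c
    using q[of c] assms that unfolding pos_def_def by force
  show inj: "inj (\<lambda>i. partial i F u)"
  proof (rule injI, rule ccontr)
    fix i j assume eq: "partial i F u = partial j F u" and "i \<noteq> j"
    have "(\<Sum>k\<in>UNIV. (axis i 1 - axis j 1 :: real^3) $ k *\<^sub>R partial k F u) = 0"
      using eq by (simp add: axis_def scaleR_diff_left sum_subtractf if_distrib[of "\<lambda>x. x *\<^sub>R _"] cong: if_cong)
    then have "axis i 1 = (axis j 1 :: real^3)"
      using zero[of "axis i 1 - axis j 1"] by simp
    with \<open>i \<noteq> j\<close> show False
      by (simp add: axis_eq_axis)
  qed
  show "independent (range (\<lambda>i. partial i F u))"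
  proof (rule independent_if_scalars_zero)
    fix c x assume c: "(\<Sum>y\<in>range (\<lambda>i. partial i F u). c y *\<^sub>R y) = 0" and "x \<in> range (\<lambda>i. partial i F u)"
    then obtain i where i: "x = partial i F u"
      by auto
    have "(\<Sum>i\<in>UNIV. (\<chi> i. c (partial i F u)) $ i *\<^sub>R partial i F u) = 0"
      using c by (simp add: sum.reindex[OF inj] o_def)
    then have "(\<chi> i. c (partial i F u)) = 0"
      by (rule zero)
    then show "c x = 0"
      by (simp add: i vec_eq_iff)
  qed simp
qed

text \<open>The normal is given pointwise, without regularity in space or time; its smoothness is
  derived from convexity. The speed is expressed by a trace instead of
  \<open>mean_curvature\<close>, since the trace depends smoothly on the two forms and is invariant
  under changes of parameters.\<close>

locale moving_chart =
  fixes V :: "(real^3) set" and I :: "real set" and G \<nu> :: "(real^3) \<times> real \<Rightarrow> real^4"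
  assumes V: "open V" and I: "convex I" "interior I \<noteq> {}" and G: "smooth_on (V \<times> I) G"
    and unit: "\<And>u t. u \<in> V \<Longrightarrow> t \<in> I \<Longrightarrow> norm (\<nu> (u, t)) = 1"
    and normal: "\<And>u t i. u \<in> V \<Longrightarrow> t \<in> I \<Longrightarrow> \<nu> (u, t) \<bullet> partial i (\<lambda>u. G (u, t)) u = 0"
    and immersion: "\<And>u t. u \<in> V \<Longrightarrow> t \<in> I \<Longrightarrow> pos_def (first_form (\<lambda>u. G (u, t)) u)"
    and convex: "\<And>u t. u \<in> V \<Longrightarrow> t \<in> I \<Longrightarrow> pos_def (second_form (\<lambda>u. G (u, t)) (\<nu> (u, t)) u)"
    and flow: "\<And>u t. u \<in> V \<Longrightarrow> t \<in> I \<Longrightarrow> dd (V \<times> I) time_dir G (u, t) =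
      - (trace (shape (\<lambda>u. G (u, t)) (\<nu> (u, t)) u) ^ 3) *\<^sub>R \<nu> (u, t)"
begin

sublocale smooth_domain "V \<times> I"
  by (rule smooth_domain_times_interval[OF V I])

definition weingarten :: "(real^3) \<times> real \<Rightarrow> real^3^3" where
  "weingarten x = shape (\<lambda>u. G (u, snd x)) (\<nu> x) (fst x)"

abbreviation "Q \<equiv> V \<times> I"
abbreviation "F i \<equiv> dd Q (space_dir i) G"
abbreviation "FF i j \<equiv> dd Q (space_dir j) (F i)"

lemma smooth_F: "smooth_on Q (F i)" "smooth_on Q (FF i j)"
  by (intro smooth_dd G)+

lemma first_form_eq: "x \<in> Q \<Longrightarrow> first_form (\<lambda>u. G (u, snd x)) (fst x) $ i $ j = F i x \<bullet> F j x"
  by (auto simp: first_form_def partial_slice[OF V I G])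

lemma second_form_eq: "x \<in> Q \<Longrightarrow> second_form (\<lambda>u. G (u, snd x)) n (fst x) $ i $ j = - (FF i j x \<bullet> n)"
  by (auto simp: second_form_def partial2_slice[OF V I G])

lemma smooth_first_form: "smooth_on Q (\<lambda>x. first_form (\<lambda>u. G (u, snd x)) (fst x) $ i $ j)"
  by (rule smooth_on_cong[OF smooth_on_inner[OF smooth_F(1) smooth_F(1)]]) (simp add: first_form_eq)

lemma invertible_first_form: "x \<in> Q \<Longrightarrow> invertible (first_form (\<lambda>u. G (u, snd x)) (fst x))"
  by (rule invertible_pos_def) (use immersion in auto)

text \<open>The normal component of \<open>- FF 1 1\<close> is a positive multiple of \<open>\<nu>\<close> by convexity.\<close>

lemma smooth_normal: "smooth_on Q \<nu>"
proof -
  define gi where "gi x = matrix_inv (first_form (\<lambda>u. G (u, snd x)) (fst x))" for x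
  \<comment> \<open>The double sum is the tangential part of \<open>FF 1 1\<close>, expressed with
    the inverse metric. Thus \<open>N\<close> is built from \<open>G\<close> alone, and its
    smoothness is known before anything is known about \<open>\<nu>\<close>. The axis
    \<open>1\<close> is an arbitrary choice.\<close>
  define N where "N x = (\<Sum>i\<in>UNIV. \<Sum>j\<in>UNIV. (gi x $ j $ i * (FF 1 1 x \<bullet> F j x)) *\<^sub>R F i x) - FF 1 1 x" for x
  have gi: "smooth_on Q (\<lambda>x. gi x $ i $ j)" for i j
    unfolding gi_def by (rule smooth_matrix_inv[OF smooth_first_form invertible_first_form])
  have N: "smooth_on Q N"
    unfolding N_def[abs_def] by (intro smooth_intros smooth_F gi)
  have main: "sqrt (N x \<bullet> N x) > 0 \<and> N x \<bullet> N x > 0 \<and> \<nu> x = inverse (sqrt (N x \<bullet> N x)) *\<^sub>R N x" if x: "x \<in> Q" for x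
  proof -
    obtain u t where ut: "x = (u, t)" "u \<in> V" "t \<in> I"
      using x by auto
    have F: "F i x = partial i (\<lambda>u. G (u, t)) u" for i
      using ut by (simp add: partial_slice[OF V I G])
    have nF: "\<nu> x \<bullet> F i x = 0" for i
      unfolding F unfolding ut(1) by (rule normal[OF ut(2,3)])
    have nn: "\<nu> x \<bullet> \<nu> x = 1"
      using unit[OF ut(2,3)] ut(1) by (simp add: norm_eq_1)
    have NF: "N x \<bullet> F k x = 0" for k
    proof -
      have "(\<Sum>i\<in>UNIV. gi x $ j $ i * (F i x \<bullet> F k x)) =
        (gi x ** first_form (\<lambda>u. G (u, snd x)) (fst x)) $ j $ k" for j
        by (simp add: matrix_matrix_mult_def first_form_eq[OF x])
      then have inv: "(\<Sum>i\<in>UNIV. gi x $ j $ i * (F i x \<bullet> F k x)) = (if j = k then 1 else 0)" for j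
        unfolding gi_def matrix_inv_inverse(2)[OF invertible_first_form[OF x]] by (simp add: mat_def)
      have "(\<Sum>i\<in>UNIV. \<Sum>j\<in>UNIV. (gi x $ j $ i * (FF 1 1 x \<bullet> F j x)) *\<^sub>R F i x) \<bullet> F k x =
        (\<Sum>j\<in>UNIV. (FF 1 1 x \<bullet> F j x) * (\<Sum>i\<in>UNIV. gi x $ j $ i * (F i x \<bullet> F k x)))"
        unfolding inner_sum_left sum_distrib_left by (subst sum.swap) (simp add: mult_ac)
      also have "\<dots> = FF 1 1 x \<bullet> F k x"
        unfolding inv by (simp add: if_distrib cong: if_cong)
      finally show ?thesis
        by (simp add: N_def inner_diff_left)
    qed
    have Nn: "N x \<bullet> \<nu> x = - (FF 1 1 x \<bullet> \<nu> x)"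
      by (simp add: N_def inner_diff_left inner_sum_left inner_commute[of "F _ x"] nF)
    also have "\<dots> = axis 1 1 \<bullet> (second_form (\<lambda>u. G (u, snd x)) (\<nu> x) (fst x) *v axis 1 1)"
      using second_form_eq[OF x, of "\<nu> x" 1 1]
      by (simp add: inner_axis' matrix_vector_mul_component inner_axis)
    also have "\<dots> > 0"
      using convex[OF ut(2,3)] ut(1) by (simp add: pos_def_def axis_eq_0_iff)
    finally have pos: "N x \<bullet> \<nu> x > 0" .
    have "N x - (N x \<bullet> \<nu> x) *\<^sub>R \<nu> x = 0"
    proof (rule orthogonal_to_frame_imp_zero[OF independent_partials[OF immersion[OF ut(2,3)]]])
      show "\<nu> x \<noteq> 0"
        using nn by auto
    qed (simp_all add: F[symmetric] nF NF nn inner_diff_left)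
    then have N_eq: "N x = (N x \<bullet> \<nu> x) *\<^sub>R \<nu> x"
      by simp
    have "N x \<bullet> N x = (N x \<bullet> \<nu> x)\<^sup>2"
      using arg_cong[OF N_eq, of "\<lambda>v. N x \<bullet> v"] by (simp add: power2_eq_square)
    then have "sqrt (N x \<bullet> N x) = N x \<bullet> \<nu> x" "N x \<bullet> N x > 0"
      using pos by simp_all
    then show ?thesis
      using pos arg_cong[OF N_eq, of "\<lambda>v. inverse (N x \<bullet> \<nu> x) *\<^sub>R v"] by simp
  qed
  have "smooth_on Q (\<lambda>x. inverse (sqrt (N x \<bullet> N x)) *\<^sub>R N x)"
    using main by (intro smooth_on_scaleR smooth_on_inverse smooth_on_sqrt smooth_on_inner N) (auto simp: less_le)
  then show ?thesis
    by (rule smooth_on_cong) (use main in auto)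
qed

lemma smooth_weingarten: "smooth_on Q (\<lambda>x. weingarten x $ i $ j)"
proof -
  have h: "smooth_on Q (\<lambda>x. second_form (\<lambda>u. G (u, snd x)) (\<nu> x) (fst x) $ i $ j)" for i j
    by (rule smooth_on_cong[OF smooth_on_minus[OF smooth_on_inner[OF smooth_F(2) smooth_normal]]])
      (simp add: second_form_eq)
  show ?thesis
    unfolding weingarten_def shape_def matrix_matrix_mult_def
    by (simp, intro smooth_on_sum smooth_on_mult h smooth_matrix_inv[OF smooth_first_form invertible_first_form])
qed

lemma smooth_pinching: "smooth_on Q (\<lambda>x. pinching (weingarten x))"
  unfolding pinching_def trace_def matrix_matrix_mult_def power2_eq_square
  by (simp, intro smooth_intros smooth_weingarten)

lemma weingarten_mult:
  assumes "x \<in> Q"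
  shows "- (FF i j x \<bullet> \<nu> x) = (\<Sum>k\<in>UNIV. (F i x \<bullet> F k x) * weingarten x $ k $ j)"
proof -
  have "(\<Sum>k\<in>UNIV. (F i x \<bullet> F k x) * weingarten x $ k $ j) =
    (first_form (\<lambda>u. G (u, snd x)) (fst x) ** weingarten x) $ i $ j"
    by (simp add: matrix_matrix_mult_def first_form_eq[OF assms])
  also have "\<dots> = second_form (\<lambda>u. G (u, snd x)) (\<nu> x) (fst x) $ i $ j"
    by (simp add: weingarten_def shape_def matrix_mul_assoc matrix_inv_inverse invertible_first_form[OF assms])
  finally show ?thesis
    by (simp add: second_form_eq[OF assms])
qed

text \<open>The change of parameters does not involve time, so points still move in the normal
  direction and the new map satisfies the same equation. This permits coordinates adapted to one
  point at one time.\<close>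

lemma reparam:
  assumes V': "open V'" and p: "smooth_on V' p" and sub: "p ` V' \<subseteq> V"
    and J: "\<And>y. y \<in> V' \<Longrightarrow> invertible (jacobian_matrix V' p y)"
  defines "G' \<equiv> \<lambda>x. G (p (fst x), snd x)" and "\<nu>' \<equiv> \<lambda>x. \<nu> (p (fst x), snd x)"
  shows "moving_chart V' I G' \<nu>'"
    and "\<And>y t. y \<in> V' \<Longrightarrow> t \<in> I \<Longrightarrow>
      pinching (shape (\<lambda>y. G' (y, t)) (\<nu>' (y, t)) y) = pinching (weingarten (p y, t))"
proof -
  let ?P = "\<lambda>x. (p (fst x), snd x)"
  have P: "smooth_on (V' \<times> I) ?P"
  proof -
    have "smooth_on (V' \<times> I) (\<lambda>x. p (fst x))"
      by (rule smooth_on_compose[OF p smooth_on_linear[OF bounded_linear_fst]]) auto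
    then have "smooth_on (V' \<times> I) (\<lambda>x. (p (fst x), 0) + (0, snd x))"
      by (intro smooth_on_add smooth_on_bounded_linear[of "\<lambda>x. (x, 0)"]
          smooth_on_bounded_linear[of "\<lambda>x. (0, x)"] smooth_on_linear[OF bounded_linear_snd]
          bounded_linear_intros)
    then show ?thesis
      by simp
  qed
  have Psub: "?P ` (V' \<times> I) \<subseteq> Q"
    using sub by auto
  have py: "p y \<in> V" if "y \<in> V'" for y
    using sub that by auto
  note dom' = smooth_domain_times_interval[OF V' I]
  have slice: "smooth_on V (\<lambda>u. G (u, t))" if "t \<in> I" for t
    by (rule smooth_slice[OF V I G that])
  have normal': "\<nu> (p y, t) \<bullet> partial a (\<lambda>u. G (u, t)) (p y) = 0" if "y \<in> V'" "t \<in> I" for y t a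
    by (rule normal[OF py[OF that(1)] that(2)])
  have inv: "invertible (first_form (\<lambda>u. G (u, t)) (p y))" if "y \<in> V'" "t \<in> I" for y t
    by (rule invertible_pos_def[OF immersion[OF py[OF that(1)] that(2)]])
  have tr: "trace (shape (\<lambda>y. G' (y, t)) (\<nu>' (y, t)) y) = trace (shape (\<lambda>u. G (u, t)) (\<nu> (p y, t)) (p y))"
    and pinch: "pinching (shape (\<lambda>y. G' (y, t)) (\<nu>' (y, t)) y) = pinching (shape (\<lambda>u. G (u, t)) (\<nu> (p y, t)) (p y))"
    if y: "y \<in> V'" "t \<in> I" for y t
    using shape_reparam[OF V V' slice[OF y(2)] p sub y(1) normal'[OF y] J[OF y(1)] inv[OF y]]
    by (simp_all add: G'_def \<nu>'_def)
  show "pinching (shape (\<lambda>y. G' (y, t)) (\<nu>' (y, t)) y) = pinching (weingarten (p y, t))"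
    if y: "y \<in> V'" "t \<in> I" for y t
    by (simp add: weingarten_def pinch[OF y])
  show "moving_chart V' I G' \<nu>'"
  proof
    show "open V'" "convex I" "interior I \<noteq> {}"
      by (fact V' I)+
    show "smooth_on (V' \<times> I) G'"
      unfolding G'_def by (rule smooth_on_compose[OF G P Psub])
    fix y t assume y: "y \<in> V'" "t \<in> I"
    show "norm (\<nu>' (y, t)) = 1"
      using unit[OF py[OF y(1)] y(2)] by (simp add: \<nu>'_def)
    show "\<nu>' (y, t) \<bullet> partial i (\<lambda>y. G' (y, t)) y = 0" for i
      using partial_reparam[OF V V' slice[OF y(2)] p sub y(1), of i]
      by (simp add: G'_def \<nu>'_def inner_sum_right normal'[OF y])
    show "pos_def (first_form (\<lambda>y. G' (y, t)) y)"
      using pos_def_congruence[OF immersion[OF py[OF y(1)] y(2)] J[OF y(1)]]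
        first_form_reparam[OF V V' slice[OF y(2)] p sub y(1)]
      by (simp add: G'_def)
    show "pos_def (second_form (\<lambda>y. G' (y, t)) (\<nu>' (y, t)) y)"
      using pos_def_congruence[OF convex[OF py[OF y(1)] y(2)] J[OF y(1)]]
        second_form_reparam[OF V V' slice[OF y(2)] p sub y(1) normal'[OF y]]
      by (simp add: G'_def \<nu>'_def)
    have "dd (V' \<times> I) time_dir ?P (y, t) = time_dir"
    proof -
      have "(p has_derivative frechet_derivative p (at y)) (at (fst (y, t)))"
        using smooth_on_differentiable[OF V' p y(1)] frechet_derivative_works by auto
      then have "((\<lambda>x. p (fst x)) has_derivative (\<lambda>v. frechet_derivative p (at y) (fst v))) (at (y, t) within V' \<times> I)"
        by (rule has_derivative_compose[rotated]) (auto intro!: derivative_eq_intros)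
      then have "(?P has_derivative (\<lambda>v. (frechet_derivative p (at y) (fst v), snd v))) (at (y, t) within V' \<times> I)"
        by (auto intro!: derivative_eq_intros)
      then have "dd (V' \<times> I) time_dir ?P (y, t) = (frechet_derivative p (at y) 0, 1)"
        using smooth_domain.dd_eqI[OF dom'] y by (fastforce simp: time_dir_def)
      moreover have "frechet_derivative p (at y) 0 = 0"
        using linear_frechet_derivative[OF smooth_on_differentiable[OF V' p y(1)]] linear_0 by blast
      ultimately show ?thesis
        by (simp add: time_dir_def)
    qed
    then have "dd (V' \<times> I) time_dir G' (y, t) = dd Q time_dir G (p y, t)"
      unfolding G'_def using dd_chain[OF smooth_domain_axioms dom' G P Psub, of "(y, t)" time_dir] y by simp
    then show "dd (V' \<times> I) time_dir G' (y, t) =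
      - (trace (shape (\<lambda>y. G' (y, t)) (\<nu>' (y, t)) y) ^ 3) *\<^sub>R \<nu>' (y, t)"
      unfolding tr[OF y] using flow[OF py[OF y(1)] y(2)] by (simp add: \<nu>'_def)
  qed
qed

end

section \<open>Normal coordinates and the local maximum principle\<close>

lemma transpose_mult_mult_inner:
  fixes g :: "real^'n^'n" and v :: "'n \<Rightarrow> real^'n"
  assumes "transpose g = g"
  shows "(transpose (\<chi> a i. v i $ a) ** g ** (\<chi> a i. v i $ a)) $ i $ j = (g *v v i) \<bullet> v j"
proof -
  have "(transpose (\<chi> a i. v i $ a) ** g ** (\<chi> a i. v i $ a)) $ i $ j = v i \<bullet> (g *v v j)"
    unfolding transpose_mult_mult
    by (simp add: inner_vec_def matrix_vector_mult_def sum_distrib_left mult_ac)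
  then show ?thesis
    by (simp add: symmetric_inner[OF assms])
qed

context moving_chart
begin

text \<open>The linear part of \<open>p\<close> sends the axes to \<open>g\<close>-orthonormal
  principal directions, which makes the metric the identity and the Weingarten map diagonal at
  \<open>0\<close>. The quadratic part removes the tangential component of the second derivatives at
  \<open>0\<close>. Only the time \<open>t0\<close> is normalized.\<close>

lemma normal_coordinates:
  assumes u0: "u0 \<in> V" and t0: "t0 \<in> I"
  obtains V' p l
  where "open V'" "0 \<in> V'" "smooth_on V' p" "p ` V' \<subseteq> V" "p 0 = u0"
    "\<And>y. y \<in> V' \<Longrightarrow> invertible (jacobian_matrix V' p y)"
    "\<And>i. l i > 0"
    "\<And>i j. partial i (\<lambda>y. G (p y, t0)) 0 \<bullet> partial j (\<lambda>y. G (p y, t0)) 0 = (if i = j then 1 else 0)"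
    "\<And>i j k. partial j (partial i (\<lambda>y. G (p y, t0))) 0 \<bullet> partial k (\<lambda>y. G (p y, t0)) 0 = 0"
    "shape (\<lambda>y. G (p y, t0)) (\<nu> (u0, t0)) 0 = (\<chi> i j. if i = j then l i else 0)"
proof -
  define Gt where "Gt = (\<lambda>u. G (u, t0))"
  define n where "n = \<nu> (u0, t0)"
  define D where "D x = dd V x Gt u0" for x
  define g where "g = first_form Gt u0"
  define h where "h = second_form Gt n u0"
  note domV = smooth_domain_open[OF V]
  have Gt: "smooth_on V Gt"
    unfolding Gt_def by (rule smooth_slice[OF V I G t0])
  have diff: "Gt differentiable (at u0)"
    by (rule smooth_on_differentiable[OF V Gt u0])
  have g: "pos_def g" and h: "pos_def h"
    using immersion[OF u0 t0] convex[OF u0 t0] by (simp_all add: g_def h_def Gt_def n_def)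
  then have hT: "transpose h = h" and gT: "transpose g = g"
    by (simp_all add: pos_def_def)
  obtain v :: "3 \<Rightarrow> real^3" and l where eig: "\<And>i. h *v v i = (l $ i) *\<^sub>R (g *v v i)"
    and orth: "\<And>i j. (g *v v i) \<bullet> v j = (if i = j then 1 else 0)"
    using principal_frame[of Gt u0 n] g hT unfolding g_def[symmetric] h_def[symmetric] by metis
  have linD: "linear D"
    unfolding D_def[abs_def] by (rule smooth_domain.dd_linear[OF domV Gt u0])
  have DD: "D x \<bullet> D y = (g *v x) \<bullet> y" for x y
    unfolding D_def dd_open[OF V u0] g_def by (rule first_form_inner[OF diff])
  define X where "X i j = dd V (v j) (dd V (v i) Gt) u0" for i j
  have X_sym: "X i j = X j i" for i j
    unfolding X_def by (rule smooth_domain.dd_commute[OF domV Gt u0])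
  \<comment> \<open>\<open>w i j\<close> is the vector of parameters whose image under
    \<open>D\<close> is minus the tangential part of \<open>X i j\<close>. Its coefficients are
    inner products because the vectors \<open>D (v m)\<close> are orthonormal.\<close>
  define w where "w i j = - (\<Sum>m\<in>UNIV. (X i j \<bullet> D (v m)) *\<^sub>R v m)" for i j
  have w_sym: "w i j = w j i" for i j
    unfolding w_def X_sym[of i j] ..
  have Dw: "D (w i j) \<bullet> D (v k) = - (X i j \<bullet> D (v k))" for i j k
    unfolding w_def
    by (simp add: linear_neg[OF linD] linear_sum[OF linD] linear_scale[OF linD] inner_sum_left DD orth
        if_distrib cong: if_cong)
  \<comment> \<open>In the double sum every mixed product occurs twice. With the factor
    \<open>1/2\<close> and the symmetry of \<open>w\<close>, the second derivative of
    \<open>p\<close> along axes \<open>i\<close> and \<open>j\<close> is exactly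
    \<open>w i j\<close>.\<close>
  define p where "p y = u0 + (\<Sum>i\<in>UNIV. y $ i *\<^sub>R v i) +
    (\<Sum>i\<in>UNIV. \<Sum>j\<in>UNIV. (1 / 2 * (y $ i * y $ j)) *\<^sub>R w i j)" for y
  have smooth_nth: "smooth_on S (\<lambda>y :: real^3. y $ i)" for S i
    by (rule smooth_on_linear[OF bounded_linear_vec_nth])
  have smooth_p: "smooth_on S p" for S
    unfolding p_def[abs_def] by (intro smooth_intros smooth_nth)
  have nth: "((\<lambda>y. y $ i) has_derivative (\<lambda>d. d $ i)) F" for i :: 3 and F :: "(real^3) filter"
    by (rule bounded_linear_imp_has_derivative[OF bounded_linear_vec_nth])
  define dp where "dp y d = (\<Sum>i\<in>UNIV. d $ i *\<^sub>R v i) +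
    (\<Sum>i\<in>UNIV. \<Sum>j\<in>UNIV. (1 / 2 * (y $ i * d $ j + d $ i * y $ j)) *\<^sub>R w i j)" for y d
  have dp: "(p has_derivative dp y) (at y within S)" for y S
  proof -
    have "(p has_derivative (\<lambda>d. 0 + (\<Sum>i\<in>UNIV. d $ i *\<^sub>R v i) +
        (\<Sum>i\<in>UNIV. \<Sum>j\<in>UNIV. (1 / 2 * (y $ i * d $ j + d $ i * y $ j)) *\<^sub>R w i j))) (at y within S)"
      unfolding p_def[abs_def]
      by (intro has_derivative_add has_derivative_sum has_derivative_const has_derivative_scaleR_left
          has_derivative_mult_right has_derivative_mult nth)
    then show ?thesis
      by (simp add: dp_def[abs_def])
  qed
  have dp_axis: "dp y (axis k 1) = v k + (\<Sum>j\<in>UNIV. y $ j *\<^sub>R w k j)" for y k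
  proof -
    have "(\<Sum>i\<in>UNIV. axis k (1::real) $ i *\<^sub>R v i) = v k"
      by (simp add: axis_def if_distrib[of "\<lambda>x. x *\<^sub>R _"] cong: if_cong)
    moreover have "(\<Sum>i\<in>UNIV. \<Sum>j\<in>UNIV. (1 / 2 * (y $ i * axis k 1 $ j + axis k 1 $ i * y $ j)) *\<^sub>R w i j) =
      (\<Sum>i\<in>UNIV. \<Sum>j\<in>UNIV. (if j = k then (1 / 2 * y $ i) *\<^sub>R w i k else 0) +
        (if i = k then (1 / 2 * y $ j) *\<^sub>R w k j else 0))"
      by (intro sum.cong refl) (auto simp: axis_def algebra_simps)
    moreover have "\<dots> = (\<Sum>i\<in>UNIV. (1 / 2 * y $ i) *\<^sub>R w i k) + (\<Sum>j\<in>UNIV. (1 / 2 * y $ j) *\<^sub>R w k j)"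
    proof -
      have "(\<Sum>i\<in>UNIV. \<Sum>j\<in>UNIV. (if i = k then (1 / 2 * y $ j) *\<^sub>R w k j else 0)) =
        (\<Sum>j\<in>UNIV. \<Sum>i\<in>UNIV. (if i = k then (1 / 2 * y $ j) *\<^sub>R w k j else 0))"
        by (rule sum.swap)
      then show ?thesis
        by (simp add: sum.distrib)
    qed
    moreover have "\<dots> = (\<Sum>j\<in>UNIV. y $ j *\<^sub>R w k j)"
      unfolding w_sym[of _ k] by (simp flip: sum.distrib scaleR_add_left)
    ultimately show ?thesis
      by (simp add: dp_def)
  qed
  \<comment> \<open>The Jacobian of \<open>p\<close> in closed form, written down before the domain
    is known, so that \<open>V'\<close> can be cut out by
    \<open>det (J y) \<noteq> 0\<close>.\<close>
  define J :: "real^3 \<Rightarrow> real^3^3" where "J y = (\<chi> a i. (v i + (\<Sum>j\<in>UNIV. y $ j *\<^sub>R w i j)) $ a)" for y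
  define V' where "V' = p -` V \<inter> (\<lambda>y. det (J y)) -` (- {0})"
  have "continuous_on UNIV p"
    by (rule smooth_on_imp_continuous_on[OF smooth_p])
  moreover have "continuous_on UNIV (\<lambda>y. det (J y))"
  proof (rule smooth_on_imp_continuous_on)
    show "smooth_on UNIV (\<lambda>y. det (J y))"
      unfolding det_3 J_def by (simp, intro smooth_intros smooth_nth)
  qed
  ultimately have V': "open V'"
    unfolding V'_def using V by (intro open_Int open_vimage) auto
  note domV' = smooth_domain_open[OF V']
  have p0: "p 0 = u0"
    by (simp add: p_def)
  have J0: "J 0 = (\<chi> a i. v i $ a)"
    by (simp add: J_def)
  have JTJ: "(transpose (J 0) ** g ** J 0) = mat 1" "(transpose (J 0) ** h ** J 0) = (\<chi> i j. if i = j then l $ i else 0)"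
    unfolding J0 by (simp_all add: vec_eq_iff transpose_mult_mult_inner[OF gT]
        transpose_mult_mult_inner[OF hT] eig orth mat_def)
  have "invertible (J 0)"
    using JTJ(1) by (metis invertible_left_inverse)
  then have zero: "0 \<in> V'"
    using u0 p0 by (simp add: V'_def invertible_det_nz)
  have ddp: "dd V' x p y = dp y x" if "y \<in> V'" for x y
    by (rule smooth_domain.dd_eqI[OF domV' dp that])
  have jac: "jacobian_matrix V' p y = J y" if "y \<in> V'" for y
    by (simp add: jacobian_matrix_def J_def ddp[OF that] dp_axis)
  have sub: "p ` V' \<subseteq> V"
    by (auto simp: V'_def)
  have n: "n \<bullet> partial a Gt (p 0) = 0" for a
    unfolding p0 n_def Gt_def by (rule normal[OF u0 t0])
  have ff: "first_form (\<lambda>y. Gt (p y)) 0 = mat 1"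
    using first_form_reparam[OF V V' Gt smooth_p sub zero] JTJ(1)
    unfolding jac[OF zero] p0 g_def[symmetric] by simp
  have sf: "second_form (\<lambda>y. Gt (p y)) n 0 = (\<chi> i j. if i = j then l $ i else 0)"
    using second_form_reparam[OF V V' Gt smooth_p sub zero n] JTJ(2)
    unfolding jac[OF zero] p0 h_def[symmetric] by simp
  have pd: "partial k (\<lambda>y. Gt (p y)) 0 = D (v k)" for k
  proof -
    have "partial k (\<lambda>y. Gt (p y)) 0 = dd V (dd V' (axis k 1) p 0) Gt (p 0)"
      unfolding partial_eq_dd[OF V' zero] by (rule dd_chain[OF domV domV' Gt smooth_p sub zero])
    then show ?thesis
      by (simp add: ddp[OF zero] dp_axis p0 D_def)
  qed
  have pd2: "partial j (partial i (\<lambda>y. Gt (p y))) 0 = X i j + D (w i j)" for i j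
  proof -
    have "partial j (partial i (\<lambda>y. Gt (p y))) 0 =
      (\<Sum>b\<in>Basis. (v i \<bullet> b) *\<^sub>R dd V (v j) (dd V b Gt) u0) + dd V (dd V' (axis j 1) (dd V' (axis i 1) p) 0) Gt u0"
      unfolding partial2_eq_dd[OF V' smooth_on_compose[OF Gt smooth_p sub] zero]
        dd2_chain[OF domV domV' Gt smooth_p sub zero] ddp[OF zero] dp_axis p0 by simp
    also have "(\<Sum>b\<in>Basis. (v i \<bullet> b) *\<^sub>R dd V (v j) (dd V b Gt) u0) = X i j"
    proof -
      have "X i j = dd V (v j) (\<lambda>u. \<Sum>b\<in>Basis. (v i \<bullet> b) *\<^sub>R dd V b Gt u) u0"
        unfolding X_def
        by (rule smooth_domain.dd_cong[OF domV smooth_domain.smooth_dd[OF domV Gt] dd_eq_sum_Basis[OF domV Gt] u0])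
      also have "\<dots> = (\<Sum>b\<in>Basis. dd V (v j) (\<lambda>u. (v i \<bullet> b) *\<^sub>R dd V b Gt u) u0)"
        by (intro smooth_domain.dd_sum[OF domV] smooth_on_scaleR smooth_on_const
            smooth_domain.smooth_dd[OF domV Gt] u0)
      also have "\<dots> = (\<Sum>b\<in>Basis. (v i \<bullet> b) *\<^sub>R dd V (v j) (dd V b Gt) u0)"
        by (intro sum.cong refl smooth_domain.dd_bounded_linear[OF domV bounded_linear_scaleR_right]
            smooth_domain.smooth_dd[OF domV Gt] u0)
      finally show ?thesis ..
    qed
    also have "dd V' (axis j 1) (dd V' (axis i 1) p) 0 = w i j"
    proof -
      have "dd V' (axis j 1) (dd V' (axis i 1) p) 0 = dd V' (axis j 1) (\<lambda>y. v i + (\<Sum>j\<in>UNIV. y $ j *\<^sub>R w i j)) 0"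
        by (rule smooth_domain.dd_cong[OF domV' smooth_domain.smooth_dd[OF domV' smooth_p] _ zero])
          (simp add: ddp dp_axis)
      also have "\<dots> = 0 + (\<Sum>k\<in>UNIV. axis j 1 $ k *\<^sub>R w i k)"
        by (rule smooth_domain.dd_eqI[OF domV' _ zero])
          (intro has_derivative_add has_derivative_const has_derivative_sum has_derivative_scaleR_left nth)
      finally show ?thesis
        by (simp add: axis_def if_distrib[of "\<lambda>x. x *\<^sub>R _"] cong: if_cong)
    qed
    finally show ?thesis
      by (simp add: D_def)
  qed
  show thesis
  proof (rule that[of V' p "\<lambda>i. l $ i"])
    show "invertible (jacobian_matrix V' p y)" if "y \<in> V'" for y
      using that unfolding jac[OF that] by (simp add: V'_def invertible_det_nz)
    show "l $ i > 0" for i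
    proof -
      have "v i \<noteq> 0"
        using orth[of i i] by auto
      then have "v i \<bullet> (h *v v i) > 0"
        using h by (simp add: pos_def_def)
      then show ?thesis
        using orth[of i i] by (simp add: eig inner_commute)
    qed
    show "partial i (\<lambda>y. G (p y, t0)) 0 \<bullet> partial j (\<lambda>y. G (p y, t0)) 0 = (if i = j then 1 else 0)" for i j
      using pd unfolding Gt_def by (simp add: DD orth)
    show "partial j (partial i (\<lambda>y. G (p y, t0))) 0 \<bullet> partial k (\<lambda>y. G (p y, t0)) 0 = 0" for i j k
      using pd pd2 unfolding Gt_def by (simp add: inner_add_left Dw)
    show "shape (\<lambda>y. G (p y, t0)) (\<nu> (u0, t0)) 0 = (\<chi> i j. if i = j then l $ i else 0)"
      using ff sf unfolding Gt_def n_def by (simp add: shape_def matrix_inv_unique_left[of "mat 1" "mat 1"])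
  qed (fact V' zero smooth_p sub p0)+
qed

text \<open>The comparison involves earlier times only, so the derivative is tested from the left
  and obtains a sign instead of vanishing.\<close>

lemma dd_time_nonneg:
  fixes f :: "(real^3) \<times> real \<Rightarrow> real"
  assumes f: "smooth_on Q f" and u: "u \<in> V" and t: "t0 \<in> I" "t \<in> I" "t0 < t"
    and max: "\<And>s. t0 \<le> s \<Longrightarrow> s \<le> t \<Longrightarrow> f (u, s) \<le> f (u, t)"
  shows "dd Q time_dir f (u, t) \<ge> 0"
proof (rule ccontr)
  let ?B = "{t0..t}"
  have B: "?B \<subseteq> I"
    using closed_segment_subset[OF t(1,2) I(1)] t(3) by (simp add: closed_segment_eq_real_ivl)
  have "((\<lambda>s. f (u, s)) has_derivative (\<lambda>h. dd Q (0, h) f (u, t))) (at t within ?B)"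
  proof (rule has_derivative_in_compose2[of Q f "\<lambda>x v. dd Q v f x"])
    show "(\<lambda>s. (u, s)) ` ?B \<subseteq> Q"
      using B u by auto
    show "((\<lambda>s. (u, s)) has_derivative (\<lambda>h. (0, h))) (at t within ?B)"
      by (auto intro!: derivative_eq_intros)
  qed (use smooth_has_derivative[OF f] t in auto)
  moreover have "dd Q (0, h) f (u, t) = dd Q time_dir f (u, t) * h" for h
    using linear_scale[OF dd_linear[OF f, of "(u, t)"], of h time_dir] u t(2) by (simp add: time_dir_def)
  ultimately have "((\<lambda>s. f (u, s)) has_real_derivative dd Q time_dir f (u, t)) (at t within ?B)"
    by (simp add: has_field_derivative_def)
  moreover assume "\<not> dd Q time_dir f (u, t) \<ge> 0"
  ultimately obtain d where d: "d > 0" "\<And>h. 0 < h \<Longrightarrow> t - h \<in> ?B \<Longrightarrow> h < d \<Longrightarrow> f (u, t) < f (u, t - h)"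
    using has_real_derivative_neg_dec_left by (metis not_le)
  define h where "h = min d (t - t0) / 2"
  have "0 < h" "h < d" "h < t - t0"
    using d(1) t(3) by (auto simp: h_def)
  then show False
    using d(2)[of h] max[of "t - h"] by auto
qed

text \<open>If the value at a time \<open>t\<close> after \<open>t0\<close> were not exceeded on
  \<open>V\<close> during \<open>{t0..t}\<close>, the time derivative there would be nonnegative and
  all second derivatives in space nonpositive, so that \<open>L \<ge> 0\<close>. But
  \<open>L\<close> is negative at the starting point and, by continuity, nearby. \<open>N\<close>
  only locates the point in question; competitors range over all of \<open>V\<close>.\<close>

lemma no_late_maximum:
  assumes u0: "u0 \<in> V" and t0: "t0 \<in> I" and P0: "pinching (weingarten (u0, t0)) = 0"
    and le: "\<And>u. u \<in> V \<Longrightarrow> pinching (weingarten (u, t0)) \<le> 0"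
  obtains N \<delta> where "open N" "u0 \<in> N" "N \<subseteq> V" "\<delta> > 0"
    "\<And>u t. u \<in> N \<Longrightarrow> t \<in> I \<Longrightarrow> t0 < t \<Longrightarrow> t < t0 + \<delta> \<Longrightarrow>
      \<exists>u'\<in>V. \<exists>s\<in>{t0..t}. pinching (weingarten (u, t)) < pinching (weingarten (u', s))"
proof -
  obtain V' p l where V': "open V'" "0 \<in> V'" and p: "smooth_on V' p" "p ` V' \<subseteq> V" "p 0 = u0"
    and J: "\<And>y. y \<in> V' \<Longrightarrow> invertible (jacobian_matrix V' p y)" and l: "\<And>i. l i > 0"
    and metric: "\<And>i j. partial i (\<lambda>y. G (p y, t0)) 0 \<bullet> partial j (\<lambda>y. G (p y, t0)) 0 = (if i = j then 1 else 0)"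
    and christoffel: "\<And>i j k. partial j (partial i (\<lambda>y. G (p y, t0))) 0 \<bullet> partial k (\<lambda>y. G (p y, t0)) 0 = 0"
    and shape0: "shape (\<lambda>y. G (p y, t0)) (\<nu> (u0, t0)) 0 = (\<chi> i j. if i = j then l i else 0)"
    by (rule normal_coordinates[OF u0 t0]) (rule that)
  define G' where "G' = (\<lambda>x. G (p (fst x), snd x))"
  define \<nu>' where "\<nu>' = (\<lambda>x. \<nu> (p (fst x), snd x))"
  interpret C: moving_chart V' I G' \<nu>'
    unfolding G'_def \<nu>'_def by (rule reparam(1)[OF V'(1) p(1,2) J])
  have pinch: "pinching (C.weingarten (y, t)) = pinching (weingarten (p y, t))" if "y \<in> V'" "t \<in> I" for y t
    using reparam(2)[OF V'(1) p(1,2) J that] unfolding C.weingarten_def by (simp add: G'_def \<nu>'_def)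
  have x0: "(0, t0) \<in> V' \<times> I"
    using V'(2) t0 by simp
  interpret N: normal_point "V' \<times> I" G' \<nu>' "\<lambda>i j x. C.weingarten x $ i $ j" "(0, t0)" l
  proof
    fix x i j assume x: "x \<in> V' \<times> I"
    then obtain u t where ut: "x = (u, t)" "u \<in> V'" "t \<in> I"
      by auto
    show "\<nu>' x \<bullet> \<nu>' x = 1"
      using C.unit[OF ut(2,3)] ut(1) by (simp add: norm_eq_1)
    show "dd (V' \<times> I) (space_dir i) G' x \<bullet> \<nu>' x = 0"
      using C.normal[OF ut(2,3), of i]
      unfolding partial_slice[OF V'(1) C.I C.G ut(2,3)] ut(1) by (simp add: inner_commute)
    show "- (dd (V' \<times> I) (space_dir j) (dd (V' \<times> I) (space_dir i) G') x \<bullet> \<nu>' x) =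
      (\<Sum>k\<in>UNIV. (dd (V' \<times> I) (space_dir i) G' x \<bullet> dd (V' \<times> I) (space_dir k) G' x) * C.weingarten x $ k $ j)"
      by (rule C.weingarten_mult[OF x])
    show "dd (V' \<times> I) time_dir G' x = - ((\<Sum>i\<in>UNIV. C.weingarten x $ i $ i)^3) *\<^sub>R \<nu>' x"
      using C.flow[OF ut(2,3)] by (simp add: ut(1) C.weingarten_def trace_def)
  next
    show "dd (V' \<times> I) (space_dir i) G' (0, t0) \<bullet> dd (V' \<times> I) (space_dir j) G' (0, t0) = (if i = j then 1 else 0)" for i j
      using metric[of i j] partial_slice[OF V'(1) C.I C.G V'(2) t0] by (simp add: G'_def)
    show "dd (V' \<times> I) (space_dir j) (dd (V' \<times> I) (space_dir i) G') (0, t0) \<bullet>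
      dd (V' \<times> I) (space_dir k) G' (0, t0) = 0" for i j k
      using christoffel[of j i k] partial_slice[OF V'(1) C.I C.G V'(2) t0, of k]
        partial2_slice[OF V'(1) C.I C.G V'(2) t0, of j i] by (simp add: G'_def)
    show "C.weingarten (0, t0) $ i $ j = (if i = j then l i else 0)" for i j
      using shape0 unfolding C.weingarten_def by (simp add: G'_def \<nu>'_def p(3))
  qed (fact C.G C.smooth_normal C.smooth_weingarten x0)+
  have NP: "N.P (y, t) = pinching (weingarten (p y, t))" if "y \<in> V'" "t \<in> I" for y t
    unfolding pinch[OF that, symmetric]
    by (simp add: N.P_def N.S_def N.H_def pinching_def trace_def matrix_matrix_mult_def power2_eq_square)
  \<comment> \<open>The coefficient \<open>3 H\<^sup>2\<close> is the derivative of the speed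
    \<open>H\<^sup>3\<close>. The plain sum of second derivatives represents the Laplacian at
    \<open>(0, t0)\<close>, where the coordinates are normal.\<close>
  define L where "L x = N.D time_dir N.P x - 3 * (N.H x)\<^sup>2 * (\<Sum>k\<in>UNIV. N.D (space_dir k) (N.D (space_dir k) N.P) x)" for x
  have seg: "\<exists>r>0. \<forall>s. \<bar>s\<bar> < r \<longrightarrow> y + s *\<^sub>R axis k 1 \<in> V'" if y: "y \<in> V'" for y and k :: 3
  proof -
    obtain r where "r > 0" "ball y r \<subseteq> V'"
      using V'(1) y open_contains_ball by blast
    then show ?thesis
      by (intro exI[of _ r]) (auto simp: subset_iff dist_norm)
  qed
  have crit: "N.D (space_dir k) N.P (y, t) = 0 \<and> N.D (space_dir k) (N.D (space_dir k) N.P) (y, t) \<le> 0"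
    if y: "y \<in> V'" "t \<in> I" and max: "\<And>y'. y' \<in> V' \<Longrightarrow> N.P (y', t) \<le> N.P (y, t)" for y t k
  proof -
    obtain r where r: "r > 0" "\<And>s. \<bar>s\<bar> < r \<Longrightarrow> y + s *\<^sub>R axis k 1 \<in> V'"
      using seg[OF y(1)] by blast
    have "(y, t) + s *\<^sub>R space_dir k = (y + s *\<^sub>R axis k 1, t)" for s
      by (simp add: space_dir_def)
    then show ?thesis
      using C.local_maximum_dd[OF N.smooth_P r(1), of "(y, t)" "space_dir k"] r(2) y(2) max by simp
  qed
  have "L (0, t0) < 0"
    unfolding L_def
  proof (rule N.heat_P_negative[OF l])
    show "N.P (0, t0) = 0"
      using NP[OF V'(2) t0] P0 by (simp add: p(3))
    show "N.D (space_dir k) N.P (0, t0) = 0" for k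
    proof -
      have "N.P (y', t0) \<le> N.P (0, t0)" if "y' \<in> V'" for y'
        using le[of "p y'"] p(2) that P0 by (auto simp: NP[OF _ t0] V'(2) p(3))
      then show ?thesis
        using crit[OF V'(2) t0] by blast
    qed
  qed
  moreover have "continuous_on (V' \<times> I) L"
    unfolding L_def[abs_def] power2_eq_square
    by (intro smooth_on_imp_continuous_on smooth_intros C.smooth_dd N.smooth_P N.smooth_H)
  ultimately obtain e where e: "e > 0" "\<And>x. x \<in> V' \<times> I \<Longrightarrow> dist x (0, t0) < e \<Longrightarrow> L x < 0"
  proof -
    assume L0: "L (0, t0) < 0" and "continuous_on (V' \<times> I) L"
      and that': "\<And>e. 0 < e \<Longrightarrow> (\<And>x. x \<in> V' \<times> I \<Longrightarrow> dist x (0, t0) < e \<Longrightarrow> L x < 0) \<Longrightarrow> thesis"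
    then obtain e where e: "e > 0" "\<And>x. x \<in> V' \<times> I \<Longrightarrow> dist x (0, t0) < e \<Longrightarrow> dist (L x) (L (0, t0)) < - L (0, t0)"
      using x0 unfolding continuous_on_iff by (metis neg_0_less_iff_less)
    have "L x < 0" if "x \<in> V' \<times> I" "dist x (0, t0) < e" for x
      using e(2)[OF that] by (simp add: dist_real_def abs_less_iff)
    with e(1) show thesis
      by (rule that')
  qed
  \<comment> \<open>One half of \<open>e\<close> is reserved for space and the other half for
    time.\<close>
  obtain r where r: "r > 0" "ball 0 r \<subseteq> V'" "r \<le> e / 2"
  proof -
    obtain r where r: "r > 0" "ball 0 r \<subseteq> V'"
      using V' open_contains_ball by blast
    show ?thesis
    proof (rule that)
      show "min r (e / 2) > 0"
        using r(1) e(1) by simp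
      show "ball 0 (min r (e / 2)) \<subseteq> V'"
        by (rule order_trans[OF subset_ball[OF min.cobounded1] r(2)])
      show "min r (e / 2) \<le> e / 2"
        by (rule min.cobounded2)
    qed
  qed
  \<comment> \<open>The open mapping theorem with a right inverse of the derivative of
    \<open>p\<close> shows that the image of the small ball covers a neighbourhood of
    \<open>u0\<close>; every point of it has a preimage close to \<open>0\<close>.\<close>
  have "u0 \<in> interior (p ` ball 0 r)"
  proof -
    define D where "D = frechet_derivative p (at 0)"
    have D: "(p has_derivative D) (at 0)"
      unfolding D_def using smooth_on_differentiable[OF V'(1) p(1) V'(2)] frechet_derivative_works by blast
    have lin: "linear D"
      by (rule has_derivative_linear[OF D])
    have "D x = jacobian_matrix V' p 0 *v x" for x
    proof -
      have "D x = D (\<Sum>i\<in>UNIV. x $ i *\<^sub>R axis i 1)"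
        using basis_expansion[of x] by (simp add: scalar_mult_eq_scaleR)
      also have "\<dots> = (\<Sum>i\<in>UNIV. x $ i *\<^sub>R D (axis i 1))"
        by (simp add: linear_sum[OF lin] linear_scale[OF lin])
      finally show ?thesis
        by (simp add: jacobian_matrix_def vec_eq_iff matrix_vector_mult_def dd_open[OF V'(1,2)] D_def mult.commute)
    qed
    moreover obtain K where "jacobian_matrix V' p 0 ** K = mat 1"
      using J[OF V'(2)] by (auto simp: invertible_def)
    ultimately have "D \<circ> (\<lambda>x. K *v x) = id"
      by (auto simp: matrix_vector_mul_assoc)
    then have "p 0 \<in> interior (p ` ball 0 r)"
      using r V' by (intro sussmann_open_mapping[OF V'(1) smooth_on_imp_continuous_on[OF p(1)] V'(2) D
            matrix_vector_mul_bounded_linear]) (auto simp: interior_open)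
    then show ?thesis
      by (simp add: p(3))
  qed
  moreover have "interior (p ` ball 0 r) \<subseteq> V"
    using interior_subset r(2) p(2) by blast
  moreover have "\<exists>u'\<in>V. \<exists>s\<in>{t0..t}. pinching (weingarten (u, t)) < pinching (weingarten (u', s))"
    if u: "u \<in> interior (p ` ball 0 r)" and t: "t \<in> I" "t0 < t" "t < t0 + e / 2" for u t
  proof (rule ccontr)
    assume contra: "\<not> ?thesis"
    obtain y where y: "u = p y" "y \<in> ball 0 r"
      using u interior_subset by blast
    have yV: "y \<in> V'"
      using y(2) r(2) by auto
    have sI: "s \<in> I" if "t0 \<le> s" "s \<le> t" for s
      using closed_segment_subset[OF t0 t(1) I(1)] that by (auto simp: closed_segment_eq_real_ivl)
    have max: "N.P (y', s) \<le> N.P (y, t)" if "y' \<in> V'" "t0 \<le> s" "s \<le> t" for y' s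
      using contra that p(2) unfolding NP[OF that(1) sI[OF that(2,3)]] NP[OF yV t(1)] y(1)
      by (force simp: not_less)
    have "dist (y, t) (0, t0) \<le> dist y 0 + dist t t0"
      unfolding dist_Pair_Pair by (rule sqrt_sum_squares_le_sum) auto
    also have "\<dots> < e"
      using y(2) r(3) t by (simp add: dist_real_def dist_commute)
    finally have "L (y, t) < 0"
      using e(2) yV t(1) by auto
    moreover have "N.D time_dir N.P (y, t) \<ge> 0"
      by (rule C.dd_time_nonneg[OF N.smooth_P yV t0 t(1,2)]) (use max yV in auto)
    moreover have "(\<Sum>k\<in>UNIV. N.D (space_dir k) (N.D (space_dir k) N.P) (y, t)) \<le> 0"
    proof (rule sum_nonpos)
      fix k :: 3
      show "N.D (space_dir k) (N.D (space_dir k) N.P) (y, t) \<le> 0"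
        using crit[OF yV t(1), of k] max t(2) by auto
    qed
    then have "3 * (N.H (y, t))\<^sup>2 * (\<Sum>k\<in>UNIV. N.D (space_dir k) (N.D (space_dir k) N.P) (y, t)) \<le> 0"
      by (intro mult_nonneg_nonpos) auto
    ultimately show False
      unfolding L_def by linarith
  qed
  ultimately show ?thesis
    using e(1) by (intro that[of "interior (p ` ball 0 r)" "e / 2"]) auto
qed

end

section \<open>The maximum principle\<close>

text \<open>Needed for transitions between charts, where two parametrizations agree on the open
  overlap only.\<close>

lemma form_cong:
  assumes U: "open U" and F: "smooth_on U F" and eq: "\<And>u. u \<in> U \<Longrightarrow> F u = F' u" and u: "u \<in> U"
  shows "first_form F u = first_form F' u" "second_form F n u = second_form F' n u"
proof -
  note dom = smooth_domain_open[OF U]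
  have F': "smooth_on U F'"
    by (rule smooth_on_cong[OF F eq])
  have "partial i F u = partial i F' u" for i
    unfolding partial_eq_dd[OF U u] by (rule smooth_domain.dd_cong[OF dom F eq u])
  then show "first_form F u = first_form F' u"
    by (simp add: first_form_def)
  have "partial j (partial i F) u = partial j (partial i F') u" for i j
    unfolding partial2_eq_dd[OF U F u] partial2_eq_dd[OF U F' u]
    by (rule smooth_domain.dd2_cong[OF dom F eq u])
  then show "second_form F n u = second_form F' n u"
    by (simp add: second_form_def)
qed

lemma convex_time_interval: "convex (time_interval T)"
proof -
  have "is_interval (time_interval T)"
    unfolding is_interval_1 time_interval_def
    by (auto intro: le_less_trans[OF _ _] simp: ereal_less_eq(3)[symmetric] simp del: ereal_less_eq(3))
  then show ?thesis
    by (simp add: is_interval_convex_1)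
qed

lemma interior_time_interval:
  assumes "0 < T"
  shows "interior (time_interval T) \<noteq> {}"
proof -
  obtain r where r: "0 < ereal r" "ereal r < T"
    using ereal_dense2[OF assms] by auto
  have "{0<..<r} \<subseteq> time_interval T"
    using r by (auto simp: time_interval_def intro: less_trans[of _ "ereal r"])
  then have "{0<..<r} \<subseteq> interior (time_interval T)"
    by (simp add: interior_maximal)
  moreover have "r / 2 \<in> {0<..<r}"
    using r(1) by simp
  ultimately show ?thesis
    by blast
qed

lemma sorted_pinched:
  fixes x y z :: real
  assumes "0 < x" "x \<le> y" "y \<le> z" "z \<le> 2 * x"
  shows "8 * (x\<^sup>2 + y\<^sup>2 + z\<^sup>2) \<le> 3 * (x + y + z)\<^sup>2"
proof -
  \<comment> \<open>The first product is the value of the difference at \<open>y = x\<close>, and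
    the second is the change when \<open>y\<close> grows from there to at most \<open>z\<close>.
    Equality occurs for the ratios 1:1:2.\<close>
  have "0 \<le> (2 * x - z) * (5 * z - 2 * x) + (y - x) * (6 * z - 5 * y + x)"
    using assms by (intro add_nonneg_nonneg mult_nonneg_nonneg) auto
  also have "\<dots> = 3 * (x + y + z)\<^sup>2 - 8 * (x\<^sup>2 + y\<^sup>2 + z\<^sup>2)"
    by (simp add: power2_eq_square algebra_simps)
  finally show ?thesis
    by simp
qed

lemma pinched_initially:
  fixes a b c :: real
  assumes "0 < a" "0 < b" "0 < c"
    "a \<le> 2 * b" "a \<le> 2 * c" "b \<le> 2 * a" "b \<le> 2 * c" "c \<le> 2 * a" "c \<le> 2 * b"
  shows "8 * (a\<^sup>2 + b\<^sup>2 + c\<^sup>2) \<le> 3 * (a + b + c)\<^sup>2"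
proof -
  consider "a \<le> b" "b \<le> c" | "a \<le> c" "c \<le> b" | "b \<le> a" "a \<le> c" | "b \<le> c" "c \<le> a" |
    "c \<le> a" "a \<le> b" | "c \<le> b" "b \<le> a"
    by linarith
  then show ?thesis
    using sorted_pinched[of a b c] sorted_pinched[of a c b] sorted_pinched[of b a c]
      sorted_pinched[of b c a] sorted_pinched[of c a b] sorted_pinched[of c b a] assms
    by cases (auto simp: add_ac)
qed

text \<open>In a principal frame the form is diagonal with the principal curvatures as entries, and
  positivity is carried back by congruence. This puts strict convexity into the shape required by
  \<open>moving_chart\<close>.\<close>

lemma pos_def_second_form:
  assumes g: "pos_def (first_form F u)" and h: "transpose (second_form F n u) = second_form F n u"
    and pos: "\<And>l i. principal_curvatures F n u l \<Longrightarrow> l $ i > 0"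
  shows "pos_def (second_form F n u)"
proof -
  obtain v :: "3 \<Rightarrow> real^3" and l where pc: "principal_curvatures F n u l"
    and eig: "\<And>i. second_form F n u *v v i = (l $ i) *\<^sub>R (first_form F u *v v i)"
    and orth: "\<And>i j. (first_form F u *v v i) \<bullet> v j = (if i = j then 1 else 0)"
    by (rule principal_frame[OF g h]) (rule that)
  define B :: "real^3^3" where "B = (\<chi> a i. v i $ a)"
  define L :: "real^3^3" where "L = (\<chi> i j. if i = j then l $ i else 0)"
  have gB: "transpose B ** first_form F u ** B = mat 1"
    unfolding B_def by (simp add: vec_eq_iff transpose_mult_mult_inner[OF first_form_sym] orth mat_def)
  have hB: "transpose B ** second_form F n u ** B = L"
    unfolding B_def L_def by (simp add: vec_eq_iff transpose_mult_mult_inner[OF h] eig orth)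
  have B: "invertible B"
    using gB by (metis invertible_left_inverse)
  define K where "K = matrix_inv B"
  have K: "B ** K = mat 1" "K ** B = mat 1"
    unfolding K_def using matrix_inv_inverse[OF B] by auto
  have "pos_def L"
  proof -
    have "x \<bullet> (L *v x) > 0" if "x \<noteq> 0" for x
    proof -
      have "\<exists>k. x $ k \<noteq> 0"
        using that by (simp add: vec_eq_iff)
      then obtain k where k: "x $ k \<noteq> 0"
        by (elim exE)
      have "(L *v x) $ i = l $ i * x $ i" for i
        by (simp add: L_def matrix_vector_mult_def if_distrib[of "\<lambda>y. y * _"] cong: if_cong)
      then have "x \<bullet> (L *v x) = (\<Sum>i\<in>UNIV. l $ i * (x $ i)\<^sup>2)"
        by (simp add: inner_vec_def power2_eq_square mult_ac)
      also have "\<dots> > 0"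
        using pos[OF pc] k by (intro sum_pos2[of _ k]) (auto intro: mult_nonneg_nonneg[OF less_imp_le])
      finally show ?thesis .
    qed
    then show ?thesis
      by (auto simp: pos_def_def L_def transpose_def vec_eq_iff)
  qed
  moreover have "invertible K"
    using K by (auto simp: invertible_def)
  ultimately have "pos_def (transpose K ** L ** K)"
    by (rule pos_def_congruence)
  moreover have "transpose K ** L ** K = second_form F n u"
  proof -
    have "transpose K ** L ** K = (transpose (B ** K) ** second_form F n u) ** (B ** K)"
      by (simp add: hB[symmetric] matrix_transpose_mul matrix_mul_assoc)
    then show ?thesis
      by (simp add: K transpose_mat)
  qed
  ultimately show ?thesis
    by simp
qed

text \<open>Identifies the velocity of a single point with the time derivative of the space-time
  map. Uniqueness of the one-variable derivative holds at the initial time too, because no point of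
  \<open>I\<close> is isolated.\<close>

lemma dd_time_eqI:
  fixes V :: "(real^3) set"
  assumes V: "open V" and I: "convex I" "interior I \<noteq> {}" and G: "smooth_on (V \<times> I) G"
    and u: "u \<in> V" and t: "t \<in> I"
    and d: "((\<lambda>s. G (u, s)) has_vector_derivative d) (at t within I)"
  shows "dd (V \<times> I) time_dir G (u, t) = d"
proof -
  interpret smooth_domain "V \<times> I"
    by (rule smooth_domain_times_interval[OF V I])
  have ut: "(u, t) \<in> V \<times> I"
    using u t by simp
  have "((\<lambda>s. G (u, s)) has_derivative (\<lambda>h. dd (V \<times> I) (0, h) G (u, t))) (at t within I)"
  proof (rule has_derivative_in_compose2[of "V \<times> I" G "\<lambda>x v. dd (V \<times> I) v G x"])
    show "((\<lambda>s. (u, s)) has_derivative (\<lambda>h. (0, h))) (at t within I)"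
      by (auto intro!: derivative_eq_intros)
  qed (use smooth_has_derivative[OF G] u t in auto)
  moreover have "dd (V \<times> I) (0, h) G (u, t) = h *\<^sub>R dd (V \<times> I) time_dir G (u, t)" for h
    using linear_scale[OF dd_linear[OF G ut], of h time_dir] by (simp add: time_dir_def)
  ultimately have "((\<lambda>s. G (u, s)) has_vector_derivative dd (V \<times> I) time_dir G (u, t)) (at t within I)"
    by (simp add: has_vector_derivative_def)
  moreover have "at t within I \<noteq> bot"
  proof -
    have "\<not> (\<exists>a. I = {a})"
      using I(2) by (metis empty_interior_finite finite.emptyI finite.insertI)
    then have "t islimpt I"
      using I(1) t convex_connected connected_imp_perfect by blast
    then show ?thesis
      by (simp add: trivial_limit_within)
  qed
  ultimately show ?thesis
    using d vector_derivative_unique_within by blast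
qed

section \<open>The pinching quantity on the manifold\<close>

locale convex_H3_flow =
  fixes M :: "'m::t2_space set" and A :: "'m parametrization set" and T :: ereal
    and X \<nu> :: "real \<Rightarrow> 'm \<Rightarrow> real^4"
  assumes manifold: "closed_3_manifold M A" and flow: "H3_flow M A T X \<nu>"
    and strictly_convex: "\<And>t. t \<in> time_interval T \<Longrightarrow> strictly_convex A (X t) (\<nu> t)"
begin

abbreviation "I \<equiv> time_interval T"

lemma T_pos: "0 < T"
  using flow by (simp add: H3_flow_def)

lemma I: "convex I" "interior I \<noteq> {}"
  by (rule convex_time_interval) (rule interior_time_interval[OF T_pos])

definition pinch :: "((real^3) \<Rightarrow> 'm) \<Rightarrow> real^3 \<Rightarrow> real \<Rightarrow> real" where
  "pinch \<psi> u t = pinching (shape (X t \<circ> \<psi>) (\<nu> t (\<psi> u)) u)"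

context
  fixes U \<psi>
  assumes chart: "(U, \<psi>) \<in> A"
begin

lemma open_chart: "open U"
  and open_image: "openin (top_of_set M) (\<psi> ` U)"
  and homeo: "\<exists>\<phi>. homeomorphism U (\<psi> ` U) \<psi> \<phi>"
  using manifold chart by (auto simp: closed_3_manifold_def)

lemma chart_embedding:
  assumes "t \<in> I"
  shows "smooth_on U (X t \<circ> \<psi>)" "u \<in> U \<Longrightarrow> inj (frechet_derivative (X t \<circ> \<psi>) (at u))"
proof -
  have "smooth_embedding M A (X t)"
    using flow assms by (simp add: H3_flow_def)
  then have "\<forall>(U, \<psi>)\<in>A. smooth_on U (X t \<circ> \<psi>) \<and> (\<forall>u\<in>U. inj (frechet_derivative (X t \<circ> \<psi>) (at u)))"
    by (simp add: smooth_embedding_def)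
  from bspec[OF this chart]
  show "smooth_on U (X t \<circ> \<psi>)" "u \<in> U \<Longrightarrow> inj (frechet_derivative (X t \<circ> \<psi>) (at u))"
    by simp_all
qed

lemmas smooth_space = chart_embedding(1)

lemma chart_normal:
  assumes "t \<in> I" "u \<in> U"
  shows "norm (\<nu> t (\<psi> u)) = 1" "\<nu> t (\<psi> u) \<bullet> partial i (X t \<circ> \<psi>) u = 0"
proof -
  have "outer_unit_normal_field M A (X t) (\<nu> t)"
    using flow assms(1) by (simp add: H3_flow_def)
  from bspec[OF this[unfolded outer_unit_normal_field_def] chart]
  have "outer_unit_normal (X t ` M) (X t \<circ> \<psi>) u (\<nu> t (\<psi> u))"
    using assms(2) by simp
  then show "norm (\<nu> t (\<psi> u)) = 1" "\<nu> t (\<psi> u) \<bullet> partial i (X t \<circ> \<psi>) u = 0"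
    by (simp_all add: outer_unit_normal_def)
qed

lemma chart_immersion:
  assumes "t \<in> I" "u \<in> U"
  shows "pos_def (first_form (X t \<circ> \<psi>) u)"
proof (rule first_form_pos_def)
  show "X t \<circ> \<psi> differentiable at u"
    by (rule smooth_on_differentiable[OF open_chart smooth_space[OF assms(1)] assms(2)])
  show "inj (frechet_derivative (X t \<circ> \<psi>) (at u))"
    by (rule chart_embedding(2)[OF assms])
qed

lemma chart_second_sym:
  assumes "t \<in> I" "u \<in> U"
  shows "transpose (second_form (X t \<circ> \<psi>) n u) = second_form (X t \<circ> \<psi>) n u"
  by (rule second_form_sym[OF open_chart smooth_space[OF assms(1)] assms(2)])

lemma chart_curvatures_pos:
  assumes "t \<in> I" "u \<in> U" "principal_curvatures (X t \<circ> \<psi>) (\<nu> t (\<psi> u)) u l"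
  shows "l $ i > 0"
  using bspec[OF strictly_convex[OF assms(1), unfolded strictly_convex_def] chart] assms(2,3) by simp

lemma moving_chart: "moving_chart U I (\<lambda>(u, t). X t (\<psi> u)) (\<lambda>(u, t). \<nu> t (\<psi> u))"
proof
  show "open U" "convex I" "interior I \<noteq> {}"
    by (fact open_chart I)+
  show G: "smooth_on (U \<times> I) (\<lambda>(u, t). X t (\<psi> u))"
    using flow chart by (auto simp: H3_flow_def)
  fix u t assume u: "u \<in> U" and t: "t \<in> I"
  have G_eq: "(\<lambda>u. case (u, t) of (u, t) \<Rightarrow> X t (\<psi> u)) = X t \<circ> \<psi>"
    by auto
  show "norm (case (u, t) of (u, t) \<Rightarrow> \<nu> t (\<psi> u)) = 1"
    using chart_normal(1)[OF t u] by simp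
  show "(case (u, t) of (u, t) \<Rightarrow> \<nu> t (\<psi> u)) \<bullet> partial i (\<lambda>u. case (u, t) of (u, t) \<Rightarrow> X t (\<psi> u)) u = 0" for i
    unfolding G_eq using chart_normal(2)[OF t u] by simp
  show g: "pos_def (first_form (\<lambda>u. case (u, t) of (u, t) \<Rightarrow> X t (\<psi> u)) u)"
    unfolding G_eq by (rule chart_immersion[OF t u])
  show "pos_def (second_form (\<lambda>u. case (u, t) of (u, t) \<Rightarrow> X t (\<psi> u)) (case (u, t) of (u, t) \<Rightarrow> \<nu> t (\<psi> u)) u)"
    unfolding G_eq unfolding prod.case
    by (rule pos_def_second_form[OF chart_immersion[OF t u] chart_second_sym[OF t u] chart_curvatures_pos[OF t u]])
  have "((\<lambda>s. X s (\<psi> u)) has_vector_derivative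
      - ((mean_curvature (X t \<circ> \<psi>) (\<nu> t (\<psi> u)) u ^ 3) *\<^sub>R \<nu> t (\<psi> u))) (at t within I)"
    using flow chart u t unfolding H3_flow_def by blast
  then have "dd (U \<times> I) time_dir (\<lambda>(u, t). X t (\<psi> u)) (u, t) =
    - ((mean_curvature (X t \<circ> \<psi>) (\<nu> t (\<psi> u)) u ^ 3) *\<^sub>R \<nu> t (\<psi> u))"
    by (intro dd_time_eqI[OF open_chart I G u t]) simp
  then show "dd (U \<times> I) time_dir (\<lambda>(u, t). X t (\<psi> u)) (u, t) =
    - (trace (shape (\<lambda>u. case (u, t) of (u, t) \<Rightarrow> X t (\<psi> u)) (case (u, t) of (u, t) \<Rightarrow> \<nu> t (\<psi> u)) u) ^ 3) *\<^sub>R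
      (case (u, t) of (u, t) \<Rightarrow> \<nu> t (\<psi> u))"
    unfolding G_eq unfolding prod.case mean_curvature_eq_trace[OF chart_immersion[OF t u] chart_second_sym[OF t u]]
    by simp
qed

lemma pinch_eq_weingarten:
  "pinch \<psi> u t = pinching (moving_chart.weingarten (\<lambda>(u, t). X t (\<psi> u)) (\<lambda>(u, t). \<nu> t (\<psi> u)) (u, t))"
  unfolding moving_chart.weingarten_def[OF moving_chart] pinch_def by (simp add: comp_def)

lemma continuous_pinch: "continuous_on (U \<times> I) (\<lambda>(u, t). pinch \<psi> u t)"
proof -
  have "continuous_on (U \<times> I)
      (\<lambda>x. pinching (moving_chart.weingarten (\<lambda>(u, t). X t (\<psi> u)) (\<lambda>(u, t). \<nu> t (\<psi> u)) x))"
    by (rule smooth_on_imp_continuous_on[OF moving_chart.smooth_pinching[OF moving_chart]])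
  moreover have "(\<lambda>(u, t). pinch \<psi> u t) =
      (\<lambda>x. pinching (moving_chart.weingarten (\<lambda>(u, t). X t (\<psi> u)) (\<lambda>(u, t). \<nu> t (\<psi> u)) x))"
  proof
    fix x :: "(real^3) \<times> real"
    show "(case x of (u, t) \<Rightarrow> pinch \<psi> u t) =
      pinching (moving_chart.weingarten (\<lambda>(u, t). X t (\<psi> u)) (\<lambda>(u, t). \<nu> t (\<psi> u)) x)"
      by (cases x) (simp only: pinch_eq_weingarten prod.case)
  qed
  ultimately show ?thesis
    by (simp only:)
qed

end

text \<open>On the overlap the two parametrizations differ by the transition map \<open>p\<close>,
  so invariance under change of parameters applies; the unit normal is attached to the point of
  \<open>M\<close> and is the same for both.\<close>

lemma pinch_chart_independent:
  assumes c: "(U, \<psi>) \<in> A" "(V, \<eta>) \<in> A" and u: "u \<in> U" and v: "v \<in> V" and eq: "\<psi> u = \<eta> v" and t: "t \<in> I"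
  shows "pinch \<psi> u t = pinch \<eta> v t"
proof -
  define V' where "V' = {u \<in> U. \<psi> u \<in> \<eta> ` V}"
  define p where "p = (\<lambda>u. inv_into V \<eta> (\<psi> u))"
  have inj: "inj_on \<eta> V"
  proof -
    obtain \<phi> where "homeomorphism V (\<eta> ` V) \<eta> \<phi>"
      using homeo[OF c(2)] by (elim exE)
    then show ?thesis
      by (intro inj_on_inverseI[of V \<phi>]) (rule homeomorphism_apply1)
  qed
  have p: "smooth_on V' p"
  proof -
    have "\<forall>(U, \<psi>)\<in>A. \<forall>(V, \<eta>)\<in>A. smooth_on {u \<in> U. \<psi> u \<in> \<eta> ` V} (\<lambda>u. inv_into V \<eta> (\<psi> u))"
      using manifold by (simp add: closed_3_manifold_def)
    from bspec[OF this c(1)]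
    have "\<forall>(V, \<eta>)\<in>A. smooth_on {u \<in> U. \<psi> u \<in> \<eta> ` V} (\<lambda>u. inv_into V \<eta> (\<psi> u))"
      by simp
    from bspec[OF this c(2)] show ?thesis
      by (simp add: V'_def p_def)
  qed
  have V': "open V'"
  proof -
    obtain O' where O': "open O'" "\<eta> ` V = M \<inter> O'"
      using open_image[OF c(2)] by (auto simp: openin_open)
    have "\<psi> ` U \<subseteq> M"
      using open_image[OF c(1)] openin_imp_subset by blast
    then have "V' = U \<inter> \<psi> -` O'"
      unfolding V'_def O'(2) by auto
    moreover have "continuous_on U \<psi>"
      using homeo[OF c(1)] homeomorphism_cont1 by blast
    ultimately show ?thesis
      using continuous_open_preimage open_chart[OF c(1)] O'(1) by metis
  qed
  have sub: "p ` V' \<subseteq> V" and inv: "\<And>y. y \<in> V' \<Longrightarrow> \<eta> (p y) = \<psi> y"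
    by (auto simp: V'_def p_def inv_into_into f_inv_into_f)
  have uV': "u \<in> V'"
    using u v eq by (auto simp: V'_def)
  have pu: "p u = v"
    by (simp add: p_def eq inv_into_f_f[OF inj v])
  have eqV': "(X t \<circ> \<eta>) (p y) = (X t \<circ> \<psi>) y" if "y \<in> V'" for y
    using inv[OF that] by simp
  have sm: "smooth_on V' (\<lambda>y. (X t \<circ> \<eta>) (p y))"
    by (rule smooth_on_compose[OF smooth_space[OF c(2) t] p sub])
  have ff: "first_form (\<lambda>y. (X t \<circ> \<eta>) (p y)) u = first_form (X t \<circ> \<psi>) u"
    by (rule form_cong(1)[OF V' sm _ uV']) (rule eqV')
  have sf: "second_form (\<lambda>y. (X t \<circ> \<eta>) (p y)) n u = second_form (X t \<circ> \<psi>) n u" for n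
    by (rule form_cong(2)[OF V' sm _ uV']) (rule eqV')
  have shape_eq: "shape (\<lambda>y. (X t \<circ> \<eta>) (p y)) n u = shape (X t \<circ> \<psi>) n u" for n
    by (simp only: shape_def ff sf)
  have n: "\<nu> t (\<psi> u) \<bullet> partial a (X t \<circ> \<eta>) (p u) = 0" for a
    unfolding pu eq by (rule chart_normal(2)[OF c(2) t v])
  have g: "invertible (first_form (X t \<circ> \<eta>) (p u))"
    unfolding pu by (rule invertible_pos_def[OF chart_immersion[OF c(2) t v]])
  \<comment> \<open>The metric in the chart \<open>\<psi>\<close> is nondegenerate and arises from
    the other one by congruence with the Jacobian, so the determinant of the Jacobian cannot
    vanish.\<close>
  have J: "invertible (jacobian_matrix V' p u)"
  proof -
    have "first_form (X t \<circ> \<psi>) u = transpose (jacobian_matrix V' p u) ** first_form (X t \<circ> \<eta>) (p u) ** jacobian_matrix V' p u"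
      unfolding ff[symmetric]
      by (rule first_form_reparam[OF open_chart[OF c(2)] V' smooth_space[OF c(2) t] p sub uV'])
    then have "invertible (transpose (jacobian_matrix V' p u) ** first_form (X t \<circ> \<eta>) (p u) ** jacobian_matrix V' p u)"
      using invertible_pos_def[OF chart_immersion[OF c(1) t u]] by simp
    then show ?thesis
      by (simp add: invertible_det_nz det_mul)
  qed
  have "pinching (shape (\<lambda>y. (X t \<circ> \<eta>) (p y)) (\<nu> t (\<psi> u)) u) =
    pinching (shape (X t \<circ> \<eta>) (\<nu> t (\<psi> u)) (p u))"
    by (rule shape_reparam(2)[OF open_chart[OF c(2)] V' smooth_space[OF c(2) t] p sub uV' n J g])
  then show ?thesis
    by (simp only: pinch_def shape_eq pu eq)
qed

text \<open>A function on \<open>M\<close> itself, so that compactness can be used across charts.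
  The description is unambiguous by \<open>pinch_chart_independent\<close>.\<close>

definition P :: "'m \<Rightarrow> real \<Rightarrow> real" where
  "P q t = (THE r. \<exists>U \<psi> u. (U, \<psi>) \<in> A \<and> u \<in> U \<and> q = \<psi> u \<and> r = pinch \<psi> u t)"

lemma P_chart:
  assumes "(U, \<psi>) \<in> A" "u \<in> U" "t \<in> I"
  shows "P (\<psi> u) t = pinch \<psi> u t"
  unfolding P_def
proof (rule the_equality)
  show "\<exists>U' \<psi>' u'. (U', \<psi>') \<in> A \<and> u' \<in> U' \<and> \<psi> u = \<psi>' u' \<and> pinch \<psi> u t = pinch \<psi>' u' t"
    using assms by blast
next
  fix r assume "\<exists>U' \<psi>' u'. (U', \<psi>') \<in> A \<and> u' \<in> U' \<and> \<psi> u = \<psi>' u' \<and> r = pinch \<psi>' u' t"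
  then obtain U' \<psi>' u' where "(U', \<psi>') \<in> A" "u' \<in> U'" "\<psi> u = \<psi>' u'" "r = pinch \<psi>' u' t"
    by blast
  then show "r = pinch \<psi> u t"
    using pinch_chart_independent[OF assms(1) _ assms(2) _ _ assms(3)] by metis
qed

lemma chart_at:
  assumes "q \<in> M"
  obtains U \<psi> u where "(U, \<psi>) \<in> A" "u \<in> U" "q = \<psi> u"
  using manifold assms unfolding closed_3_manifold_def by blast

lemma continuous_P: "continuous_on (M \<times> I) (\<lambda>(q, t). P q t)"
  unfolding continuous_on_eq_continuous_within
proof
  fix x assume "x \<in> M \<times> I"
  then obtain q t where x: "x = (q, t)" "q \<in> M" "t \<in> I"
    by auto
  obtain U \<psi> u where c: "(U, \<psi>) \<in> A" "u \<in> U" "q = \<psi> u"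
    using chart_at[OF x(2)] .
  obtain O' where O': "open O'" "\<psi> ` U = M \<inter> O'"
    using open_image[OF c(1)] by (auto simp: openin_open)
  obtain \<phi> where \<phi>: "homeomorphism U (\<psi> ` U) \<psi> \<phi>"
    using homeo[OF c(1)] by blast
  have "continuous_on (\<psi> ` U \<times> I) (\<lambda>y. (\<phi> (fst y), snd y))"
    by (intro continuous_on_Pair continuous_on_compose2[OF homeomorphism_cont2[OF \<phi>]] continuous_on_fst
        continuous_on_snd continuous_on_id) auto
  then have "continuous_on (\<psi> ` U \<times> I) (\<lambda>y. case (\<phi> (fst y), snd y) of (u, t) \<Rightarrow> pinch \<psi> u t)"
    by (rule continuous_on_compose2[OF continuous_pinch[OF c(1)]])
      (use homeomorphism_image2[OF \<phi>] in auto)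
  moreover have "(case (\<phi> (fst y), snd y) of (u, t) \<Rightarrow> pinch \<psi> u t) = (case y of (q, t) \<Rightarrow> P q t)"
    if "y \<in> \<psi> ` U \<times> I" for y
    using that P_chart[OF c(1)] homeomorphism_apply1[OF \<phi>] by auto
  ultimately have "continuous_on (\<psi> ` U \<times> I) (\<lambda>(q, t). P q t)"
    by (simp cong: continuous_on_cong)
  then have "continuous (at x within \<psi> ` U \<times> I) (\<lambda>(q, t). P q t)"
    using x c by (simp add: continuous_on_eq_continuous_within)
  moreover have "at x within \<psi> ` U \<times> I = at x within M \<times> I"
    by (rule at_within_nhd[of _ "O' \<times> UNIV"]) (use O' x c in \<open>auto intro: open_Times\<close>)
  ultimately show "continuous (at x within M \<times> I) (\<lambda>(q, t). P q t)"
    by simp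
qed


text \<open>Where \<open>P < 0\<close> at time \<open>t0\<close>, continuity keeps \<open>P\<close>
  negative for a short time, and the condition \<open>P q' t > 0\<close> makes the claim vacuous.
  Where \<open>P = 0\<close> it is \<open>no_late_maximum\<close> in a chart, carried over to a
  relatively open subset of \<open>M\<close>.\<close>

lemma locally_no_late_maximum:
  assumes q: "q \<in> M" and t0: "t0 \<in> I" and le: "\<And>q. q \<in> M \<Longrightarrow> P q t0 \<le> 0"
  shows "\<exists>O' \<delta>. open O' \<and> q \<in> O' \<and> \<delta> > 0 \<and> (\<forall>q'\<in>M \<inter> O'. \<forall>t\<in>I. t0 < t \<and> t < t0 + \<delta> \<and> P q' t > 0 \<longrightarrow>
    (\<exists>q''\<in>M. \<exists>s\<in>{t0..t}. P q' t < P q'' s))"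
proof (cases "P q t0 < 0")
  case True
  have qt: "(q, t0) \<in> M \<times> I"
    using q t0 by simp
  have "open {..<0::real}"
    by simp
  then obtain B where B: "open B" "(q, t0) \<in> B" "\<And>x. x \<in> B \<Longrightarrow> x \<in> M \<times> I \<Longrightarrow> (case x of (q, t) \<Rightarrow> P q t) < 0"
    using continuous_P True qt unfolding continuous_on_topological by (smt (verit) case_prod_conv lessThan_iff)
  obtain O' R where O': "open O'" "open R" "q \<in> O'" "t0 \<in> R" "O' \<times> R \<subseteq> B"
    using open_prod_elim[OF B(1,2)] by (metis mem_Sigma_iff)
  obtain \<delta> where \<delta>: "\<delta> > 0" "\<And>t. dist t t0 < \<delta> \<Longrightarrow> t \<in> R"
    using O'(2,4) open_dist by metis
  have "P q' t < 0" if "q' \<in> M \<inter> O'" "t \<in> I" "t0 < t" "t < t0 + \<delta>" for q' t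
  proof -
    have "t \<in> R"
      using that(3,4) by (intro \<delta>(2)) (simp add: dist_real_def)
    then show ?thesis
      using B(3)[of "(q', t)"] O'(5) that(1,2) by auto
  qed
  then show ?thesis
    using O'(1,3) \<delta>(1) by (intro exI[of _ O'] exI[of _ \<delta>]) force
next
  case False
  obtain U \<psi> u where c: "(U, \<psi>) \<in> A" "u \<in> U" "q = \<psi> u"
    using chart_at[OF q] .
  let ?W = "moving_chart.weingarten (\<lambda>(u, t). X t (\<psi> u)) (\<lambda>(u, t). \<nu> t (\<psi> u))"
  note mc = moving_chart[OF c(1)]
  have image: "\<psi> ` U \<subseteq> M"
    using open_image[OF c(1)] by (rule openin_imp_subset)
  have PW: "P (\<psi> u) t = pinching (?W (u, t))" if "u \<in> U" "t \<in> I" for u t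
    unfolding P_chart[OF c(1) that] by (rule pinch_eq_weingarten[OF c(1)])
  have W0: "pinching (?W (u, t0)) = 0"
    using False le[OF q] PW[OF c(2) t0] c(3) by simp
  have Wle: "pinching (?W (u', t0)) \<le> 0" if "u' \<in> U" for u'
    using le[of "\<psi> u'"] PW[OF that t0] image that by auto
  obtain N \<delta> where N: "open N" "u \<in> N" "N \<subseteq> U" "\<delta> > 0"
    and late: "\<And>u t. u \<in> N \<Longrightarrow> t \<in> I \<Longrightarrow> t0 < t \<Longrightarrow> t < t0 + \<delta> \<Longrightarrow>
      \<exists>u'\<in>U. \<exists>s\<in>{t0..t}. pinching (?W (u, t)) < pinching (?W (u', s))"
    by (rule moving_chart.no_late_maximum[OF mc c(2) t0 W0 Wle]) (assumption, rule that)
  obtain \<phi> where \<phi>: "homeomorphism U (\<psi> ` U) \<psi> \<phi>"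
    using homeo[OF c(1)] by (elim exE)
  have "openin (top_of_set U) N"
    using N(1,3) by (simp add: openin_open_eq[OF open_chart[OF c(1)]])
  then have "openin (top_of_set (\<psi> ` U)) (\<psi> ` N)"
    by (rule homeomorphism_imp_open_map[OF \<phi>])
  then have "openin (top_of_set M) (\<psi> ` N)"
    using open_image[OF c(1)] by (rule openin_trans)
  then obtain O' where O': "open O'" "\<psi> ` N = M \<inter> O'"
    unfolding openin_open by (elim exE conjE) (rule that)
  have "\<exists>q''\<in>M. \<exists>s\<in>{t0..t}. P q' t < P q'' s"
    if "q' \<in> M \<inter> O'" and t: "t \<in> I" "t0 < t" "t < t0 + \<delta>" for q' t
  proof -
    have "q' \<in> \<psi> ` N"
      using that(1) unfolding O'(2) .
    then obtain y where y: "y \<in> N" "q' = \<psi> y"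
      by (elim imageE) (rule that)
    obtain u' s where u': "u' \<in> U" "s \<in> {t0..t}" "pinching (?W (y, t)) < pinching (?W (u', s))"
      using late[OF y(1) t] by (elim bexE) (rule that)
    have "s \<in> I"
      using closed_segment_subset[OF t0 t(1) I(1)] u'(2) by (auto simp: closed_segment_eq_real_ivl)
    then have "P q' t < P (\<psi> u') s"
      using PW[OF _ t(1), of y] PW[OF u'(1), of s] y N(3) u'(3) by auto
    then show ?thesis
      using image u'(1,2) by blast
  qed
  moreover have "q \<in> O'"
    using O'(2) N(2) c(3) by blast
  ultimately show ?thesis
    using O'(1) N(4) by (intro exI[of _ O'] exI[of _ \<delta>]) blast
qed

lemma P_preserved:
  assumes init: "\<And>q. q \<in> M \<Longrightarrow> P q 0 \<le> 0" and q1: "q1 \<in> M" and t1: "t1 \<in> I"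
  shows "P q1 t1 \<le> 0"
proof (rule ccontr)
  assume bad1: "\<not> P q1 t1 \<le> 0"
  define Bad where "Bad = {t \<in> I. \<exists>q\<in>M. P q t > 0}"
  \<comment> \<open>The infimum of the times at which \<open>P\<close> is positive somewhere. At
    \<open>t0\<close> itself \<open>P \<le> 0\<close> still holds, by the initial condition or
    because positivity would persist to earlier times; yet positive values occur arbitrarily soon
    after \<open>t0\<close>.\<close>
  define t0 where "t0 = Inf Bad"
  have "P q1 t1 > 0"
    using bad1 by simp
  then have Bad: "t1 \<in> Bad" "bdd_below Bad"
    using q1 t1 by (auto simp: Bad_def time_interval_def intro!: bdd_belowI[of _ 0])
  have t0_le: "t0 \<le> t" if "t \<in> Bad" for t
    unfolding t0_def by (rule cInf_lower[OF that Bad(2)])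
  have "t0 \<ge> 0"
    unfolding t0_def using Bad(1) by (intro cInf_greatest) (auto simp: Bad_def time_interval_def)
  have interval: "s \<in> I" if "0 \<le> s" "s \<le> t" "t \<in> I" for s t
    using that by (auto simp: time_interval_def intro: le_less_trans[of "ereal s" "ereal t"])
  have t0: "t0 \<in> I"
    by (rule interval[OF \<open>t0 \<ge> 0\<close> t0_le[OF Bad(1)] t1])
  have le: "P q t0 \<le> 0" if q: "q \<in> M" for q
  proof (rule ccontr)
    assume pos: "\<not> P q t0 \<le> 0"
    then have "t0 \<noteq> 0"
      using init[OF q] by auto
    with \<open>t0 \<ge> 0\<close> have "t0 > 0"
      by simp
    have "continuous_on I (\<lambda>t. (\<lambda>(q, t). P q t) (q, t))"
      by (rule continuous_on_compose2[OF continuous_P]) (use q in \<open>auto intro!: continuous_intros\<close>)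
    then have "continuous_on I (P q)"
      by simp
    then obtain d where d: "d > 0" "\<And>t. t \<in> I \<Longrightarrow> dist t t0 < d \<Longrightarrow> dist (P q t) (P q t0) < P q t0"
      using t0 pos unfolding continuous_on_iff by (metis not_le)
    define t where "t = max 0 (t0 - d / 2)"
    have t: "0 \<le> t" "t < t0" "dist t t0 < d"
      using d(1) \<open>t0 > 0\<close> by (auto simp: t_def dist_real_def)
    have tI: "t \<in> I"
      using interval[OF t(1) _ t0] t(2) by simp
    have "P q t > 0"
      using d(2)[OF tI t(3)] by (simp add: dist_real_def abs_less_iff)
    then have "t \<in> Bad"
      using q tI by (auto simp: Bad_def)
    then show False
      using t0_le t(2) by fastforce
  qed
  have "\<forall>q\<in>M. \<exists>O' \<delta>. open O' \<and> q \<in> O' \<and> \<delta> > 0 \<and> (\<forall>q'\<in>M \<inter> O'. \<forall>t\<in>I. t0 < t \<and> t < t0 + \<delta> \<and> P q' t > 0 \<longrightarrow>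
      (\<exists>q''\<in>M. \<exists>s\<in>{t0..t}. P q' t < P q'' s))"
    using locally_no_late_maximum[OF _ t0 le] by (intro ballI)
  then obtain N \<delta> where N: "\<forall>q\<in>M. open (N q) \<and> q \<in> N q \<and> \<delta> q > 0 \<and> (\<forall>q'\<in>M \<inter> N q. \<forall>t\<in>I. t0 < t \<and> t < t0 + \<delta> q \<and> P q' t > 0 \<longrightarrow>
      (\<exists>q''\<in>M. \<exists>s\<in>{t0..t}. P q' t < P q'' s))"
    unfolding bchoice_iff by (elim exE)
  have compact: "compact M"
    using manifold by (simp add: closed_3_manifold_def)
  have "M \<subseteq> (\<Union>q\<in>M. N q)"
    using N by blast
  then obtain C where C: "C \<subseteq> M" "finite C" "M \<subseteq> (\<Union>q\<in>C. N q)"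
    using compactE_image[OF compact, of M N] N by blast
  have "C \<noteq> {}"
    using C(3) q1 by auto
  \<comment> \<open>Finitely many neighbourhoods cover \<open>M\<close>, which gives a common time
    span \<open>d\<close>. For a bad time \<open>t' < t0 + d\<close> the maximum over
    \<open>M \<times> {t0..t'}\<close> is positive, hence attained after \<open>t0\<close>, and the
    neighbourhood containing its location supplies a strictly larger value.\<close>
  define d where "d = Min (\<delta> ` C)"
  have d: "d > 0" "\<And>q. q \<in> C \<Longrightarrow> d \<le> \<delta> q"
    using C(1,2) \<open>C \<noteq> {}\<close> N by (auto simp: d_def)
  have "Inf Bad < t0 + d"
    using d(1) by (simp add: t0_def)
  then obtain t' where t': "t' \<in> Bad" "t' < t0 + d"
    using cInf_lessD[of Bad] Bad(1) by blast
  then obtain q' where q': "q' \<in> M" "P q' t' > 0" "t' \<in> I"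
    by (auto simp: Bad_def)
  have sub: "{t0..t'} \<subseteq> I"
    using interval[OF _ _ q'(3)] \<open>t0 \<ge> 0\<close> by auto
  have "compact (M \<times> {t0..t'})"
    by (intro compact_Times compact compact_Icc)
  moreover have "M \<times> {t0..t'} \<noteq> {}"
    using q' t0_le[OF t'(1)] by auto
  moreover have "continuous_on (M \<times> {t0..t'}) (\<lambda>(q, t). P q t)"
    using sub by (intro continuous_on_subset[OF continuous_P]) auto
  ultimately have "\<exists>x\<in>M \<times> {t0..t'}. \<forall>y\<in>M \<times> {t0..t'}. (\<lambda>(q, t). P q t) y \<le> (\<lambda>(q, t). P q t) x"
    by (rule continuous_attains_sup)
  then obtain x where x: "x \<in> M \<times> {t0..t'}"
    "\<And>y. y \<in> M \<times> {t0..t'} \<Longrightarrow> (case y of (q, t) \<Rightarrow> P q t) \<le> (case x of (q, t) \<Rightarrow> P q t)"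
    by (elim bexE) (rule that, assumption, erule bspec)
  obtain q t where qt: "x = (q, t)"
    by (cases x)
  have q: "q \<in> M" and t: "t0 \<le> t" "t \<le> t'"
    using x(1) by (auto simp: qt)
  have max: "P q'' s \<le> P q t" if "q'' \<in> M" "s \<in> {t0..t'}" for q'' s
    using x(2)[of "(q'', s)"] that by (simp add: qt)
  have pos: "P q t > 0"
    using max[OF q'(1), of t'] q'(2) t0_le[OF t'(1)] by simp
  then have "t0 < t"
    using le[OF q] t(1) by (cases "t = t0") auto
  obtain k where k: "k \<in> C" "q \<in> N k"
    using C(3) q by blast
  have "t < t0 + \<delta> k"
    using t(2) t'(2) d(2)[OF k(1)] by linarith
  moreover have "t \<in> I"
    using sub t by auto
  moreover have "\<forall>q'\<in>M \<inter> N k. \<forall>t\<in>I. t0 < t \<and> t < t0 + \<delta> k \<and> P q' t > 0 \<longrightarrow>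
      (\<exists>q''\<in>M. \<exists>s\<in>{t0..t}. P q' t < P q'' s)"
    using bspec[OF N subsetD[OF C(1) k(1)]] by (elim conjE)
  ultimately have "\<exists>q''\<in>M. \<exists>s\<in>{t0..t}. P q t < P q'' s"
    using q k(2) \<open>t0 < t\<close> pos by simp
  then obtain q'' s where "q'' \<in> M" "s \<in> {t0..t}" "P q t < P q'' s"
    by (elim bexE) (rule that)
  then show False
    using max[of q'' s] t(2) by auto
qed

lemma P_initially:
  assumes "two_pinched A (X 0) (\<nu> 0)" and q: "q \<in> M"
  shows "P q 0 \<le> 0"
proof -
  have I0: "0 \<in> I"
    using T_pos by (simp add: time_interval_def zero_ereal_def)
  obtain U \<psi> u where c: "(U, \<psi>) \<in> A" "u \<in> U" "q = \<psi> u"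
    using chart_at[OF q] .
  note g = chart_immersion[OF c(1) I0 c(2)]
  obtain v :: "3 \<Rightarrow> real^3" and l where l: "principal_curvatures (X 0 \<circ> \<psi>) (\<nu> 0 (\<psi> u)) u l"
    by (rule principal_frame[OF g chart_second_sym[OF c(1) I0 c(2)]]) (rule that)
  have pos: "l $ i > 0" for i
    by (rule chart_curvatures_pos[OF c(1) I0 c(2) l])
  have ratio: "l $ i / l $ j \<le> 2" for i j
    using bspec[OF assms(1)[unfolded two_pinched_def] c(1)] c(2) l by simp
  have le: "l $ i \<le> 2 * l $ j" for i j
    using ratio[of i j] pos[of j] by (simp add: pos_divide_le_eq)
  have "P q 0 = 8 * ((l $ 1)\<^sup>2 + (l $ 2)\<^sup>2 + (l $ 3)\<^sup>2) - 3 * (l $ 1 + l $ 2 + l $ 3)\<^sup>2"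
    unfolding c(3) P_chart[OF c(1,2) I0] pinch_def pinching_def
      principal_curvatures_trace[OF invertible_pos_def[OF g] l] by (simp add: sum_3)
  then show ?thesis
    using pinched_initially[OF pos pos pos le le le le le le, of 1 2 3] by simp
qed

end

theorem corollary6p2:
  fixes M :: "'m::t2_space set"
    and A :: "'m parametrization set"
    and T :: ereal
    and X \<nu> :: "real \<Rightarrow> 'm \<Rightarrow> real^4"
  assumes "closed_3_manifold M A"
    and "maximal_H3_flow M A T X \<nu>"
    and "\<forall>t\<in>time_interval T. strictly_convex A (X t) (\<nu> t)"
    and "two_pinched A (X 0) (\<nu> 0)"
  shows "\<forall>t\<in>time_interval T. \<forall>(U, \<psi>)\<in>A. \<forall>u\<in>U. \<forall>a b c.
           principal_curvatures (X t \<circ> \<psi>) (\<nu> t (\<psi> u)) u (vector [a, b, c]) \<longrightarrow>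
           phi a b c \<le> 1 / 8"
proof -
  interpret convex_H3_flow M A T X \<nu>
    by standard (use assms in \<open>auto simp: maximal_H3_flow_def\<close>)
  have "phi a b c \<le> 1 / 8"
    if t: "t \<in> time_interval T" and c: "(U, \<psi>) \<in> A" "u \<in> U"
      and pc: "principal_curvatures (X t \<circ> \<psi>) (\<nu> t (\<psi> u)) u (vector [a, b, c])" for t U \<psi> u a b c
  proof -
    have M: "\<psi> u \<in> M"
      using openin_imp_subset[OF open_image[OF c(1)]] c(2) by blast
    have "P (\<psi> u) t \<le> 0"
      by (rule P_preserved[OF P_initially[OF assms(4)] M t])
    then have le: "8 * (a\<^sup>2 + b\<^sup>2 + c\<^sup>2) \<le> 3 * (a + b + c)\<^sup>2"
      unfolding P_chart[OF c t] pinch_def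
        pinching_principal_curvatures[OF invertible_pos_def[OF chart_immersion[OF c(1) t c(2)]] pc] by simp
    have "a > 0" "b > 0" "c > 0"
      using chart_curvatures_pos[OF c(1) t c(2) pc, of 1] chart_curvatures_pos[OF c(1) t c(2) pc, of 2]
        chart_curvatures_pos[OF c(1) t c(2) pc, of 3] by (simp_all add: vector_3)
    then have "(a + b + c)\<^sup>2 > 0"
      by simp
    \<comment> \<open>By this identity \<open>phi a b c \<le> 1/8\<close> reads
      \<open>3 S - H\<^sup>2 \<le> H\<^sup>2 / 8\<close>, with \<open>S\<close> the sum of squares
      and \<open>H\<close> the sum; this is \<open>8 S \<le> 3 H\<^sup>2\<close>.\<close>
    moreover have "(a - b)\<^sup>2 + (a - c)\<^sup>2 + (b - c)\<^sup>2 = 3 * (a\<^sup>2 + b\<^sup>2 + c\<^sup>2) - (a + b + c)\<^sup>2"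
      by (simp add: power2_eq_square algebra_simps)
    ultimately show ?thesis
      using le by (simp add: phi_def pos_divide_le_eq)
  qed
  then show ?thesis
    by auto
qed

end
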